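(* Let $\gamma>1$, let $0<T<\infty$, and let $(\rho_\varepsilon,u_\varepsilon)$ be a family of BD-entropic weak solutions on $(0,T)\times\mathbb{R}^3$ of the scaled quantum Navier--Stokes system with initial data $(\rho_\varepsilon^0,u_\varepsilon^0)$ such that $\|\nabla\sqrt{\rho_\varepsilon^0}\|_{L^2}$, $\|\sqrt{\rho_\varepsilon^0}u_\varepsilon^0\|_{L^2}$, $\|\pi_\varepsilon(\rho_\varepsilon^0)\|_{L^1}$ are bounded uniformly in $\varepsilon$ and $\sqrt{\rho_\varepsilon^0}u_\varepsilon^0\rightharpoonup u_0$ weakly in $L^2(\mathbb{R}^3)$. Assume further that, as $\varepsilon\to0$, $$\sqrt{\rho_\varepsilon^0}u_\varepsilon^0\to u_0=\mathbf{P}(u_0)\ \text{strongly in }L^2(\mathbb{R}^3),\quad \pi_\varepsilon(\rho_\varepsilon^0)\to0\ \text{strongly in }L^1(\mathbb{R}^3),\quad \nabla\sqrt{\rho_\varepsilon^0}\to0\ \text{strongly in }L^2(\mathbb{R}^3).$$ Let $u$ be the weak (weak-$*$) limit in $L^\infty(0,T;L^2(\mathbb{R}^3))$ of a subsequence of $\sqrt{\rho_\varepsilon}u_\varepsilon$ (so that $u$ is a weak solution of the incompressible Navier--Stokes equations $\partial_tu+u\cdot\nabla u+\nabla p=\nu\Delta u$, $\operatorname{div}u=0$, with initial data $\mathbf P(u_0)$). Then $u$ satisfies the energy inequality $$\int_{\mathbb{R}^3}\frac12|u(t)|^2\,dx+\nu\int_0^t\int_{\mathbb{R}^3}|\nabla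 u|^2\,dx\,dt'\le\int_{\mathbb{R}^3}\frac12|u_0|^2\,dx$$ for almost every $t\in[0,T]$.
   Context: Projections: $\mathbf{Q}=\nabla\Delta^{-1}\operatorname{div}$, $\mathbf{P}=\mathbf{I}-\mathbf{Q}$. Scaled quantum Navier--Stokes system (QNS). Fix $\gamma>1$, $\nu,\kappa>0$ and $0<\varepsilon<1$. On $(0,T)\times\mathbb{R}^3$, $$\partial_t\rho_\varepsilon+\operatorname{div}(\rho_\varepsilon u_\varepsilon)=0,$$ $$\partial_t(\rho_\varepsilon u_\varepsilon)+\operatorname{div}(\rho_\varepsilon u_\varepsilon\otimes u_\varepsilon)+\tfrac1{\varepsilon^2}\nabla P(\rho_\varepsilon)=2\nu\operatorname{div}(\rho_\varepsilon \mathbf{D}u_\varepsilon)+2\kappa^2\rho_\varepsilon\nabla\Big(\tfrac{\Delta\sqrt{\rho_\varepsilon}}{\sqrt{\rho_\varepsilon}}\Big),$$ with $P(\rho)=\frac1\gamma\rho^\gamma$, $\mathbf{D}u=\frac12(\nabla u+(\nabla u)^T)$, initial data $\rho_\varepsilon(0)=\rho_\varepsilon^0$, $(\rho_\varepsilon u_\varepsilon)(0)=\rho_\varepsilon^0u_\varepsilon^0$, and far field $\rho_\varepsilon\to1$ as $|x|\to\infty$. Set $\pi_\varepsilon(\rho)=\frac{\rho^\gamma-1-\gamma(\rho-1)}{\varepsilon^2\gamma(\gamma-1)}$. The actual unknowns are $\sqrt{\rho_\varepsilon}\ge0$ and the field denoted $\sqrt{\rho_\varepsilon}u_\varepsilon$;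 $\rho_\varepsilon=(\sqrt{\rho_\varepsilon})^2$, $\rho_\varepsilon u_\varepsilon=\sqrt{\rho_\varepsilon}\,(\sqrt{\rho_\varepsilon}u_\varepsilon)$; $u_\varepsilon$ itself need not be defined on vacuum. Finite energy weak solution on $(0,T)\times\mathbb{R}^3$: (i) $\sqrt{\rho_\varepsilon},\ \sqrt{\rho_\varepsilon}u_\varepsilon,\ \nabla\sqrt{\rho_\varepsilon}\in L^2_{loc}((0,T)\times\mathbb{R}^3)$; (ii) for all $\phi\in C_c^\infty([0,T)\times\mathbb{R}^3)$, $\int\rho_\varepsilon^0\phi(0)\,dx+\int_0^T\!\int\rho_\varepsilon\phi_t+\sqrt{\rho_\varepsilon}\sqrt{\rho_\varepsilon}u_\varepsilon\cdot\nabla\phi\,dx\,dt=0$; (iii) for all $\psi\in C_c^\infty([0,T)\times\mathbb{R}^3;\mathbb{R}^3)$, $$\int\rho_\varepsilon^0u_\varepsilon^0\cdot\psi(0)+\int_0^T\!\!\int\Big[\rho_\varepsilon u_\varepsilon\cdot\psi_t+(\sqrt{\rho_\varepsilon}u_\varepsilon\otimes\sqrt{\rho_\varepsilon}u_\varepsilon):\nabla\psi+\tfrac1{\varepsilon^2}P(\rho_\varepsilon)\operatorname{div}\psi+2\nu(\sqrt{\rho_\varepsilon}u_\varepsilon\otimes\nabla\sqrt{\rho_\varepsilon}+\nabla\sqrt{\rho_\varepsilon}\otimes\sqrt{\rho_\varepsilon}u_\varepsilon):\nabla\psi$$ $$+\nu\rho_\varepsilon u_\varepsilon\cdot(\Delta\psi+\nabla\operatorname{div}\psi)+4\kappa^2(\nabla\sqrt{\rho_\varepsilon}\otimes\nabla\sqrt{\rho_\varepsilon}):\nabla\psi+2\kappa^2\sqrt{\rho_\varepsilon}\nabla\sqrt{\rho_\varepsilon}\cdot\nabla\operatorname{div}\psi\Big]dx\,dt=0;$$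 (iv) there is a tensor $\mathbf{T}_\varepsilon\in L^2((0,T)\times\mathbb{R}^3)$ with $\sqrt{\rho_\varepsilon}\mathbf{T}_\varepsilon=\nabla(\rho_\varepsilon u_\varepsilon)-2\sqrt{\rho_\varepsilon}u_\varepsilon\otimes\nabla\sqrt{\rho_\varepsilon}$ in $\mathcal{D}'((0,T)\times\mathbb{R}^3)$ such that, with $E(t)=\int_{\mathbb{R}^3}\frac12|\sqrt{\rho_\varepsilon}u_\varepsilon|^2+2\kappa^2|\nabla\sqrt{\rho_\varepsilon}|^2+\pi_\varepsilon(\rho_\varepsilon)\,dx$ and $\mathbf{S}_\varepsilon$ the symmetric part of $\mathbf{T}_\varepsilon$, for a.e. $t\in[0,T]$: $E(t)+2\nu\int_0^t\!\int|\mathbf{S}_\varepsilon|^2dx\,ds\le E(0)$. BD-entropic weak solution: a finite energy weak solution such that, for some $c>0$, with $B_\varepsilon(t)=\int\frac12|\sqrt{\rho_\varepsilon}u_\varepsilon+2c\nabla\sqrt{\rho_\varepsilon}|^2+|\nabla\sqrt{\rho_\varepsilon}|^2+\pi_\varepsilon(\rho_\varepsilon)\,dx$ and $\mathbf{A}_\varepsilon$ the antisymmetric part of $\mathbf{T}_\varepsilon$, for a.e. $t\in[0,T]$: $B_\varepsilon(t)+\nu\int_0^t\!\int|\mathbf{A}_\varepsilon|^2+\nu\int_0^t\!\int|\nabla^2\sqrt{\rho_\varepsilon}|^2+\frac{\nu}{4\gamma\varepsilon^2}\int_0^t\!\int|\nabla\rho_\varepsilon^{\gamma/2}|^2\le C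 B_\varepsilon(0)$. Throughout, $c$ and $C$ are independent of $\varepsilon$. *)

theory Defs
  imports "HOL-Analysis.Analysis"
begin

section \<open>Test functions and differential operators\<close>

definition dir_deriv ::
    "'a::real_normed_vector \<Rightarrow> ('a \<Rightarrow> 'b::real_normed_vector) \<Rightarrow> 'a \<Rightarrow> 'b"
  where "dir_deriv d f z = frechet_derivative f (at z) d"

primrec times_continuously_differentiable ::
    "nat \<Rightarrow> ('a::euclidean_space \<Rightarrow> 'b::euclidean_space) \<Rightarrow> bool"
  where
    "times_continuously_differentiable 0 f \<longleftrightarrow> continuous_on UNIV f"
  | "times_continuously_differentiable (Suc k) f \<longleftrightarrow>
       (\<forall>z. f differentiable (at z)) \<and>
       (\<forall>d. times_continuously_differentiable k (dir_deriv d f))"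

definition smooth :: "('a::euclidean_space \<Rightarrow> 'b::euclidean_space) \<Rightarrow> bool"
  where "smooth f \<longleftrightarrow> (\<forall>k. times_continuously_differentiable k f)"

definition test_function ::
    "'a::euclidean_space set \<Rightarrow> ('a \<Rightarrow> 'b::euclidean_space) \<Rightarrow> bool"
  where "test_function \<Omega> \<phi> \<longleftrightarrow>
    smooth \<phi> \<and> compact (closure {z. \<phi> z \<noteq> 0}) \<and> closure {z. \<phi> z \<noteq> 0} \<subseteq> \<Omega>"

type_synonym R3 = "real ^ 3"
type_synonym spacetime = "real \<times> R3"

definition cylinder :: "real \<Rightarrow> spacetime set"
  where "cylinder T = {0<..<T} \<times> UNIV"

text \<open>
  Test functions on $[0,T) \times R^3$, which need not vanish at time $0$, are represented
  by their smooth extensions to negative times, i.e. by test functions on the following set.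
\<close>

definition half_open_cylinder :: "real \<Rightarrow> spacetime set"
  where "half_open_cylinder T = {..<T} \<times> UNIV"

definition dt :: "(spacetime \<Rightarrow> 'b::real_normed_vector) \<Rightarrow> spacetime \<Rightarrow> 'b"
  where "dt = dir_deriv (1, 0)"

definition dx :: "3 \<Rightarrow> (spacetime \<Rightarrow> 'b::real_normed_vector) \<Rightarrow> spacetime \<Rightarrow> 'b"
  where "dx j = dir_deriv (0, axis j 1)"

definition grad_x :: "(spacetime \<Rightarrow> real) \<Rightarrow> spacetime \<Rightarrow> R3"
  where "grad_x \<phi> z = (\<chi> j. dx j \<phi> z)"

text \<open>Convention for gradients of vector fields: the entry $(i,j)$ is $\partial_j \psi_i$.\<close>

definition jacobian_x :: "(spacetime \<Rightarrow> R3) \<Rightarrow> spacetime \<Rightarrow> real ^ 3 ^ 3"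
  where "jacobian_x \<psi> z = (\<chi> i j. dx j \<psi> z $ i)"

definition div_x :: "(spacetime \<Rightarrow> R3) \<Rightarrow> spacetime \<Rightarrow> real"
  where "div_x \<psi> z = (\<Sum>j\<in>UNIV. dx j \<psi> z $ j)"

definition laplace_x :: "(spacetime \<Rightarrow> 'b::real_normed_vector) \<Rightarrow> spacetime \<Rightarrow> 'b"
  where "laplace_x \<psi> z = (\<Sum>j\<in>UNIV. dx j (dx j \<psi>) z)"

definition grad :: "(R3 \<Rightarrow> real) \<Rightarrow> R3 \<Rightarrow> R3"
  where "grad \<phi> x = (\<chi> j. dir_deriv (axis j 1) \<phi> x)"

definition laplace :: "(R3 \<Rightarrow> real) \<Rightarrow> R3 \<Rightarrow> real"
  where "laplace \<phi> x = (\<Sum>j\<in>UNIV. dir_deriv (axis j 1) (dir_deriv (axis j 1) \<phi>) x)"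

text \<open>
  For matrices, \<open>inner\<close> is the Frobenius product $A : B$ and \<open>norm\<close> the Frobenius norm.
\<close>

definition tensor :: "R3 \<Rightarrow> R3 \<Rightarrow> real ^ 3 ^ 3"
  where "tensor a b = (\<chi> i j. a $ i * b $ j)"

definition sym_part :: "real ^ 3 ^ 3 \<Rightarrow> real ^ 3 ^ 3"
  where "sym_part A = (1/2) *\<^sub>R (A + transpose A)"

definition antisym_part :: "real ^ 3 ^ 3 \<Rightarrow> real ^ 3 ^ 3"
  where "antisym_part A = (1/2) *\<^sub>R (A - transpose A)"


section \<open>Lebesgue spaces\<close>

text \<open>
  Elements of Lebesgue spaces are given by Borel representatives; all
  conditions below are invariant under modification on null sets.
\<close>

definition L1_loc :: "'a::euclidean_space set \<Rightarrow> ('a \<Rightarrow> 'b::euclidean_space) \<Rightarrow> bool"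
  where "L1_loc \<Omega> f \<longleftrightarrow> set_borel_measurable lborel \<Omega> f \<and>
    (\<forall>K. compact K \<longrightarrow> K \<subseteq> \<Omega> \<longrightarrow> set_integrable lborel K f)"

definition L2_loc :: "'a::euclidean_space set \<Rightarrow> ('a \<Rightarrow> 'b::euclidean_space) \<Rightarrow> bool"
  where "L2_loc \<Omega> f \<longleftrightarrow> set_borel_measurable lborel \<Omega> f \<and>
    (\<forall>K. compact K \<longrightarrow> K \<subseteq> \<Omega> \<longrightarrow> set_integrable lborel K (\<lambda>z. (norm (f z))\<^sup>2))"

definition L2_on :: "'a::euclidean_space set \<Rightarrow> ('a \<Rightarrow> 'b::euclidean_space) \<Rightarrow> bool"
  where "L2_on \<Omega> f \<longleftrightarrow> set_borel_measurable lborel \<Omega> f \<and>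
    set_integrable lborel \<Omega> (\<lambda>z. (norm (f z))\<^sup>2)"

definition L2_norm :: "(R3 \<Rightarrow> 'b::euclidean_space) \<Rightarrow> real"
  where "L2_norm f = sqrt (LINT x|lborel. (norm (f x))\<^sup>2)"

definition L1_norm :: "(R3 \<Rightarrow> real) \<Rightarrow> real"
  where "L1_norm f = (LINT x|lborel. \<bar>f x\<bar>)"

definition weakly_tends_L2 ::
    "('i \<Rightarrow> R3 \<Rightarrow> R3) \<Rightarrow> (R3 \<Rightarrow> R3) \<Rightarrow> 'i filter \<Rightarrow> bool"
  where "weakly_tends_L2 f l F \<longleftrightarrow> L2_on UNIV l \<and> (\<forall>w. L2_on UNIV w \<longrightarrow>
    ((\<lambda>i. LINT x|lborel. f i x \<bullet> w x) \<longlongrightarrow> (LINT x|lborel. l x \<bullet> w x)) F)"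

text \<open>Elements of $L^\infty(0,T;L^2)$ and its predual $L^1(0,T;L^2)$ are given by jointly
  measurable functions on the cylinder.\<close>

definition Linf_L2 :: "real \<Rightarrow> (spacetime \<Rightarrow> R3) \<Rightarrow> bool"
  where "Linf_L2 T f \<longleftrightarrow> set_borel_measurable lborel (cylinder T) f \<and>
    (\<exists>M. AE t in lborel. t \<in> {0<..<T} \<longrightarrow>
       L2_on UNIV (\<lambda>x. f (t, x)) \<and> L2_norm (\<lambda>x. f (t, x)) \<le> M)"

definition L1_L2 :: "real \<Rightarrow> (spacetime \<Rightarrow> R3) \<Rightarrow> bool"
  where "L1_L2 T f \<longleftrightarrow> set_borel_measurable lborel (cylinder T) f \<and>
    (AE t in lborel. t \<in> {0<..<T} \<longrightarrow> L2_on UNIV (\<lambda>x. f (t, x))) \<and>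
    set_integrable lborel {0<..<T} (\<lambda>t. L2_norm (\<lambda>x. f (t, x)))"

definition weak_star_tends_Linf_L2 ::
    "real \<Rightarrow> ('i \<Rightarrow> spacetime \<Rightarrow> R3) \<Rightarrow> (spacetime \<Rightarrow> R3) \<Rightarrow> 'i filter \<Rightarrow> bool"
  where "weak_star_tends_Linf_L2 T f l F \<longleftrightarrow> Linf_L2 T l \<and> (\<forall>w. L1_L2 T w \<longrightarrow>
    ((\<lambda>i. LINT z:cylinder T|lborel. f i z \<bullet> w z)
      \<longlongrightarrow> (LINT z:cylinder T|lborel. l z \<bullet> w z)) F)"


section \<open>Weak derivatives and the Leray projection\<close>

definition has_weak_deriv ::
    "'a::euclidean_space set \<Rightarrow> 'a \<Rightarrow> ('a \<Rightarrow> real) \<Rightarrow> ('a \<Rightarrow> real) \<Rightarrow> bool"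
  where "has_weak_deriv \<Omega> d f g \<longleftrightarrow> L1_loc \<Omega> f \<and> L1_loc \<Omega> g \<and>
    (\<forall>\<phi>::'a \<Rightarrow> real. test_function \<Omega> \<phi> \<longrightarrow>
      (LINT z:\<Omega>|lborel. f z * dir_deriv d \<phi> z) = - (LINT z:\<Omega>|lborel. g z * \<phi> z))"

definition has_weak_grad :: "(R3 \<Rightarrow> real) \<Rightarrow> (R3 \<Rightarrow> R3) \<Rightarrow> bool"
  where "has_weak_grad f g \<longleftrightarrow> (\<forall>j. has_weak_deriv UNIV (axis j 1) f (\<lambda>x. g x $ j))"

definition has_weak_grad_x :: "real \<Rightarrow> (spacetime \<Rightarrow> real) \<Rightarrow> (spacetime \<Rightarrow> R3) \<Rightarrow> bool"
  where "has_weak_grad_x T f g \<longleftrightarrow>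
    (\<forall>j. has_weak_deriv (cylinder T) (0, axis j 1) f (\<lambda>z. g z $ j))"

definition has_weak_jacobian_x ::
    "real \<Rightarrow> (spacetime \<Rightarrow> R3) \<Rightarrow> (spacetime \<Rightarrow> real ^ 3 ^ 3) \<Rightarrow> bool"
  where "has_weak_jacobian_x T f G \<longleftrightarrow> (\<forall>i. has_weak_grad_x T (\<lambda>z. f z $ i) (\<lambda>z. G z $ i))"

text \<open>
  \<open>is_Q_proj f q\<close> says $q = \nabla p$ with $p = \Delta^{-1} \mathrm{div} f$, i.e. $p$ solves
  $\Delta p = \mathrm{div} f$ in the sense of distributions and $\nabla p \in L^2$.
  For $f \in L^2(R^3)$ there is exactly one such $q$ up to null sets
  (a harmonic function with square integrable gradient is constant).
\<close>

definition is_Q_proj :: "(R3 \<Rightarrow> R3) \<Rightarrow> (R3 \<Rightarrow> R3) \<Rightarrow> bool"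
  where "is_Q_proj f q \<longleftrightarrow> L2_on UNIV q \<and> (\<exists>p. has_weak_grad p q \<and>
    (\<forall>\<phi>. test_function UNIV \<phi> \<longrightarrow>
      (LINT x|lborel. p x * laplace \<phi> x) = - (LINT x|lborel. f x \<bullet> grad \<phi> x)))"

definition is_P_proj :: "(R3 \<Rightarrow> R3) \<Rightarrow> (R3 \<Rightarrow> R3) \<Rightarrow> bool"
  where "is_P_proj f h \<longleftrightarrow> (\<exists>q. is_Q_proj f q \<and> (AE x in lborel. h x = f x - q x))"


section \<open>The scaled quantum Navier--Stokes system\<close>

text \<open>
  The unknowns are $r = \sqrt\rho$ and $w = \sqrt\rho u$ (one symbol, no velocity field being
  needed on vacuum), so that $\rho = r^2$ and $\rho u = r w$; \<open>dr\<close> is the weak gradient of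
  $r$. The initial data \<open>r0\<close>, \<open>w0\<close>, \<open>dr0\<close> are encoded in the same way. The far field
  condition $\rho \to 1$ is contained in the integrability of \<open>pi_pot\<close>, i.e. in the
  finiteness of the energy.
\<close>

definition pressure :: "real \<Rightarrow> real \<Rightarrow> real"
  where "pressure \<gamma> \<rho> = (1 / \<gamma>) * \<rho> powr \<gamma>"

definition pi_pot :: "real \<Rightarrow> real \<Rightarrow> real \<Rightarrow> real"
  where "pi_pot \<gamma> \<epsilon> \<rho> = (\<rho> powr \<gamma> - 1 - \<gamma> * (\<rho> - 1)) / (\<epsilon>\<^sup>2 * \<gamma> * (\<gamma> - 1))"

text \<open>Energy and BD entropy of a state at a fixed time; the integrands are nonnegative and
  the value may be infinite.\<close>

definition energy ::
    "real \<Rightarrow> real \<Rightarrow> real \<Rightarrow> (R3 \<Rightarrow> real) \<Rightarrow> (R3 \<Rightarrow> R3) \<Rightarrow> (R3 \<Rightarrow> R3) \<Rightarrow> ennreal"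
  where "energy \<gamma> \<kappa> \<epsilon> r w dr = (\<integral>\<^sup>+x. ennreal (1/2 * (norm (w x))\<^sup>2
    + 2 * \<kappa>\<^sup>2 * (norm (dr x))\<^sup>2 + pi_pot \<gamma> \<epsilon> ((r x)\<^sup>2)) \<partial>lborel)"

definition BD_entropy ::
    "real \<Rightarrow> real \<Rightarrow> real \<Rightarrow> (R3 \<Rightarrow> real) \<Rightarrow> (R3 \<Rightarrow> R3) \<Rightarrow> (R3 \<Rightarrow> R3) \<Rightarrow> ennreal"
  where "BD_entropy \<gamma> c \<epsilon> r w dr = (\<integral>\<^sup>+x. ennreal (1/2 * (norm (w x + (2 * c) *\<^sub>R dr x))\<^sup>2
    + (norm (dr x))\<^sup>2 + pi_pot \<gamma> \<epsilon> ((r x)\<^sup>2)) \<partial>lborel)"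

definition sq_integral_upto :: "real \<Rightarrow> (spacetime \<Rightarrow> 'b::real_normed_vector) \<Rightarrow> ennreal"
  where "sq_integral_upto t F = (\<integral>\<^sup>+z\<in>cylinder t. ennreal ((norm (F z))\<^sup>2) \<partial>lborel)"

definition initial_state :: "(R3 \<Rightarrow> real) \<Rightarrow> (R3 \<Rightarrow> R3) \<Rightarrow> (R3 \<Rightarrow> R3) \<Rightarrow> bool"
  where "initial_state r0 w0 dr0 \<longleftrightarrow> (AE x in lborel. r0 x \<ge> 0) \<and>
    L2_loc UNIV r0 \<and> L2_loc UNIV w0 \<and> L2_loc UNIV dr0 \<and> has_weak_grad r0 dr0"

definition weak_continuity_eq ::
    "real \<Rightarrow> (R3 \<Rightarrow> real) \<Rightarrow> (spacetime \<Rightarrow> real) \<Rightarrow> (spacetime \<Rightarrow> R3) \<Rightarrow> bool"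
  where "weak_continuity_eq T r0 r w \<longleftrightarrow>
    (\<forall>\<phi>::spacetime \<Rightarrow> real. test_function (half_open_cylinder T) \<phi> \<longrightarrow>
      (let F = (\<lambda>z. (r z)\<^sup>2 * dt \<phi> z + (r z *\<^sub>R w z) \<bullet> grad_x \<phi> z) in
        set_integrable lborel (cylinder T) F \<and>
        (LINT x|lborel. (r0 x)\<^sup>2 * \<phi> (0, x)) + (LINT z:cylinder T|lborel. F z) = 0))"

definition weak_momentum_eq ::
    "real \<Rightarrow> real \<Rightarrow> real \<Rightarrow> real \<Rightarrow> real \<Rightarrow> (R3 \<Rightarrow> real) \<Rightarrow> (R3 \<Rightarrow> R3) \<Rightarrow>
     (spacetime \<Rightarrow> real) \<Rightarrow> (spacetime \<Rightarrow> R3) \<Rightarrow> (spacetime \<Rightarrow> R3) \<Rightarrow> bool"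
  where "weak_momentum_eq \<gamma> \<nu> \<kappa> \<epsilon> T r0 w0 r w dr \<longleftrightarrow>
    (\<forall>\<psi>::spacetime \<Rightarrow> R3. test_function (half_open_cylinder T) \<psi> \<longrightarrow>
      (let F = (\<lambda>z.
          (r z *\<^sub>R w z) \<bullet> dt \<psi> z
          + tensor (w z) (w z) \<bullet> jacobian_x \<psi> z
          + (1 / \<epsilon>\<^sup>2) * pressure \<gamma> ((r z)\<^sup>2) * div_x \<psi> z
          + 2 * \<nu> * ((tensor (w z) (dr z) + tensor (dr z) (w z)) \<bullet> jacobian_x \<psi> z)
          + \<nu> * ((r z *\<^sub>R w z) \<bullet> (laplace_x \<psi> z + grad_x (div_x \<psi>) z))
          + 4 * \<kappa>\<^sup>2 * (tensor (dr z) (dr z) \<bullet> jacobian_x \<psi> z)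
          + 2 * \<kappa>\<^sup>2 * ((r z *\<^sub>R dr z) \<bullet> grad_x (div_x \<psi>) z)) in
        set_integrable lborel (cylinder T) F \<and>
        (LINT x|lborel. (r0 x *\<^sub>R w0 x) \<bullet> \<psi> (0, x)) + (LINT z:cylinder T|lborel. F z) = 0))"

text \<open>$\sqrt\rho \, TT = \nabla(\rho u) - 2 \sqrt\rho u \otimes \nabla\sqrt\rho$ in the sense
  of distributions on $(0,T) \times R^3$.\<close>

definition stress_identity ::
    "real \<Rightarrow> (spacetime \<Rightarrow> real) \<Rightarrow> (spacetime \<Rightarrow> R3) \<Rightarrow> (spacetime \<Rightarrow> R3) \<Rightarrow>
     (spacetime \<Rightarrow> real ^ 3 ^ 3) \<Rightarrow> bool"
  where "stress_identity T r w dr TT \<longleftrightarrow>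
    (\<forall>i j. \<forall>\<phi>::spacetime \<Rightarrow> real. test_function (cylinder T) \<phi> \<longrightarrow>
      (LINT z:cylinder T|lborel. r z * TT z $ i $ j * \<phi> z)
      = - (LINT z:cylinder T|lborel. (r z *\<^sub>R w z) $ i * dx j \<phi> z)
        - (LINT z:cylinder T|lborel. 2 * tensor (w z) (dr z) $ i $ j * \<phi> z))"

text \<open>The tensor \<open>TT\<close> is a parameter because the BD entropy inequality
  refers to the antisymmetric part of the same tensor.\<close>

definition finite_energy_weak_solution_with ::
    "real \<Rightarrow> real \<Rightarrow> real \<Rightarrow> real \<Rightarrow> real \<Rightarrow>
     (R3 \<Rightarrow> real) \<Rightarrow> (R3 \<Rightarrow> R3) \<Rightarrow> (R3 \<Rightarrow> R3) \<Rightarrow>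
     (spacetime \<Rightarrow> real) \<Rightarrow> (spacetime \<Rightarrow> R3) \<Rightarrow> (spacetime \<Rightarrow> R3) \<Rightarrow>
     (spacetime \<Rightarrow> real ^ 3 ^ 3) \<Rightarrow> bool"
  where "finite_energy_weak_solution_with \<gamma> \<nu> \<kappa> \<epsilon> T r0 w0 dr0 r w dr TT \<longleftrightarrow>
    initial_state r0 w0 dr0 \<and>
    (AE z in lborel. z \<in> cylinder T \<longrightarrow> r z \<ge> 0) \<and>
    L2_loc (cylinder T) r \<and> L2_loc (cylinder T) w \<and> L2_loc (cylinder T) dr \<and>
    has_weak_grad_x T r dr \<and>
    weak_continuity_eq T r0 r w \<and>
    weak_momentum_eq \<gamma> \<nu> \<kappa> \<epsilon> T r0 w0 r w dr \<and>
    L2_on (cylinder T) TT \<and> stress_identity T r w dr TT \<and>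
    (AE t in lborel. t \<in> {0..T} \<longrightarrow>
      energy \<gamma> \<kappa> \<epsilon> (\<lambda>x. r (t, x)) (\<lambda>x. w (t, x)) (\<lambda>x. dr (t, x))
        + ennreal (2 * \<nu>) * sq_integral_upto t (\<lambda>z. sym_part (TT z))
      \<le> energy \<gamma> \<kappa> \<epsilon> r0 w0 dr0)"

text \<open>In the BD entropy inequality \<open>H\<close> is the Hessian of $\sqrt\rho$
  and \<open>N\<close> the gradient of $\rho^{\gamma/2}$.\<close>

definition BD_entropic_weak_solution ::
    "real \<Rightarrow> real \<Rightarrow> real \<Rightarrow> real \<Rightarrow> real \<Rightarrow> real \<Rightarrow> real \<Rightarrow>
     (R3 \<Rightarrow> real) \<Rightarrow> (R3 \<Rightarrow> R3) \<Rightarrow> (R3 \<Rightarrow> R3) \<Rightarrow>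
     (spacetime \<Rightarrow> real) \<Rightarrow> (spacetime \<Rightarrow> R3) \<Rightarrow> bool"
  where "BD_entropic_weak_solution \<gamma> \<nu> \<kappa> \<epsilon> T c C r0 w0 dr0 r w \<longleftrightarrow>
    (\<exists>dr TT H N.
      finite_energy_weak_solution_with \<gamma> \<nu> \<kappa> \<epsilon> T r0 w0 dr0 r w dr TT \<and>
      has_weak_jacobian_x T dr H \<and>
      has_weak_grad_x T (\<lambda>z. ((r z)\<^sup>2) powr (\<gamma> / 2)) N \<and>
      (AE t in lborel. t \<in> {0..T} \<longrightarrow>
        BD_entropy \<gamma> c \<epsilon> (\<lambda>x. r (t, x)) (\<lambda>x. w (t, x)) (\<lambda>x. dr (t, x))
          + ennreal \<nu> * sq_integral_upto t (\<lambda>z. antisym_part (TT z))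
          + ennreal \<nu> * sq_integral_upto t H
          + ennreal (\<nu> / (4 * \<gamma> * \<epsilon>\<^sup>2)) * sq_integral_upto t N
        \<le> ennreal C * BD_entropy \<gamma> c \<epsilon> r0 w0 dr0))"

end

theory Submission
  imports Defs
begin

text \<open>
Write \<open>r\<close>, \<open>w\<close>, \<open>dr\<close>, \<open>TT\<close> for $\sqrt\rho$, $\sqrt\rho u$, $\nabla\sqrt\rho$ and the stress tensor of the
solution with parameter $\varepsilon$, and \<open>S\<close> for the symmetric part of \<open>TT\<close>. The data are such
that the initial energies converge to $\frac12 \|u_0\|^2$: the capillary and the pressure part
vanish in the limit. The energy inequality therefore bounds
$\frac12 \|w(t)\|^2 + 2\nu \int_0^t \|S\|^2$ by a quantity that converges to the right-hand side of the
claim, and lower semicontinuity gives the claim once two points are settled: weak limits of \<open>TT\<close>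
are the gradient of \<open>u\<close>, and twice the squared norm of the symmetric part of $\nabla u$ has the
same integral over $(0,t) \times R^3$ as the squared norm of $\nabla u$.

The first point. A tangent line estimate for powers gives
$(r - 1)^2 \le \gamma \varepsilon^2 \pi_\varepsilon(r^2)$, so $r - 1$ is of order $\varepsilon$ in $L^2$. The BD entropy
bounds the Hessian of \<open>r\<close> in $L^2$, and interpolating between $r - 1$ and the Hessian shows
that \<open>dr\<close> tends to zero strongly in $L^2$ (\<open>weak_deriv_L2_tendsto_0\<close>). In the identity
$r \, TT = \nabla (r w) - 2 w \otimes dr$ one may then replace \<open>r\<close> by \<open>1\<close> and \<open>dr\<close> by \<open>0\<close>, so \<open>TT\<close> tends to
$\nabla u$ in the sense of distributions (\<open>stress_identity_limit\<close>). The continuity equation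
becomes $\mathrm{div}\, u = 0$ in the same way (\<open>continuity_equation_limit\<close>).

The second point. $2 |S|^2 = |A|^2 + A : A^T$ for the symmetric part \<open>S\<close> of a matrix \<open>A\<close>, and
$\int \nabla u : (\nabla u)^T = \int (\mathrm{div}\, u)^2 = 0$. The integrations by parts are carried out on difference
quotients in the space directions, under which the cylinder is invariant
(\<open>integral_gradient_transpose_eq_0\<close>).

Weak compactness of $L^2$ is replaced by an elementary device. Among iterated midpoints of the
tails of a bounded sequence one can choose a sequence that converges strongly
(\<open>bounded_tail_hull_converges\<close>): take elements of almost minimal norm and apply the
parallelogram law. Forming midpoints preserves limits of integrals against a fixed function as
well as upper bounds on convex functionals such as the energy, so nothing is lost in passing from
$(w, TT)$ to its midpoints; the limit is $(u, \nabla u)$.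

Test functions enter through their density in $L^2(\Omega)$, which rests on bump functions built from
$e^{-1/x}$ and on the same minimisation argument.
\<close>

section \<open>Square integrable functions\<close>

definition square_integrable :: "'a measure \<Rightarrow> ('a \<Rightarrow> 'b::euclidean_space) \<Rightarrow> bool"
  where "square_integrable M f \<longleftrightarrow>
    f \<in> borel_measurable M \<and> integrable M (\<lambda>x. (norm (f x))\<^sup>2)"

text \<open>
The squared $L^2$ norm; the squared form is the one that enters energies and polarisation identities.
\<close>

definition sq_norm :: "'a measure \<Rightarrow> ('a \<Rightarrow> 'b::euclidean_space) \<Rightarrow> real"
  where "sq_norm M f = (LINT x|M. (norm (f x))\<^sup>2)"

lemma square_integrableD [dest]:
  assumes "square_integrable M f"
  shows "f \<in> borel_measurable M" "integrable M (\<lambda>x. (norm (f x))\<^sup>2)"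
  using assms by (auto simp: square_integrable_def)

lemma sq_norm_nonneg [simp]: "0 \<le> sq_norm M f"
  by (simp add: sq_norm_def)

lemma norm_add_sq_le: "(norm (a + b))\<^sup>2 \<le> 2 * (norm a)\<^sup>2 + 2 * (norm (b::'b::real_inner))\<^sup>2"
proof -
  have "0 \<le> (norm (a - b))\<^sup>2" by simp
  then show ?thesis
    by (simp add: power2_norm_eq_inner inner_simps inner_commute)
qed

lemma square_integrable_add [intro]:
  assumes f: "square_integrable M f" and g: "square_integrable M g"
  shows "square_integrable M (\<lambda>x. f x + g x)"
proof -
  note [measurable] = square_integrableD(1)[OF f] square_integrableD(1)[OF g]
  have "integrable M (\<lambda>x. 2 * (norm (f x))\<^sup>2 + 2 * (norm (g x))\<^sup>2)"
    using square_integrableD(2)[OF f] square_integrableD(2)[OF g] by simp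
  then have "integrable M (\<lambda>x. (norm (f x + g x))\<^sup>2)"
    by (rule Bochner_Integration.integrable_bound) (auto intro!: AE_I2 simp: norm_add_sq_le)
  then show ?thesis by (simp add: square_integrable_def)
qed

lemma square_integrable_scaleR [intro]:
  assumes f: "square_integrable M f"
  shows "square_integrable M (\<lambda>x. c *\<^sub>R f x)"
  using square_integrableD(2)[OF f] borel_measurable_scaleR[OF borel_measurable_const square_integrableD(1)[OF f]]
  by (simp add: square_integrable_def power_mult_distrib)

lemma square_integrable_diff [intro]:
  assumes f: "square_integrable M f" and g: "square_integrable M g"
  shows "square_integrable M (\<lambda>x. f x - g x)"
  using square_integrable_add[OF f square_integrable_scaleR[OF g, of "-1"]] by simp

lemma sq_norm_scaleR: "sq_norm M (\<lambda>x. c *\<^sub>R f x) = c\<^sup>2 * sq_norm M f"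
  by (simp add: sq_norm_def power_mult_distrib)

lemma integrable_inner_square_integrable [intro]:
  assumes f: "square_integrable M f" and g: "square_integrable M g"
  shows "integrable M (\<lambda>x. f x \<bullet> g x)"
proof -
  note [measurable] = square_integrableD(1)[OF f] square_integrableD(1)[OF g]
  have le: "\<bar>f x \<bullet> g x\<bar> \<le> (norm (f x))\<^sup>2 + (norm (g x))\<^sup>2" for x
  proof -
    have "\<bar>f x \<bullet> g x\<bar> \<le> norm (f x) * norm (g x)" by (rule Cauchy_Schwarz_ineq2)
    also have "\<dots> \<le> (norm (f x))\<^sup>2 + (norm (g x))\<^sup>2"
      using sum_squares_bound[of "norm (f x)" "norm (g x)"]
        mult_nonneg_nonneg[OF norm_ge_zero[of "f x"] norm_ge_zero[of "g x"]]
      by (simp only: mult.assoc)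
    finally show ?thesis .
  qed
  have "integrable M (\<lambda>x. (norm (f x))\<^sup>2 + (norm (g x))\<^sup>2)"
    using f g by auto
  then show ?thesis
    by (rule Bochner_Integration.integrable_bound) (auto intro!: AE_I2 simp: le)
qed

lemma sq_norm_add:
  assumes f: "square_integrable M f" and g: "square_integrable M g"
  shows "sq_norm M (\<lambda>x. f x + g x) = sq_norm M f + 2 * (LINT x|M. f x \<bullet> g x) + sq_norm M g"
proof -
  have "sq_norm M (\<lambda>x. f x + g x)
      = (LINT x|M. (norm (f x))\<^sup>2 + 2 * (f x \<bullet> g x) + (norm (g x))\<^sup>2)"
    unfolding sq_norm_def
    by (intro Bochner_Integration.integral_cong) (auto simp: power2_norm_eq_inner inner_simps inner_commute)
  also have "\<dots> = sq_norm M f + 2 * (LINT x|M. f x \<bullet> g x) + sq_norm M g"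
    unfolding sq_norm_def
    using square_integrableD(2)[OF f] square_integrableD(2)[OF g] integrable_inner_square_integrable[OF f g]
    by simp
  finally show ?thesis .
qed

lemma sq_norm_diff:
  assumes f: "square_integrable M f" and g: "square_integrable M g"
  shows "sq_norm M (\<lambda>x. f x - g x) = sq_norm M f - 2 * (LINT x|M. f x \<bullet> g x) + sq_norm M g"
  using sq_norm_add[OF f square_integrable_scaleR[OF g, of "-1"]] sq_norm_scaleR[of M "-1" g] by simp

text \<open>
The quadratic polynomial $s \mapsto \|f + s g\|^2$ is nonnegative.
\<close>

lemma integral_Cauchy_Schwarz:
  assumes f: "square_integrable M f" and g: "square_integrable M g"
  shows "\<bar>LINT x|M. f x \<bullet> g x\<bar> \<le> sqrt (sq_norm M f) * sqrt (sq_norm M g)"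
proof -
  define a b c where "a = sq_norm M f" and "b = (LINT x|M. f x \<bullet> g x)" and "c = sq_norm M g"
  have quad: "0 \<le> a + 2 * s * b + s\<^sup>2 * c" for s
  proof -
    have "0 \<le> sq_norm M (\<lambda>x. f x + s *\<^sub>R g x)" by simp
    also have "\<dots> = a + 2 * (s * b) + s\<^sup>2 * c"
      by (subst sq_norm_add[OF f square_integrable_scaleR[OF g]])
         (simp add: a_def b_def c_def sq_norm_scaleR)
    finally show ?thesis by (simp add: mult.assoc)
  qed
  have a0: "0 \<le> a" and c0: "0 \<le> c" by (simp_all add: a_def c_def)
  have "b\<^sup>2 \<le> a * c"
  proof (cases "c = 0")
    case True
    have "b = 0"
    proof (rule ccontr)
      assume "b \<noteq> 0"
      \<comment> \<open>For this \<open>s\<close> the affine function \<open>a + 2 * s * b\<close> equals \<open>- 1\<close>.\<close>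
      then show False using quad[of "- (a + 1) / (2 * b)"] True a0 by (simp add: field_simps)
    qed
    then show ?thesis using a0 True by simp
  next
    case False
    then have "0 < c" using c0 by simp
    then show ?thesis using quad[of "- b / c"]
      by (simp add: field_simps power2_eq_square)
  qed
  then have "sqrt (b\<^sup>2) \<le> sqrt (a * c)" by (rule real_sqrt_le_mono)
  then show ?thesis by (simp add: a_def b_def c_def real_sqrt_mult)
qed

lemma square_integrable_real_mult:
  fixes f g :: "'a \<Rightarrow> real"
  assumes "square_integrable M f" "square_integrable M g"
  shows "integrable M (\<lambda>x. f x * g x)"
    "\<bar>LINT x|M. f x * g x\<bar> \<le> sqrt (sq_norm M f) * sqrt (sq_norm M g)"
  using integrable_inner_square_integrable[OF assms] integral_Cauchy_Schwarz[OF assms] by auto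

lemma sq_norm_parallelogram:
  assumes f: "square_integrable M f" and g: "square_integrable M g"
  shows "sq_norm M (\<lambda>x. f x - g x)
    = 2 * sq_norm M f + 2 * sq_norm M g - 4 * sq_norm M (\<lambda>x. (1/2) *\<^sub>R (f x + g x))"
  unfolding sq_norm_scaleR sq_norm_add[OF f g] sq_norm_diff[OF f g] by (simp add: power2_eq_square field_simps)

lemma sq_norm_midpoint_le:
  assumes f: "square_integrable M f" and g: "square_integrable M g"
  shows "sq_norm M (\<lambda>z. (1/2) *\<^sub>R (f z + g z)) \<le> 1/2 * sq_norm M f + 1/2 * sq_norm M g"
  using sq_norm_parallelogram[OF f g] sq_norm_nonneg[of M "\<lambda>z. f z - g z"] by linarith

lemma sqrt_sq_norm_triangle:
  assumes f: "square_integrable M f" and g: "square_integrable M g"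
  shows "sqrt (sq_norm M (\<lambda>x. f x + g x)) \<le> sqrt (sq_norm M f) + sqrt (sq_norm M g)"
proof (rule real_le_lsqrt)
  have "sq_norm M (\<lambda>x. f x + g x) \<le> sq_norm M f + 2 * (sqrt (sq_norm M f) * sqrt (sq_norm M g)) + sq_norm M g"
    unfolding sq_norm_add[OF f g] using integral_Cauchy_Schwarz[OF f g] by linarith
  also have "\<dots> = (sqrt (sq_norm M f) + sqrt (sq_norm M g))\<^sup>2"
    by (simp add: power2_sum)
  finally show "sq_norm M (\<lambda>x. f x + g x) \<le> (sqrt (sq_norm M f) + sqrt (sq_norm M g))\<^sup>2" .
qed auto

lemma sq_norm_mono:
  assumes g: "square_integrable M g" and f: "f \<in> borel_measurable M"
    and le: "\<And>z. norm (f z) \<le> norm (g z)"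
  shows "square_integrable M f" "sq_norm M f \<le> sq_norm M g"
proof -
  have le': "(norm (f z))\<^sup>2 \<le> (norm (g z))\<^sup>2" for z using le by (simp add: power_mono)
  have "integrable M (\<lambda>z. (norm (f z))\<^sup>2)"
    by (rule Bochner_Integration.integrable_bound[OF square_integrableD(2)[OF g]])
       (use f le' in \<open>auto intro!: AE_I2\<close>)
  then show "square_integrable M f" using f by (simp add: square_integrable_def)
  then show "sq_norm M f \<le> sq_norm M g"
    unfolding sq_norm_def using g le' by (intro integral_mono) auto
qed

lemma sq_norm_tendsto:
  assumes f: "\<And>n. square_integrable M (f n)" and g: "square_integrable M g"
    and lim: "((\<lambda>n. sq_norm M (\<lambda>x. f n x - g x)) \<longlongrightarrow> 0) F"
  shows "((\<lambda>n. sq_norm M (f n)) \<longlongrightarrow> sq_norm M g) F"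
proof -
  have s: "((\<lambda>n. sqrt (sq_norm M (\<lambda>x. f n x - g x))) \<longlongrightarrow> 0) F"
    using tendsto_real_sqrt[OF lim] by simp
  have "((\<lambda>n. sqrt (sq_norm M (f n)) - sqrt (sq_norm M g)) \<longlongrightarrow> 0) F"
  proof (rule Lim_null_comparison[OF always_eventually s], rule allI)
    fix n
    have d: "square_integrable M (\<lambda>x. f n x - g x)" by (intro square_integrable_diff f g)
    have "sqrt (sq_norm M (\<lambda>x. (-1) *\<^sub>R (f n x - g x) + f n x))
      \<le> sqrt (sq_norm M (\<lambda>x. (-1) *\<^sub>R (f n x - g x))) + sqrt (sq_norm M (f n))"
      by (intro sqrt_sq_norm_triangle square_integrable_scaleR d f)
    then have "sqrt (sq_norm M g) \<le> sqrt (sq_norm M (\<lambda>x. f n x - g x)) + sqrt (sq_norm M (f n))"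
      unfolding sq_norm_scaleR by simp
    moreover have "sqrt (sq_norm M (f n)) \<le> sqrt (sq_norm M (\<lambda>x. f n x - g x)) + sqrt (sq_norm M g)"
      using sqrt_sq_norm_triangle[OF d g] by simp
    ultimately show "norm (sqrt (sq_norm M (f n)) - sqrt (sq_norm M g)) \<le> sqrt (sq_norm M (\<lambda>x. f n x - g x))"
      by simp
  qed
  then have "((\<lambda>n. sqrt (sq_norm M (f n))) \<longlongrightarrow> sqrt (sq_norm M g)) F" by (simp add: Lim_null[symmetric])
  from tendsto_power[OF this, of 2] show ?thesis by simp
qed

text \<open>
Fatou's lemma: balls of $L^2$ are closed under convergence almost everywhere.
\<close>

lemma sq_norm_liminf:
  assumes f: "\<And>n. square_integrable M (f n)" and meas: "g \<in> borel_measurable M"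
    and lim: "AE x in M. (\<lambda>n. f n x) \<longlonglongrightarrow> g x"
    and bnd: "eventually (\<lambda>n. sq_norm M (f n) \<le> B) sequentially"
  shows "square_integrable M g" "sq_norm M g \<le> B"
proof -
  note [measurable] = square_integrableD(1)[OF f] meas
  obtain n0 where "sq_norm M (f n0) \<le> B"
    using bnd by (auto simp: eventually_sequentially)
  then have B0: "0 \<le> B" using sq_norm_nonneg[of M "f n0"] by linarith
  have "(\<integral>\<^sup>+x. ennreal ((norm (g x))\<^sup>2) \<partial>M) = (\<integral>\<^sup>+x. liminf (\<lambda>n. ennreal ((norm (f n x))\<^sup>2)) \<partial>M)"
  proof (rule nn_integral_cong_AE)
    show "AE x in M. ennreal ((norm (g x))\<^sup>2) = liminf (\<lambda>n. ennreal ((norm (f n x))\<^sup>2))"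
      using lim
    proof eventually_elim
      case (elim x)
      then have "(\<lambda>n. ennreal ((norm (f n x))\<^sup>2)) \<longlonglongrightarrow> ennreal ((norm (g x))\<^sup>2)"
        by (intro tendsto_intros)
      then show ?case by (metis lim_imp_Liminf sequentially_bot)
    qed
  qed
  also have "\<dots> \<le> liminf (\<lambda>n. \<integral>\<^sup>+x. ennreal ((norm (f n x))\<^sup>2) \<partial>M)"
    by (rule nn_integral_liminf) simp
  also have "(\<lambda>n. \<integral>\<^sup>+x. ennreal ((norm (f n x))\<^sup>2) \<partial>M) = (\<lambda>n. ennreal (sq_norm M (f n)))"
    unfolding sq_norm_def by (intro ext nn_integral_eq_integral square_integrableD(2)[OF f]) auto
  also have "liminf (\<lambda>n. ennreal (sq_norm M (f n))) \<le> ennreal B"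
    using bnd by (intro Liminf_le) (auto elim!: eventually_mono intro!: ennreal_leI)
  finally have *: "(\<integral>\<^sup>+x. ennreal ((norm (g x))\<^sup>2) \<partial>M) \<le> ennreal B" .
  then have "(\<integral>\<^sup>+x. ennreal ((norm (g x))\<^sup>2) \<partial>M) < \<infinity>"
    using le_less_trans[OF _ ennreal_less_top] by (simp add: infinity_ennreal_def)
  then have int: "integrable M (\<lambda>x. (norm (g x))\<^sup>2)"
    by (intro integrableI_nonneg) (auto)
  then show "square_integrable M g" by (simp add: square_integrable_def meas)
  show "sq_norm M g \<le> B"
    using * B0 unfolding sq_norm_def by (subst (asm) nn_integral_eq_integral[OF int]) auto
qed

text \<open>
Riesz--Fischer. The subsequence with quickly decreasing increments that constructs the limit also converges almost everywhere, which is the form of convergence that passes to time slices.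
\<close>

theorem square_integrable_complete:
  assumes f: "\<And>n. square_integrable M (f n)"
    and Cauchy: "\<And>\<delta>. \<delta> > 0 \<Longrightarrow> \<exists>N. \<forall>m\<ge>N. \<forall>n\<ge>N. sq_norm M (\<lambda>x. f m x - f n x) < \<delta>"
  obtains g r where "square_integrable M g" "(\<lambda>n. sq_norm M (\<lambda>x. f n x - g x)) \<longlonglongrightarrow> 0"
    "strict_mono (r::nat\<Rightarrow>nat)" "AE x in M. (\<lambda>n. f (r n) x) \<longlonglongrightarrow> g x"
proof -
  note [measurable] = square_integrableD(1)[OF f]
  have "\<exists>r::nat\<Rightarrow>nat. \<forall>k. (\<forall>m\<ge>r k. \<forall>n\<ge>r k. sq_norm M (\<lambda>x. f m x - f n x) < (1/4)^k) \<and> r k < r (Suc k)"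
  proof (rule dependent_nat_choice)
    show "\<exists>x. \<forall>m\<ge>x. \<forall>n\<ge>x. sq_norm M (\<lambda>x. f m x - f n x) < (1/4)^0"
      using Cauchy[of "1"] by simp
    fix x k
    obtain N where "\<forall>m\<ge>N. \<forall>n\<ge>N. sq_norm M (\<lambda>x. f m x - f n x) < (1/4)^Suc k"
      using Cauchy[of "(1/4)^Suc k"] by auto
    then show "\<exists>y. (\<forall>m\<ge>y. \<forall>n\<ge>y. sq_norm M (\<lambda>x. f m x - f n x) < (1/4)^Suc k) \<and> x < y"
      by (intro exI[of _ "max N (Suc x)"]) auto
  qed
  then obtain r :: "nat \<Rightarrow> nat" where r: "\<And>k m n. m \<ge> r k \<Longrightarrow> n \<ge> r k \<Longrightarrow> sq_norm M (\<lambda>x. f m x - f n x) < (1/4)^k"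
    and rS: "\<And>k. r k < r (Suc k)" by blast
  have mono: "strict_mono r" using rS by (simp add: strict_mono_Suc_iff)
  define d where "d k x = f (r (Suc k)) x - f (r k) x" for k x
  have d: "square_integrable M (d k)" for k unfolding d_def by (intro square_integrable_diff f)
  note [measurable] = square_integrableD(1)[OF d]
  have dk: "sq_norm M (d k) \<le> (1/4)^k" for k
    using r[of k "r (Suc k)" "r k"] rS[of k] unfolding d_def by simp
  \<comment> \<open>The weights \<open>2 ^ k\<close> turn summability of squared increments into summability
    of the increments: \<open>2 a \<le> 2\<^sup>-\<^sup>k + 2\<^sup>k a\<^sup>2\<close>.\<close>
  have "(\<integral>\<^sup>+x. (\<Sum>k. ennreal (2^k * (norm (d k x))\<^sup>2)) \<partial>M) = (\<Sum>k. \<integral>\<^sup>+x. ennreal (2^k * (norm (d k x))\<^sup>2) \<partial>M)"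
    by (rule nn_integral_suminf) simp
  also have "\<dots> = (\<Sum>k. ennreal (2^k * sq_norm M (d k)))"
  proof (rule suminf_cong)
    fix k
    have "(\<integral>\<^sup>+x. ennreal (2^k * (norm (d k x))\<^sup>2) \<partial>M) = ennreal (LINT x|M. 2^k * (norm (d k x))\<^sup>2)"
      using d[of k] by (intro nn_integral_eq_integral) auto
    then show "(\<integral>\<^sup>+x. ennreal (2^k * (norm (d k x))\<^sup>2) \<partial>M) = ennreal (2^k * sq_norm M (d k))"
      by (simp add: sq_norm_def)
  qed
  also have "\<dots> \<le> (\<Sum>k. ennreal ((1/2)^k))"
  proof (intro suminf_le ennreal_leI)
    fix k
    have "2^k * sq_norm M (d k) \<le> 2^k * (1/4)^k" using dk[of k] by simp
    also have "\<dots> = (1/2::real)^k" by (simp flip: power_mult_distrib)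
    finally show "2^k * sq_norm M (d k) \<le> (1/2)^k" .
  qed auto
  also have "\<dots> = ennreal (\<Sum>k. (1/2)^k)"
    by (intro suminf_ennreal_eq) (auto intro: summable_sums)
  also have "\<dots> < \<infinity>" by simp
  finally have fin: "(\<integral>\<^sup>+x. (\<Sum>k. ennreal (2^k * (norm (d k x))\<^sup>2)) \<partial>M) \<noteq> \<infinity>" by simp
  have "AE x in M. (\<Sum>k. ennreal (2^k * (norm (d k x))\<^sup>2)) \<noteq> \<infinity>"
    using fin by (intro nn_integral_noteq_infinite) auto
  then have conv: "AE x in M. convergent (\<lambda>n. f (r n) x)"
  proof eventually_elim
    case (elim x)
    have s2: "summable (\<lambda>k. 2^k * (norm (d k x))\<^sup>2)"
      using elim by (intro summable_suminf_not_top) (auto simp: infinity_ennreal_def)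
    have "summable (\<lambda>k. norm (d k x))"
    proof (rule summable_comparison_test'[where N=0])
      show "summable (\<lambda>k. (1/2)^k + 2^k * (norm (d k x))\<^sup>2)"
        by (intro summable_add s2) simp
      fix k
      have "0 \<le> ((1/2)^k - norm (d k x))\<^sup>2 * 2^k" by simp
      also have "\<dots> = (1/2)^k * ((1/2)^k * 2^k) - 2 * norm (d k x) * ((1/2)^k * 2^k) + 2^k * (norm (d k x))\<^sup>2"
        by (simp add: power2_eq_square algebra_simps)
      also have "(1/2)^k * 2^k = (1::real)" by (simp flip: power_mult_distrib)
      finally show "norm (norm (d k x)) \<le> (1/2)^k + 2^k * (norm (d k x))\<^sup>2"
        using norm_ge_zero[of "d k x"] unfolding real_norm_def abs_norm_cancel mult_1_right by linarith
    qed
    then have "summable (\<lambda>k. d k x)" by (rule summable_norm_cancel)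
    then have "convergent (\<lambda>n. \<Sum>k<n. d k x)" by (simp add: summable_iff_convergent)
    moreover have "(\<Sum>k<n. d k x) = f (r n) x - f (r 0) x" for n
      unfolding d_def by (induction n) auto
    ultimately have "convergent (\<lambda>n. (f (r n) x - f (r 0) x) + f (r 0) x)"
      by (intro convergent_add convergent_const) simp
    then show ?case by simp
  qed
  define g where "g x = lim (\<lambda>n. f (r n) x)" for x
  have [measurable]: "g \<in> borel_measurable M" unfolding g_def by (rule borel_measurable_lim_metric) measurable
  have lim: "AE x in M. (\<lambda>n. f (r n) x) \<longlonglongrightarrow> g x"
    using conv by eventually_elim (auto simp: g_def convergent_LIMSEQ_iff)
  have small: "square_integrable M (\<lambda>x. g x - f n x) \<and> sq_norm M (\<lambda>x. g x - f n x) \<le> (1/4)^k" if "n \<ge> r k" for n k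
  proof -
    have 1: "square_integrable M (\<lambda>x. f (r m) x - f n x)" for m by (intro square_integrable_diff f)
    have 2: "AE x in M. (\<lambda>m. f (r m) x - f n x) \<longlonglongrightarrow> g x - f n x"
      using lim by eventually_elim (intro tendsto_intros)
    have 3: "eventually (\<lambda>m. sq_norm M (\<lambda>x. f (r m) x - f n x) \<le> (1/4)^k) sequentially"
      unfolding eventually_sequentially
    proof (intro exI[of _ k] allI impI)
      fix m assume "k \<le> m"
      then have "r k \<le> r m" using mono by (simp add: strict_mono_less_eq)
      then show "sq_norm M (\<lambda>x. f (r m) x - f n x) \<le> (1/4)^k" using r[of k "r m" n] that by simp
    qed
    have 4: "(\<lambda>x. g x - f n x) \<in> borel_measurable M" by measurable
    show ?thesis using sq_norm_liminf[OF 1 4 2 3] by simp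
  qed
  have "square_integrable M (\<lambda>x. (g x - f (r 0) x) + f (r 0) x)"
    using small[of 0 "r 0"] by (intro square_integrable_add f) simp
  then have g: "square_integrable M g" by simp
  have "(\<lambda>n. sq_norm M (\<lambda>x. f n x - g x)) \<longlonglongrightarrow> 0"
  proof (rule LIMSEQ_I)
    fix \<delta> :: real assume "\<delta> > 0"
    then obtain k where k: "(1/4)^k < \<delta>" using real_arch_pow_inv[of \<delta> "1/4"] by auto
    have "norm (sq_norm M (\<lambda>x. f n x - g x) - 0) < \<delta>" if "n \<ge> r k" for n
      using small[OF that] k by (simp add: sq_norm_def norm_minus_commute)
    then show "\<exists>no. \<forall>n\<ge>no. norm (sq_norm M (\<lambda>x. f n x - g x) - 0) < \<delta>" by blast
  qed
  then show ?thesis using that g mono lim by blast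
qed

lemma abs_mult_le_bound: "\<bar>y\<bar> \<le> B \<Longrightarrow> \<bar>x * y\<bar> \<le> \<bar>B * x\<bar>" for x y B :: real
  using mult_left_mono[of "\<bar>y\<bar>" "\<bar>B\<bar>" "\<bar>x\<bar>"] by (simp add: abs_mult mult.commute)

lemma integral_triple_product:
  fixes f g :: "'a \<Rightarrow> real"
  assumes f: "square_integrable M f" and g: "square_integrable M g"
    and [measurable]: "\<psi> \<in> borel_measurable M" and bd: "\<And>z. \<bar>\<psi> z\<bar> \<le> B"
  shows "integrable M (\<lambda>z. f z * g z * \<psi> z)"
    "\<bar>LINT z|M. f z * g z * \<psi> z\<bar> \<le> B * sqrt (sq_norm M f) * sqrt (sq_norm M g)"
proof -
  note [measurable] = square_integrableD(1)[OF f] square_integrableD(1)[OF g]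
  have le: "norm (g z * \<psi> z) \<le> norm (B * g z)" for z using abs_mult_le_bound[OF bd] by simp
  have Bg: "square_integrable M (\<lambda>z. B * g z)" using square_integrable_scaleR[OF g, of B] by simp
  have B0: "0 \<le> B" using bd[of undefined] by linarith
  have g\<psi>: "square_integrable M (\<lambda>z. g z * \<psi> z)" "sq_norm M (\<lambda>z. g z * \<psi> z) \<le> sq_norm M (\<lambda>z. B * g z)"
    using sq_norm_mono[OF Bg _ le] by auto
  have "sq_norm M (\<lambda>z. B * g z) = B\<^sup>2 * sq_norm M g" using sq_norm_scaleR[of M B g] by simp
  then have "sqrt (sq_norm M (\<lambda>z. g z * \<psi> z)) \<le> B * sqrt (sq_norm M g)"
    using real_sqrt_le_mono[OF g\<psi>(2)] B0 by (simp add: real_sqrt_mult)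
  then have "sqrt (sq_norm M f) * sqrt (sq_norm M (\<lambda>z. g z * \<psi> z)) \<le> sqrt (sq_norm M f) * (B * sqrt (sq_norm M g))"
    by (intro mult_left_mono) auto
  then show "\<bar>LINT z|M. f z * g z * \<psi> z\<bar> \<le> B * sqrt (sq_norm M f) * sqrt (sq_norm M g)"
    using square_integrable_real_mult(2)[OF f g\<psi>(1)] by (simp add: mult_ac)
  show "integrable M (\<lambda>z. f z * g z * \<psi> z)"
    using square_integrable_real_mult(1)[OF f g\<psi>(1)] by (simp add: mult.assoc)
qed

text \<open>
All error terms in the limit of the equations have this shape: a strongly vanishing factor, a bounded one and a test function.
\<close>

lemma integral_triple_product_tendsto_0:
  fixes f g :: "nat \<Rightarrow> 'a \<Rightarrow> real"
  assumes f: "\<And>n. square_integrable M (f n)" and g: "\<And>n. square_integrable M (g n)"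
    and \<psi>: "\<psi> \<in> borel_measurable M" and bd: "\<And>z. \<bar>\<psi> z\<bar> \<le> B"
    and f0: "(\<lambda>n. sq_norm M (f n)) \<longlonglongrightarrow> 0" and gK: "\<And>n. sq_norm M (g n) \<le> K"
  shows "(\<lambda>n. LINT z|M. f n z * g n z * \<psi> z) \<longlonglongrightarrow> 0"
proof (rule Lim_null_comparison)
  have B0: "0 \<le> B" using bd[of undefined] by linarith
  have "norm (LINT z|M. f n z * g n z * \<psi> z) \<le> B * sqrt (sq_norm M (f n)) * sqrt K" for n
  proof -
    have "B * sqrt (sq_norm M (f n)) * sqrt (sq_norm M (g n)) \<le> B * sqrt (sq_norm M (f n)) * sqrt K"
      using gK B0 by (intro mult_left_mono) auto
    then show ?thesis using integral_triple_product(2)[OF f g \<psi> bd, of n n] by simp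
  qed
  then show "\<forall>\<^sub>F n in sequentially. norm (LINT z|M. f n z * g n z * \<psi> z) \<le> B * sqrt (sq_norm M (f n)) * sqrt K"
    by simp
  have "(\<lambda>n. B * sqrt (sq_norm M (f n)) * sqrt K) \<longlonglongrightarrow> B * sqrt 0 * sqrt K"
    by (intro tendsto_intros f0)
  then show "(\<lambda>n. B * sqrt (sq_norm M (f n)) * sqrt K) \<longlonglongrightarrow> 0" by simp
qed

lemma borel_measurable_linear_compose:
  fixes L :: "'b::euclidean_space \<Rightarrow> 'c::euclidean_space"
  assumes "linear L" "f \<in> borel_measurable M" shows "(\<lambda>z. L (f z)) \<in> borel_measurable M"
  using assms linear_continuous_on[of L UNIV] linear_conv_bounded_linear
  by (intro measurable_compose[OF assms(2)] borel_measurable_continuous_onI) blast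

lemma linear_vec_nth: "linear (\<lambda>v::'b::real_vector ^ 'n. v $ i)"
  by (rule linearI) auto

lemma square_integrable_component:
  fixes f :: "'a \<Rightarrow> 'b::euclidean_space ^ 'n"
  assumes f: "square_integrable M f"
  shows "square_integrable M (\<lambda>z. f z $ i)" "sq_norm M (\<lambda>z. f z $ i) \<le> sq_norm M f"
proof -
  have "(\<lambda>z. f z $ i) \<in> borel_measurable M"
    by (rule borel_measurable_linear_compose[OF linear_vec_nth square_integrableD(1)[OF f]])
  then show "square_integrable M (\<lambda>z. f z $ i)" "sq_norm M (\<lambda>z. f z $ i) \<le> sq_norm M f"
    using sq_norm_mono[OF f] Finite_Cartesian_Product.norm_nth_le by blast+
qed

lemma square_integrable_locally:
  fixes f :: "'a::euclidean_space \<Rightarrow> real"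
  assumes f: "square_integrable lborel f" and K: "compact K"
  shows "set_integrable lborel K f"
proof -
  have "emeasure lborel K < \<infinity>" "K \<in> sets borel"
    using emeasure_bounded_finite[OF compact_imp_bounded[OF K]] borel_compact[OF K] by auto
  then have "square_integrable lborel (indicat_real K)"
    by (auto simp: square_integrable_def power2_eq_square indicator_inter_arith[symmetric]
        intro!: integrable_real_indicator)
  from square_integrable_real_mult(1)[OF this f] show ?thesis by (simp add: set_integrable_def)
qed

section \<open>Strong limits of midpoint combinations\<close>

text \<open>
In decreasing sets closed under midpoints, elements of almost minimal norm form a Cauchy sequence:
midpoints of late elements still belong to an earlier set, so their norm is not much smaller, and
the parallelogram law turns this into closeness. For a constant sequence of sets this is the
projection theorem, for the tails of a bounded sequence it replaces weak compactness.
\<close>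

theorem minimizing_sequence_converges:
  fixes K :: "nat \<Rightarrow> ('a \<Rightarrow> 'b::euclidean_space) set"
  assumes K: "\<And>n f. f \<in> K n \<Longrightarrow> square_integrable M f"
    and dec: "\<And>n m. n \<le> m \<Longrightarrow> K m \<subseteq> K n"
    and mid: "\<And>n f g. f \<in> K n \<Longrightarrow> g \<in> K n \<Longrightarrow> (\<lambda>x. (1/2) *\<^sub>R (f x + g x)) \<in> K n"
    and bnd: "\<And>n. \<exists>f\<in>K n. sq_norm M f \<le> B"
  obtains f g where "\<And>n. f n \<in> K n" "square_integrable M g"
    "(\<lambda>n. sq_norm M (\<lambda>x. f n x - g x)) \<longlonglongrightarrow> 0" "AE x in M. (\<lambda>n. f n x) \<longlonglongrightarrow> g x"
    "\<And>h. h \<in> (\<Inter>n. K n) \<Longrightarrow> sq_norm M g \<le> sq_norm M h"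
proof -
  define m where "m n = Inf (sq_norm M ` K n)" for n
  have bb: "bdd_below (sq_norm M ` K n)" for n by (intro bdd_belowI[of _ 0]) auto
  have ne: "sq_norm M ` K n \<noteq> {}" for n using bnd[of n] by auto
  have m_le: "m n \<le> sq_norm M f" if "f \<in> K n" for f n
    unfolding m_def using bb that by (intro cInf_lower) auto
  have mB: "m n \<le> B" for n using bnd[of n] m_le by force
  have m_mono: "m n \<le> m k" if "n \<le> k" for n k
    unfolding m_def using dec[OF that] ne bb by (intro cInf_superset_mono) auto
  have "\<exists>f\<in>K n. sq_norm M f < m n + 1 / real (Suc n)" for n
    using cInf_lessD[OF ne, of n "m n + 1 / real (Suc n)"] unfolding m_def by auto
  then obtain f where fK: "\<And>n. f n \<in> K n" and fm: "\<And>n. sq_norm M (f n) < m n + 1 / real (Suc n)"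
    by metis
  have fsq: "square_integrable M (f n)" for n using K fK by blast
  obtain l where l: "m \<longlonglongrightarrow> l" and ml: "\<And>n. m n \<le> l"
    using incseq_convergent[of m B] mB m_mono by (auto simp: incseq_def)
  have Cauchy: "\<exists>N. \<forall>p\<ge>N. \<forall>q\<ge>N. sq_norm M (\<lambda>x. f p x - f q x) < \<delta>" if "\<delta> > 0" for \<delta>
  proof -
    have "(\<lambda>n. 4 * (l - m n) + 4 / real (Suc n)) \<longlonglongrightarrow> 4 * (l - l) + 0"
      by (intro tendsto_intros l filterlim_compose[OF lim_const_over_n filterlim_Suc] )
    then have "eventually (\<lambda>n. 4 * (l - m n) + 4 / real (Suc n) < \<delta>) sequentially"
      using that by (intro order_tendstoD(2)) auto
    then obtain N where N: "4 * (l - m N) + 4 / real (Suc N) < \<delta>"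
      by (auto simp: eventually_sequentially)
    have "sq_norm M (\<lambda>x. f p x - f q x) < \<delta>" if "p \<ge> N" "q \<ge> N" for p q
    proof -
      have "f p \<in> K N" "f q \<in> K N" using fK dec that by blast+
      then have "m N \<le> sq_norm M (\<lambda>x. (1/2) *\<^sub>R (f p x + f q x))" by (intro m_le mid)
      moreover have le: "1 / real (Suc p) \<le> 1 / real (Suc N)" "1 / real (Suc q) \<le> 1 / real (Suc N)"
        using that by (auto simp: field_simps)
      moreover have "sq_norm M (f p) < l + 1 / real (Suc N)" "sq_norm M (f q) < l + 1 / real (Suc N)"
        using fm[of p] fm[of q] ml[of p] ml[of q] le by (meson add_mono less_le_trans)+
      ultimately have "sq_norm M (\<lambda>x. f p x - f q x) \<le> 4 * (l - m N) + 4 * (1 / real (Suc N))"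
        using sq_norm_parallelogram[OF fsq[of p] fsq[of q]] by argo
      then show ?thesis using N by simp
    qed
    then show ?thesis by blast
  qed
  obtain g r where g: "square_integrable M g" "(\<lambda>n. sq_norm M (\<lambda>x. f n x - g x)) \<longlonglongrightarrow> 0"
    "strict_mono (r::nat\<Rightarrow>nat)" "AE x in M. (\<lambda>n. f (r n) x) \<longlonglongrightarrow> g x"
    using square_integrable_complete[OF fsq Cauchy] by blast
  show ?thesis
  proof (rule that[of "\<lambda>n. f (r n)" g])
    show "f (r n) \<in> K n" for n using fK dec[of n "r n"] seq_suble[OF g(3)] by blast
    show "(\<lambda>n. sq_norm M (\<lambda>x. f (r n) x - g x)) \<longlonglongrightarrow> 0"
      using LIMSEQ_subseq_LIMSEQ[OF g(2,3)] by (simp add: o_def)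
    fix h assume h: "h \<in> (\<Inter>n. K n)"
    have "sq_norm M g \<le> sq_norm M h + \<delta>" if "\<delta> > 0" for \<delta>
    proof (rule sq_norm_liminf(2)[of M "\<lambda>n. f (r n)"])
      obtain N where N: "1 / real (Suc N) < \<delta>" using \<open>\<delta> > 0\<close> nat_approx_posE by blast
      show "eventually (\<lambda>n. sq_norm M (f (r n)) \<le> sq_norm M h + \<delta>) sequentially"
        unfolding eventually_sequentially
      proof (intro exI[of _ N] allI impI)
        fix n assume "N \<le> n"
        then have "1 / real (Suc (r n)) \<le> 1 / real (Suc N)"
          using seq_suble[OF g(3), of n] by (auto simp: field_simps)
        then show "sq_norm M (f (r n)) \<le> sq_norm M h + \<delta>"
          using N fm[of "r n"] m_le[of h "r n"] h by fastforce
      qed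
    qed (use fsq g in auto)
    then show "sq_norm M g \<le> sq_norm M h" by (rule field_le_epsilon)
  qed (use g in auto)
qed

text \<open>
Iterated midpoints instead of all convex combinations: this is all that the parallelogram law
needs, and every property that is convex in the function follows by rule induction, without any
bookkeeping of coefficients.
\<close>

inductive_set tail_hull :: "(nat \<Rightarrow> 'a \<Rightarrow> 'b::euclidean_space) \<Rightarrow> nat \<Rightarrow> ('a \<Rightarrow> 'b) set"
  for f n where
  base: "k \<ge> n \<Longrightarrow> f k \<in> tail_hull f n"
| midpoint: "g \<in> tail_hull f n \<Longrightarrow> h \<in> tail_hull f n \<Longrightarrow> (\<lambda>x. (1/2) *\<^sub>R (g x + h x)) \<in> tail_hull f n"

lemma tail_hull_antimono: assumes "n \<le> m" shows "tail_hull f m \<subseteq> tail_hull f n"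
proof
  fix g assume "g \<in> tail_hull f m"
  then show "g \<in> tail_hull f n"
    using assms by induction (auto intro: tail_hull.intros)
qed

lemma tail_hull_square_integrable:
  assumes "g \<in> tail_hull f n" "\<And>n. square_integrable M (f n)" shows "square_integrable M g"
  using assms by induction (auto simp del: scaleR_add_right)

theorem bounded_tail_hull_converges:
  assumes f: "\<And>n. square_integrable M (f n)" and bnd: "\<And>n. sq_norm M (f n) \<le> B"
  obtains g h where "\<And>n. g n \<in> tail_hull f n" "square_integrable M h"
    "(\<lambda>n. sq_norm M (\<lambda>x. g n x - h x)) \<longlonglongrightarrow> 0" "AE x in M. (\<lambda>n. g n x) \<longlonglongrightarrow> h x"
proof -
  have "square_integrable M g" if "g \<in> tail_hull f n" for g n
    using that by induction (auto intro: f simp del: scaleR_add_right)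
  then show ?thesis
  proof (rule minimizing_sequence_converges[of "tail_hull f" M B])
    show "\<exists>g\<in>tail_hull f n. sq_norm M g \<le> B" for n
      using tail_hull.base[of n n f] bnd[of n] by auto
  qed (use that tail_hull_antimono[of _ _ f] tail_hull.midpoint[of _ f] in blast)+
qed

text \<open>
Being within distance \<open>e\<close> of \<open>l\<close> after integration against \<open>\<psi>\<close> is a midpoint-convex property, so it spreads from the tail of the sequence to the hull of the tail.
\<close>

lemma tail_hull_weak_limit:
  assumes f: "\<And>n. square_integrable M (f n)" and \<psi>: "square_integrable M \<psi>"
    and lim: "(\<lambda>n. LINT z|M. f n z \<bullet> \<psi> z) \<longlonglongrightarrow> l"
    and g: "\<And>n. g n \<in> tail_hull f n" and h: "square_integrable M h"
    and gh: "(\<lambda>n. sq_norm M (\<lambda>z. g n z - h z)) \<longlonglongrightarrow> 0"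
  shows "(LINT z|M. h z \<bullet> \<psi> z) = l"
proof -
  note gs = tail_hull_square_integrable[OF g f]
  have "(\<lambda>n. LINT z|M. g n z \<bullet> \<psi> z) \<longlonglongrightarrow> l"
  proof (rule LIMSEQ_I)
    fix e :: real assume "e > 0"
    then obtain N where N: "\<And>k. k \<ge> N \<Longrightarrow> \<bar>(LINT z|M. f k z \<bullet> \<psi> z) - l\<bar> < e"
      using LIMSEQ_D[OF lim] by (metis real_norm_def)
    have hull: "\<bar>(LINT z|M. k z \<bullet> \<psi> z) - l\<bar> < e" if "k \<in> tail_hull f N" for k
      using that
    proof induction
      case (midpoint p q)
      note p = tail_hull_square_integrable[OF midpoint(1) f] and q = tail_hull_square_integrable[OF midpoint(2) f]
      have "(LINT z|M. ((1/2) *\<^sub>R (p z + q z)) \<bullet> \<psi> z) = (LINT z|M. 1/2 * (p z \<bullet> \<psi> z) + 1/2 * (q z \<bullet> \<psi> z))"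
        by (simp only: inner_scaleR_left inner_add_left distrib_left)
      also have "\<dots> = 1/2 * (LINT z|M. p z \<bullet> \<psi> z) + 1/2 * (LINT z|M. q z \<bullet> \<psi> z)"
        using integrable_inner_square_integrable[OF p \<psi>] integrable_inner_square_integrable[OF q \<psi>] by simp
      finally have eq: "(LINT z|M. ((1/2) *\<^sub>R (p z + q z)) \<bullet> \<psi> z)
        = 1/2 * (LINT z|M. p z \<bullet> \<psi> z) + 1/2 * (LINT z|M. q z \<bullet> \<psi> z)" .
      show ?case unfolding eq using midpoint.IH unfolding abs_less_iff by argo
    qed (use N in auto)
    show "\<exists>N. \<forall>n\<ge>N. norm ((LINT z|M. g n z \<bullet> \<psi> z) - l) < e"
      using hull tail_hull_antimono g by (metis real_norm_def subsetD)
  qed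
  moreover have "(\<lambda>n. LINT z|M. g n z \<bullet> \<psi> z) \<longlonglongrightarrow> (LINT z|M. h z \<bullet> \<psi> z)"
  proof (rule Lim_null[THEN iffD2], rule Lim_null_comparison)
    have "norm ((LINT z|M. g n z \<bullet> \<psi> z) - (LINT z|M. h z \<bullet> \<psi> z))
      \<le> sqrt (sq_norm M (\<lambda>z. g n z - h z)) * sqrt (sq_norm M \<psi>)" for n
      using integral_Cauchy_Schwarz[OF square_integrable_diff[OF gs h] \<psi>, of n]
        integrable_inner_square_integrable[OF gs \<psi>, of n] integrable_inner_square_integrable[OF h \<psi>]
      by (simp add: inner_diff_left)
    then show "\<forall>\<^sub>F n in sequentially. norm ((LINT z|M. g n z \<bullet> \<psi> z) - (LINT z|M. h z \<bullet> \<psi> z))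
      \<le> sqrt (sq_norm M (\<lambda>z. g n z - h z)) * sqrt (sq_norm M \<psi>)" by simp
    have "(\<lambda>n. sqrt (sq_norm M (\<lambda>z. g n z - h z)) * sqrt (sq_norm M \<psi>)) \<longlonglongrightarrow> sqrt 0 * sqrt (sq_norm M \<psi>)"
      by (intro tendsto_intros gh)
    then show "(\<lambda>n. sqrt (sq_norm M (\<lambda>z. g n z - h z)) * sqrt (sq_norm M \<psi>)) \<longlonglongrightarrow> 0" by simp
  qed
  ultimately show ?thesis using LIMSEQ_unique by blast
qed

section \<open>Smooth bump functions\<close>

lemma dir_deriv_eq: "(f has_derivative f') (at z) \<Longrightarrow> dir_deriv d f z = f' d"
  unfolding dir_deriv_def by (metis frechet_derivative_at)

lemma has_derivative_dir_deriv:
  "f differentiable (at z) \<Longrightarrow> (f has_derivative (\<lambda>d. dir_deriv d f z)) (at z)"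
  unfolding dir_deriv_def using frechet_derivative_works by blast

lemma times_continuously_differentiable_SucI:
  assumes "\<And>z. (f has_derivative D z) (at z)"
    and "\<And>d. times_continuously_differentiable k (\<lambda>z. D z d)"
  shows "times_continuously_differentiable (Suc k) f"
proof -
  have "dir_deriv d f = (\<lambda>z. D z d)" for d using assms(1) dir_deriv_eq by blast
  then show ?thesis using assms by (auto simp: differentiable_def)
qed

lemma times_continuously_differentiable_pred:
  "times_continuously_differentiable (Suc k) f \<Longrightarrow> times_continuously_differentiable k f"
proof (induction k arbitrary: f)
  case 0
  then show ?case
    by (auto intro!: differentiable_imp_continuous_on simp: differentiable_on_def intro: differentiable_at_withinI)
qed auto

lemma times_continuously_differentiable_const: "times_continuously_differentiable k (\<lambda>z. c)"
proof (induction k arbitrary: c)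
  case (Suc k)
  show ?case by (rule times_continuously_differentiable_SucI[where D="\<lambda>z d. 0"]) (auto intro: Suc)
qed simp

lemma times_continuously_differentiable_add:
  "times_continuously_differentiable k f \<Longrightarrow> times_continuously_differentiable k g \<Longrightarrow>
    times_continuously_differentiable k (\<lambda>z. f z + g z)"
proof (induction k arbitrary: f g)
  case 0
  then show ?case by (auto intro: continuous_intros)
next
  case (Suc k)
  show ?case
    by (rule times_continuously_differentiable_SucI[where D="\<lambda>z d. dir_deriv d f z + dir_deriv d g z"])
       (use Suc in \<open>auto intro!: has_derivative_add has_derivative_dir_deriv\<close>)
qed

lemma times_continuously_differentiable_mult:
  fixes f g :: "'a::euclidean_space \<Rightarrow> real"
  shows "times_continuously_differentiable k f \<Longrightarrow> times_continuously_differentiable k g \<Longrightarrow>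
    times_continuously_differentiable k (\<lambda>z. f z * g z)"
proof (induction k arbitrary: f g)
  case 0
  then show ?case by (auto intro: continuous_intros)
next
  case (Suc k)
  note pred = times_continuously_differentiable_pred[OF Suc.prems(1)]
    times_continuously_differentiable_pred[OF Suc.prems(2)]
  show ?case
    by (rule times_continuously_differentiable_SucI[where
          D="\<lambda>z d. f z * dir_deriv d g z + dir_deriv d f z * g z"])
       (use Suc pred in \<open>auto intro!: has_derivative_mult has_derivative_dir_deriv
          times_continuously_differentiable_add\<close>)
qed

lemma times_continuously_differentiable_prod:
  fixes f :: "'i \<Rightarrow> 'a::euclidean_space \<Rightarrow> real"
  assumes "\<And>i. i \<in> I \<Longrightarrow> times_continuously_differentiable k (f i)"
  shows "times_continuously_differentiable k (\<lambda>z. \<Prod>i\<in>I. f i z)"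
  using assms
  by (induction I rule: infinite_finite_induct)
     (auto intro: times_continuously_differentiable_const times_continuously_differentiable_mult)

lemma times_continuously_differentiable_translate:
  assumes "times_continuously_differentiable k f"
  shows "times_continuously_differentiable k (\<lambda>z. f (z + v))"
  using assms
proof (induction k arbitrary: f)
  case 0
  then have "continuous_on UNIV f" by simp
  from continuous_on_compose2[OF this, of UNIV "\<lambda>z. z + v"] show ?case
    by (simp add: continuous_on_add)
next
  case (Suc k)
  show ?case
  proof (rule times_continuously_differentiable_SucI[where D="\<lambda>z d. dir_deriv d f (z + v)"])
    fix z
    have "((\<lambda>z. z + v) has_derivative (\<lambda>h. h)) (at z)" by (auto intro!: derivative_eq_intros)
    then show "((\<lambda>z. f (z + v)) has_derivative (\<lambda>d. dir_deriv d f (z + v))) (at z)"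
      by (rule has_derivative_compose) (use Suc in \<open>auto intro: has_derivative_dir_deriv\<close>)
  qed (use Suc in auto)
qed

text \<open>
The functions $x^{-m} e^{-1/x}$, continued by zero. The family is closed under differentiation, which yields smoothness by induction on the order.
\<close>

definition flat_exp :: "nat \<Rightarrow> real \<Rightarrow> real"
  where "flat_exp m x = (if x > 0 then (1/x)^m * exp (- (1/x)) else 0)"

lemma flat_exp_tendsto_0: "(flat_exp m \<longlongrightarrow> 0) (at 0)"
proof (rule filterlim_split_at)
  show "(flat_exp m \<longlongrightarrow> 0) (at_left 0)"
    by (rule tendsto_eventually) (auto simp: flat_exp_def eventually_at_filter)
  have "((\<lambda>x. inverse x ^ m / exp (inverse x)) \<longlongrightarrow> 0) (at_right (0::real))"
    by (rule filterlim_compose[OF tendsto_power_div_exp_0 filterlim_inverse_at_top_right])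
  then show "(flat_exp m \<longlongrightarrow> 0) (at_right 0)"
    by (rule Lim_transform_eventually)
       (auto simp: flat_exp_def eventually_at_filter inverse_eq_divide exp_minus divide_simps)
qed

text \<open>
At zero, the difference quotient of the function with index \<open>m\<close> is the function with index \<open>Suc m\<close>, which tends to zero.
\<close>

lemma flat_exp_has_derivative:
  "(flat_exp m has_real_derivative - real m * flat_exp (Suc m) x + flat_exp (m + 2) x) (at x)"
proof -
  consider "x > 0" | "x = 0" | "x < 0" by linarith
  then show ?thesis
  proof cases
    case 1
    have "((\<lambda>x. (1/x)^m * exp (- (1/x))) has_real_derivative
        - real m * flat_exp (Suc m) x + flat_exp (m + 2) x) (at x)"
    proof -
      have i: "((\<lambda>x. 1/x) has_real_derivative - ((1/x)^2)) (at x)"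
        using 1 by (auto intro!: derivative_eq_intros simp: power2_eq_square)
      have e: "((\<lambda>x. exp (- (1/x))) has_real_derivative exp (- (1/x)) * (1/x)^2) (at x)"
        using DERIV_chain2[OF DERIV_exp DERIV_minus[OF i]] by simp
      have p: "((\<lambda>x. (1/x)^m) has_real_derivative - real m * (1/x)^Suc m) (at x)"
      proof (cases m)
        case (Suc k)
        have "- real m * (1/x)^Suc m = (1 + of_nat k) * (- ((1/x)^2) * (1/x)^k)"
          unfolding Suc of_nat_Suc power_Suc power2_eq_square by algebra
        then show ?thesis using DERIV_power_Suc[OF i, of k] by (simp only: Suc)
      qed simp
      show ?thesis
        using DERIV_mult[OF p e] 1 by (simp add: flat_exp_def power2_eq_square algebra_simps)
    qed
    then show ?thesis
      by (rule has_field_derivative_transform_within_open[of _ _ _ "{0<..}"])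
         (use 1 in \<open>auto simp: flat_exp_def\<close>)
  next
    case 2
    have "((\<lambda>h. (flat_exp m (0 + h) - flat_exp m 0) / h) \<longlongrightarrow> 0) (at 0)"
      by (rule Lim_transform_eventually[OF flat_exp_tendsto_0[of "Suc m"]])
         (auto simp: flat_exp_def eventually_at_filter)
    then show ?thesis using 2 by (simp add: DERIV_def flat_exp_def)
  next
    case 3
    have "((\<lambda>x. 0) has_real_derivative 0) (at x)" by simp
    then have "(flat_exp m has_real_derivative 0) (at x)"
      by (rule has_field_derivative_transform_within_open[of _ _ _ "{..<0}"])
         (use 3 in \<open>auto simp: flat_exp_def\<close>)
    then show ?thesis using 3 by (simp add: flat_exp_def)
  qed
qed

lemma times_continuously_differentiable_flat_exp_affine:
  "times_continuously_differentiable k (\<lambda>z. flat_exp m (c + z \<bullet> v))"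
proof (induction k arbitrary: m)
  case 0
  have "continuous_on UNIV (flat_exp m)"
    using flat_exp_has_derivative DERIV_isCont continuous_at_imp_continuous_on by blast
  from continuous_on_compose2[OF this, of UNIV "\<lambda>z. c + z \<bullet> v"] show ?case
    by (simp add: continuous_on_add continuous_on_inner)
next
  case (Suc k)
  show ?case
  proof (rule times_continuously_differentiable_SucI[where
        D="\<lambda>z d. (d \<bullet> v) * (- real m * flat_exp (Suc m) (c + z \<bullet> v) + flat_exp (m + 2) (c + z \<bullet> v))"])
    show "((\<lambda>z. flat_exp m (c + z \<bullet> v)) has_derivative
      (\<lambda>d. (d \<bullet> v) * (- real m * flat_exp (Suc m) (c + z \<bullet> v) + flat_exp (m + 2) (c + z \<bullet> v)))) (at z)" for z
    proof -
      have "((\<lambda>z. c + z \<bullet> v) has_derivative (\<lambda>d. d \<bullet> v)) (at z)" by (auto intro!: derivative_eq_intros)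
      from has_derivative_compose[OF this flat_exp_has_derivative[unfolded has_field_derivative_def]]
      show ?thesis by (simp add: mult.commute)
    qed
  qed (intro times_continuously_differentiable_mult times_continuously_differentiable_add
        times_continuously_differentiable_const Suc)
qed

lemma flat_exp_0_bounds: "0 \<le> flat_exp 0 x" "flat_exp 0 x \<le> 1"
  by (auto simp: flat_exp_def)

text \<open>
Since $e^{-1/(nx)} \to 1$ for every $x > 0$, scaling the argument is enough to approximate the indicator function of the box from below; no smooth step functions are needed.
\<close>

definition box_bump :: "nat \<Rightarrow> 'a \<Rightarrow> 'a \<Rightarrow> 'a::euclidean_space \<Rightarrow> real"
  where "box_bump n a b z = (\<Prod>i\<in>Basis. flat_exp 0 (real (Suc n) * (z \<bullet> i - a \<bullet> i))
    * flat_exp 0 (real (Suc n) * (b \<bullet> i - z \<bullet> i)))"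

lemma smooth_box_bump: "smooth (box_bump n a b)"
proof -
  have 1: "flat_exp 0 (real (Suc n) * (z \<bullet> i - a \<bullet> i))
    = flat_exp 0 (- real (Suc n) * (a \<bullet> i) + z \<bullet> (real (Suc n) *\<^sub>R i))" for i z
    by (rule arg_cong[where f="flat_exp 0"]) (simp add: algebra_simps)
  have 2: "flat_exp 0 (real (Suc n) * (b \<bullet> i - z \<bullet> i))
    = flat_exp 0 (real (Suc n) * (b \<bullet> i) + z \<bullet> (- real (Suc n) *\<^sub>R i))" for i z
    by (rule arg_cong[where f="flat_exp 0"]) (simp add: algebra_simps)
  show ?thesis unfolding smooth_def box_bump_def 1 2
    by (intro allI times_continuously_differentiable_prod times_continuously_differentiable_mult
        times_continuously_differentiable_flat_exp_affine)
qed

lemma box_bump_bounds: "0 \<le> box_bump n a b z" "box_bump n a b z \<le> 1"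
  unfolding box_bump_def
  by (auto intro!: prod_nonneg prod_le_1 mult_nonneg_nonneg mult_le_one flat_exp_0_bounds simp del: of_nat_Suc)

lemma box_bump_eq_0: "z \<notin> box a b \<Longrightarrow> box_bump n a b z = 0"
  unfolding box_bump_def box_def
  by (auto simp: prod_zero_iff flat_exp_def zero_less_mult_iff simp del: of_nat_Suc)

lemma box_bump_tendsto: "(\<lambda>n. box_bump n a b z) \<longlonglongrightarrow> indicator (box a b) z"
proof (cases "z \<in> box a b")
  case True
  have lim: "(\<lambda>n. flat_exp 0 (real (Suc n) * x)) \<longlonglongrightarrow> 1" if "x > 0" for x
  proof -
    have "(\<lambda>n. exp (- (inverse x * (1 / real (Suc n))))) \<longlonglongrightarrow> exp (- (inverse x * 0))"
      by (intro tendsto_intros filterlim_compose[OF lim_const_over_n filterlim_Suc])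
    then show ?thesis using that
      by (simp add: flat_exp_def zero_less_mult_iff field_simps del: of_nat_Suc)
  qed
  have "(\<lambda>n. box_bump n a b z) \<longlonglongrightarrow> (\<Prod>i\<in>(Basis::'a set). 1 * 1)"
    unfolding box_bump_def using True
    by (intro tendsto_prod tendsto_mult lim) (auto simp: box_def)
  then show ?thesis using True by simp
next
  case False
  then show ?thesis by (simp add: box_bump_eq_0)
qed

lemma test_function_box_bump:
  assumes "cbox a b \<subseteq> \<Omega>" shows "test_function \<Omega> (box_bump n a b)"
proof -
  have "{z. box_bump n a b z \<noteq> 0} \<subseteq> cbox a b"
    using box_bump_eq_0[of _ a b n] box_subset_cbox[of a b] by blast
  then have "closure {z. box_bump n a b z \<noteq> 0} \<subseteq> cbox a b" by (rule closure_minimal) (rule closed_cbox)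
  moreover from this have "compact (closure {z. box_bump n a b z \<noteq> 0})"
    by (meson bounded_cbox bounded_subset closed_closure compact_eq_bounded_closed)
  ultimately show ?thesis using assms smooth_box_bump by (auto simp: test_function_def)
qed

section \<open>Test functions\<close>

lemma test_function_support:
  assumes "test_function \<Omega> \<phi>"
  obtains K where "compact K" "K \<subseteq> \<Omega>" "\<And>z. z \<notin> K \<Longrightarrow> \<phi> z = 0"
  using assms closure_subset[of "{z. \<phi> z \<noteq> 0}"] unfolding test_function_def by blast

lemma test_functionI:
  assumes "smooth \<phi>" "compact K" "K \<subseteq> \<Omega>" "\<And>z. z \<notin> K \<Longrightarrow> \<phi> z = 0"
  shows "test_function \<Omega> \<phi>"
proof -
  have "closure {z. \<phi> z \<noteq> 0} \<subseteq> K"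
    using assms by (intro closure_minimal) (auto intro: compact_imp_closed)
  moreover from this have "compact (closure {z. \<phi> z \<noteq> 0})"
    using assms(2) by (meson bounded_subset closed_closure compact_eq_bounded_closed)
  ultimately show ?thesis using assms by (auto simp: test_function_def)
qed

lemma test_function_outside: "test_function \<Omega> \<phi> \<Longrightarrow> z \<notin> \<Omega> \<Longrightarrow> \<phi> z = 0"
  by (meson subsetD test_function_support)

lemma test_function_mono: "test_function \<Omega> \<phi> \<Longrightarrow> \<Omega> \<subseteq> \<Omega>' \<Longrightarrow> test_function \<Omega>' \<phi>"
  by (auto simp: test_function_def)

lemma test_function_differentiable: "test_function \<Omega> \<phi> \<Longrightarrow> \<phi> differentiable (at z)"
  unfolding test_function_def smooth_def by (metis times_continuously_differentiable.simps(2))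

lemma test_function_continuous: "test_function \<Omega> \<phi> \<Longrightarrow> continuous_on S \<phi>"
  unfolding test_function_def smooth_def
  by (metis times_continuously_differentiable.simps(1) continuous_on_subset subset_UNIV)

lemma test_function_add:
  assumes "test_function \<Omega> \<phi>" "test_function \<Omega> \<psi>"
  shows "test_function \<Omega> (\<lambda>z. \<phi> z + \<psi> z)"
proof -
  obtain K L where "compact K" "K \<subseteq> \<Omega>" "\<And>z. z \<notin> K \<Longrightarrow> \<phi> z = 0"
    "compact L" "L \<subseteq> \<Omega>" "\<And>z. z \<notin> L \<Longrightarrow> \<psi> z = 0"
    using assms test_function_support by metis
  then show ?thesis
    using assms by (intro test_functionI[of _ "K \<union> L"])
      (auto simp: smooth_def test_function_def intro!: times_continuously_differentiable_add)
qed

lemma test_function_cmult: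
  fixes \<phi> :: "'a::euclidean_space \<Rightarrow> real"
  assumes "test_function \<Omega> \<phi>"
  shows "test_function \<Omega> (\<lambda>z. c * \<phi> z)"
proof -
  obtain K where "compact K" "K \<subseteq> \<Omega>" "\<And>z. z \<notin> K \<Longrightarrow> \<phi> z = 0"
    using assms test_function_support by metis
  then show ?thesis
    using assms by (intro test_functionI[of _ K])
      (auto simp: smooth_def test_function_def
        intro!: times_continuously_differentiable_mult times_continuously_differentiable_const)
qed

lemma test_function_zero: "test_function \<Omega> (\<lambda>z. 0)"
  by (rule test_functionI[of _ "{}"]) (auto simp: smooth_def times_continuously_differentiable_const)

lemma test_function_dir_deriv:
  assumes "test_function \<Omega> \<phi>"
  shows "test_function \<Omega> (dir_deriv d \<phi>)"
proof -
  obtain K where K: "compact K" "K \<subseteq> \<Omega>" "\<And>z. z \<notin> K \<Longrightarrow> \<phi> z = 0"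
    using assms test_function_support by metis
  have "dir_deriv d \<phi> z = 0" if "z \<notin> K" for z
  proof -
    have "((\<lambda>z. 0) has_derivative (\<lambda>d. 0)) (at z)" by simp
    then have "(\<phi> has_derivative (\<lambda>d. 0)) (at z)"
      by (rule has_derivative_transform_within_open[of _ _ _ _ "- K"])
         (use K that in \<open>auto simp: compact_imp_closed open_Compl\<close>)
    then show ?thesis by (simp add: dir_deriv_eq)
  qed
  moreover have "smooth (dir_deriv d \<phi>)"
    using assms unfolding test_function_def smooth_def
    by (metis times_continuously_differentiable.simps(2))
  ultimately show ?thesis using K by (intro test_functionI)
qed

lemma test_function_translate:
  assumes "test_function \<Omega> \<phi>" "(\<lambda>z. z - v) ` \<Omega> \<subseteq> \<Omega>"
  shows "test_function \<Omega> (\<lambda>z. \<phi> (z + v))"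
proof -
  obtain K where K: "compact K" "K \<subseteq> \<Omega>" "\<And>z. z \<notin> K \<Longrightarrow> \<phi> z = 0"
    using assms test_function_support by metis
  show ?thesis
  proof (rule test_functionI)
    show "smooth (\<lambda>z. \<phi> (z + v))"
      using assms(1) by (auto simp: smooth_def test_function_def intro: times_continuously_differentiable_translate)
    show "compact ((\<lambda>z. z - v) ` K)"
      by (intro compact_continuous_image continuous_intros K)
    show "(\<lambda>z. z - v) ` K \<subseteq> \<Omega>" using K(2) assms(2) by blast
    fix z assume "z \<notin> (\<lambda>z. z - v) ` K"
    then have "z + v \<notin> K" by (metis add_diff_cancel image_eqI)
    then show "\<phi> (z + v) = 0" by (rule K(3))
  qed
qed

lemma test_function_bounded:
  assumes "test_function \<Omega> \<phi>" obtains B where "B \<ge> 0" "\<And>z. norm (\<phi> z) \<le> B"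
proof -
  obtain K where K: "compact K" "K \<subseteq> \<Omega>" "\<And>z. z \<notin> K \<Longrightarrow> \<phi> z = 0"
    using assms test_function_support by metis
  have "bounded (\<phi> ` K)"
    using K(1) test_function_continuous[OF assms] by (intro compact_imp_bounded compact_continuous_image)
  then obtain B where "B > 0" "\<And>z. z \<in> K \<Longrightarrow> norm (\<phi> z) \<le> B" by (auto simp: bounded_pos)
  then show ?thesis using that[of B] K(3) by (metis less_imp_le norm_zero)
qed

lemma test_function_borel [measurable_dest]:
  "test_function \<Omega> \<phi> \<Longrightarrow> \<phi> \<in> borel_measurable borel"
  using test_function_continuous[of \<Omega> \<phi> UNIV] by (rule borel_measurable_continuous_onI)

lemma test_function_bound_measurable:
  fixes \<phi> :: "'a::euclidean_space \<Rightarrow> real"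
  assumes "test_function \<Omega> \<phi>"
  obtains B where "\<phi> \<in> borel_measurable lborel" "\<And>z. \<bar>\<phi> z\<bar> \<le> B"
  using test_function_bounded[OF assms] test_function_borel[OF assms] by (metis measurable_lborel2 real_norm_def)

lemma square_integrable_test_function:
  assumes "test_function \<Omega> \<phi>" shows "square_integrable lborel \<phi>"
proof -
  obtain K where K: "compact K" "K \<subseteq> \<Omega>" "\<And>z. z \<notin> K \<Longrightarrow> \<phi> z = 0"
    using assms test_function_support by metis
  have "integrable lborel (\<lambda>z. indicator K z *\<^sub>R (norm (\<phi> z))\<^sup>2)"
    by (intro borel_integrable_compact K continuous_intros test_function_continuous[OF assms])
  moreover have "(\<lambda>z. indicator K z *\<^sub>R (norm (\<phi> z))\<^sup>2) = (\<lambda>z. (norm (\<phi> z))\<^sup>2)"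
    using K(3) by (fastforce simp: indicator_def)
  ultimately show ?thesis
    using test_function_borel[OF assms] by (simp add: square_integrable_def)
qed

lemma integrable_test_function:
  fixes \<phi> :: "'a::euclidean_space \<Rightarrow> real"
  assumes "test_function \<Omega> \<phi>" shows "integrable lborel \<phi>"
proof -
  obtain K where K: "compact K" "\<And>z. z \<notin> K \<Longrightarrow> \<phi> z = 0" using assms test_function_support by metis
  have "integrable lborel (\<lambda>z. indicator K z *\<^sub>R \<phi> z)"
    by (intro borel_integrable_compact K test_function_continuous[OF assms])
  also have "(\<lambda>z. indicator K z *\<^sub>R \<phi> z) = \<phi>" using K(2) by (fastforce simp: indicator_def)
  finally show ?thesis .
qed

lemma dx_test_function: "test_function \<Omega> \<phi> \<Longrightarrow> test_function \<Omega> (dx j \<phi>)"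
  unfolding dx_def by (rule test_function_dir_deriv)

lemma dt_test_function: "test_function \<Omega> \<phi> \<Longrightarrow> test_function \<Omega> (dt \<phi>)"
  unfolding dt_def by (rule test_function_dir_deriv)

section \<open>Density of test functions\<close>

text \<open>
Bump functions show that the integral of \<open>f\<close> over every box in \<open>\<Omega>\<close> vanishes. Boxes form an
intersection-stable generator of the Borel sets, hence \<open>f\<close> has integral zero over every Borel
subset of such a box and vanishes there almost everywhere; countably many boxes cover \<open>\<Omega>\<close>.
\<close>

theorem fundamental_lemma_calculus_of_variations:
  fixes f :: "'a::euclidean_space \<Rightarrow> real"
  assumes "open \<Omega>" and loc: "\<And>K. compact K \<Longrightarrow> K \<subseteq> \<Omega> \<Longrightarrow> set_integrable lborel K f"
    and zero: "\<And>\<phi>. test_function \<Omega> \<phi> \<Longrightarrow> (LBINT z. f z * \<phi> z) = 0"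
  shows "AE z in lborel. z \<in> \<Omega> \<longrightarrow> f z = 0"
proof -
  have cbox_int: "integrable lborel (\<lambda>z. indicator (cbox a b) z * f z)" if "cbox a b \<subseteq> \<Omega>" for a b
    using loc[OF compact_cbox that] by (simp add: set_integrable_def)
  have box_zero: "(LBINT z. indicator (box a b) z * f z) = 0" if sub: "cbox a b \<subseteq> \<Omega>" for a b
  proof -
    have eq: "f z * box_bump n a b z = (indicator (cbox a b) z * f z) * box_bump n a b z" for n z
      using box_bump_eq_0[of z a b n] box_subset_cbox[of a b] by (auto simp: indicator_def)
    have [measurable]: "box_bump n a b \<in> borel_measurable borel" for n
      using test_function_box_bump[OF sub] by (rule test_function_borel)
    note [measurable] = borel_measurable_integrable[OF cbox_int[OF sub]]
    have "(\<lambda>n. LBINT z. (indicator (cbox a b) z * f z) * box_bump n a b z)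
      \<longlonglongrightarrow> (LBINT z. (indicator (cbox a b) z * f z) * indicator (box a b) z)"
    proof (rule integral_dominated_convergence[where w="\<lambda>z. \<bar>indicator (cbox a b) z * f z\<bar>"])
      show "AE z in lborel. (\<lambda>n. indicator (cbox a b) z * f z * box_bump n a b z)
         \<longlonglongrightarrow> indicator (cbox a b) z * f z * indicator (box a b) z"
        by (intro AE_I2 tendsto_intros box_bump_tendsto)
      show "AE z in lborel. norm (indicator (cbox a b) z * f z * box_bump n a b z)
         \<le> \<bar>indicator (cbox a b) z * f z\<bar>" for n
        using box_bump_bounds[of n a b] by (auto intro!: AE_I2 mult_left_le simp: abs_mult)
    qed (use cbox_int[OF sub] in auto)
    moreover have "(LBINT z. (indicator (cbox a b) z * f z) * box_bump n a b z) = 0" for n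
      using zero[OF test_function_box_bump[OF sub]] unfolding eq .
    ultimately have "(LBINT z. (indicator (cbox a b) z * f z) * indicator (box a b) z) = 0"
      by (simp add: LIMSEQ_const_iff)
    also have "(\<lambda>z. (indicator (cbox a b) z * f z) * indicator (box a b) z) = (\<lambda>z. indicator (box a b) z * f z)"
      using box_subset_cbox[of a b] by (fastforce simp: indicator_def)
    finally show ?thesis .
  qed
  have box_AE: "AE z in lborel. z \<in> cbox a b \<longrightarrow> f z = 0" if sub: "cbox a b \<subseteq> \<Omega>" for a b
  proof -
    define g where "g z = indicator (box a b) z * f z" for z
    have "integrable lborel (\<lambda>z. indicator (box a b) z *\<^sub>R (indicator (cbox a b) z * f z))"
      by (intro integrable_mult_indicator cbox_int sub) simp
    also have "(\<lambda>z. indicator (box a b) z *\<^sub>R (indicator (cbox a b) z * f z)) = g"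
      using box_subset_cbox[of a b] by (fastforce simp: indicator_def g_def)
    finally have g: "integrable lborel g" .
    have g0: "(LBINT z. g z) = 0" unfolding g_def by (rule box_zero[OF sub])
    have gA: "integrable lborel (\<lambda>z. indicator A z * g z)" if "A \<in> sets borel" for A
      using integrable_mult_indicator[OF _ g, of A] that by simp
    \<comment> \<open>From boxes to Borel sets by Dynkin's argument.\<close>
    have "(LBINT z. indicator A z * g z) = 0" if A: "A \<in> sets borel" for A
    proof -
      have "Int_stable (range (\<lambda>(a, b). box a b :: 'a set))"
        by (auto simp: Int_stable_def box_Int_box)
      moreover have "(range (\<lambda>(a, b). box a b :: 'a set)) \<subseteq> Pow UNIV" by auto
      moreover have "A \<in> sigma_sets UNIV (range (\<lambda>(a, b). box a b))"
        using A unfolding borel_eq_box by simp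
      ultimately show ?thesis
      proof (induction rule: sigma_sets_induct_disjoint)
        case (basic A)
        then obtain c d where A: "A = box c d" by auto
        define p q where "p = (\<Sum>i\<in>Basis. max (a\<bullet>i) (c\<bullet>i) *\<^sub>R i)" and "q = (\<Sum>i\<in>Basis. min (b\<bullet>i) (d\<bullet>i) *\<^sub>R i)"
        have pq: "box a b \<inter> box c d = box p q" by (simp add: box_Int_box p_def q_def)
        have eq: "(\<lambda>z. indicator A z * g z) = (\<lambda>z. indicator (box p q) z * f z)"
          unfolding g_def A pq[symmetric] by (auto simp: indicator_def)
        show ?case
        proof (cases "box p q = {}")
          case True
          then show ?thesis unfolding eq by simp
        next
          case False
          then have "cbox p q = closure (box p q)" by simp
          also have "\<dots> \<subseteq> closure (box a b)" using pq by (intro closure_mono) blast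
          also have "\<dots> \<subseteq> cbox a b" by (rule closure_minimal[OF box_subset_cbox closed_cbox])
          finally show ?thesis unfolding eq using sub by (intro box_zero) auto
        qed
      next
        case empty
        then show ?case by simp
      next
        case (compl A)
        then have A: "A \<in> sets borel" by (simp add: borel_eq_box)
        have "(\<lambda>z. indicator (UNIV - A) z * g z) = (\<lambda>z. g z - indicator A z * g z)"
          by (auto simp: indicator_def)
        then show ?case using compl gA[OF A] g g0 by simp
      next
        case (union F)
        then have F: "F i \<in> sets lborel" for i by (auto simp: borel_eq_box subset_eq)
        have "(LINT z:(\<Union>i. F i)|lborel. g z) = (\<Sum>i. LINT z:F i|lborel. g z)"
          using F union(1) gA[of "\<Union>i. F i"]
          by (intro lebesgue_integral_countable_add) (auto simp: disjoint_family_on_def set_integrable_def)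
        then show ?case using union.IH by (simp add: set_lebesgue_integral_def)
      qed
    qed
    then have "AE z in lborel. g z = 0"
      using g by (intro density_unique_real) (auto simp: set_lebesgue_integral_def)
    moreover have "emeasure lborel (cbox a b - box a b) = 0"
      by (subst emeasure_Diff) (auto simp: emeasure_lborel_cbox_eq emeasure_lborel_box_eq box_subset_cbox)
    then have "AE z in lborel. z \<notin> cbox a b - box a b"
      by (intro AE_not_in null_setsI) auto
    ultimately show ?thesis by eventually_elim (auto simp: g_def)
  qed
  obtain \<D> where D: "countable \<D>" "\<D> \<subseteq> Pow \<Omega>" "\<And>X. X \<in> \<D> \<Longrightarrow> \<exists>a b. X = cbox a b" "\<Union>\<D> = \<Omega>"
    using open_countable_Union_open_cbox[OF \<open>open \<Omega>\<close>] by metis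
  have "AE z in lborel. z \<in> X \<longrightarrow> f z = 0" if "X \<in> \<D>" for X
    using that D(2) D(3)[OF that] box_AE by auto
  then have "AE z in lborel. \<forall>X\<in>\<D>. z \<in> X \<longrightarrow> f z = 0"
    using AE_ball_countable[OF D(1), of "\<lambda>z X. z \<in> X \<longrightarrow> f z = 0" lborel] by blast
  then show ?thesis by eventually_elim (use D(4) in auto)
qed

text \<open>
The residual of the best approximation of \<open>f\<close> by test functions is orthogonal to all test functions, hence zero by the fundamental lemma.
\<close>

theorem test_functions_dense:
  fixes f :: "'a::euclidean_space \<Rightarrow> real"
  assumes "open \<Omega>" and f: "square_integrable lborel f" and out: "\<And>z. z \<notin> \<Omega> \<Longrightarrow> f z = 0" and "\<delta> > 0"
  obtains \<phi> where "test_function \<Omega> \<phi>" "sq_norm lborel (\<lambda>z. f z - \<phi> z) < \<delta>"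
proof -
  define K where "K = {\<lambda>z. f z - \<phi> z |\<phi>. test_function \<Omega> \<phi>}"
  have Ksq: "square_integrable lborel h" if "h \<in> K" for h
    using that square_integrable_diff[OF f square_integrable_test_function] by (auto simp: K_def)
  obtain h g where h: "\<And>n::nat. h n \<in> K" and g: "square_integrable lborel g"
    and lim: "(\<lambda>n. sq_norm lborel (\<lambda>z. h n z - g z)) \<longlonglongrightarrow> 0"
    and AElim: "AE z in lborel. (\<lambda>n. h n z) \<longlonglongrightarrow> g z"
    and least: "\<And>k. k \<in> (\<Inter>n::nat. K) \<Longrightarrow> sq_norm lborel g \<le> sq_norm lborel k"
  proof (rule minimizing_sequence_converges[of "\<lambda>n::nat. K" lborel "sq_norm lborel (\<lambda>z. f z - 0)"])
    fix h g assume "h \<in> K" "g \<in> K"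
    then obtain \<phi> \<psi> where t: "test_function \<Omega> \<phi>" "test_function \<Omega> \<psi>"
      and eq: "h = (\<lambda>z. f z - \<phi> z)" "g = (\<lambda>z. f z - \<psi> z)" unfolding K_def by blast
    have "(\<lambda>z. (1/2) *\<^sub>R (h z + g z)) = (\<lambda>z. f z - 1/2 * (\<phi> z + \<psi> z))"
      by (auto simp: eq field_simps)
    moreover have "test_function \<Omega> (\<lambda>z. 1/2 * (\<phi> z + \<psi> z))"
      by (intro test_function_cmult test_function_add t)
    ultimately show "(\<lambda>z. (1/2) *\<^sub>R (h z + g z)) \<in> K"
      unfolding K_def by (intro CollectI exI[of _ "\<lambda>z. 1/2 * (\<phi> z + \<psi> z)"] conjI)
  next
    show "\<exists>h\<in>K. sq_norm lborel h \<le> sq_norm lborel (\<lambda>z. f z - 0)"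
      unfolding K_def using test_function_zero
      by (intro bexI[of _ "\<lambda>z. f z - 0"] CollectI exI[of _ "\<lambda>z. 0"] conjI refl order_refl)
  qed (use Ksq that in auto)
  have orth: "(LBINT z. g z * \<phi> z) = 0" if \<phi>: "test_function \<Omega> \<phi>" for \<phi>
  proof -
    note p = square_integrable_test_function[OF \<phi>]
    have ge: "sq_norm lborel g \<le> sq_norm lborel (\<lambda>z. g z + s *\<^sub>R \<phi> z)" for s
    proof -
      have tri: "sqrt (sq_norm lborel (\<lambda>z. h n z + s *\<^sub>R \<phi> z))
          \<le> sqrt (sq_norm lborel (\<lambda>z. h n z - g z)) + sqrt (sq_norm lborel (\<lambda>z. g z + s *\<^sub>R \<phi> z))" for n
      proof -
        have "(\<lambda>z. h n z + s *\<^sub>R \<phi> z) = (\<lambda>z. (h n z - g z) + (g z + s *\<^sub>R \<phi> z))" by auto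
        then show ?thesis
          using sqrt_sq_norm_triangle[OF square_integrable_diff[OF Ksq[OF h[of n]] g]
              square_integrable_add[OF g square_integrable_scaleR[OF p, of s]]] by simp
      qed
      have "sq_norm lborel g \<le> sq_norm lborel (\<lambda>z. h n z + s *\<^sub>R \<phi> z)" for n
      proof (rule least)
        obtain \<psi> where t: "test_function \<Omega> \<psi>" and eq: "h n = (\<lambda>z. f z - \<psi> z)"
          using h[of n] unfolding K_def mem_Collect_eq by metis
        have "(\<lambda>z. h n z + s *\<^sub>R \<phi> z) = (\<lambda>z. f z - (\<psi> z + (- s) * \<phi> z))" by (auto simp: eq)
        moreover have "test_function \<Omega> (\<lambda>z. \<psi> z + (- s) * \<phi> z)"
          by (intro test_function_cmult test_function_add t \<phi>)
        ultimately show "(\<lambda>z. h n z + s *\<^sub>R \<phi> z) \<in> (\<Inter>n::nat. K)"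
          unfolding K_def by (intro INT_I CollectI exI[of _ "\<lambda>z. \<psi> z + (- s) * \<phi> z"] conjI)
      qed
      then have "sqrt (sq_norm lborel g) - sqrt (sq_norm lborel (\<lambda>z. g z + s *\<^sub>R \<phi> z))
          \<le> sqrt (sq_norm lborel (\<lambda>z. h n z - g z))" for n
      proof -
        have "sqrt (sq_norm lborel g) \<le> sqrt (sq_norm lborel (\<lambda>z. h n z + s *\<^sub>R \<phi> z))"
          using \<open>\<And>n. sq_norm lborel g \<le> sq_norm lborel (\<lambda>z. h n z + s *\<^sub>R \<phi> z)\<close> by (rule real_sqrt_le_mono)
        then show ?thesis using tri[of n] by linarith
      qed
      moreover have "(\<lambda>n. sqrt (sq_norm lborel (\<lambda>z. h n z - g z))) \<longlonglongrightarrow> 0"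
        using tendsto_real_sqrt[OF lim] by simp
      ultimately have "sqrt (sq_norm lborel g) - sqrt (sq_norm lborel (\<lambda>z. g z + s *\<^sub>R \<phi> z)) \<le> 0"
        by (intro LIMSEQ_le_const) auto
      then show ?thesis by simp
    qed
    define b c where "b = (LBINT z. g z * \<phi> z)" and "c = sq_norm lborel \<phi>"
    have c0: "0 \<le> c" by (simp add: c_def)
    have "0 \<le> 2 * (s * b) + s\<^sup>2 * c" for s
      using ge[of s] sq_norm_add[OF g square_integrable_scaleR[OF p, of s]]
        sq_norm_scaleR[of lborel s \<phi>]
      by (simp add: b_def c_def mult.left_commute[of _ s])
    \<comment> \<open>The minimum is at \<open>- b / c\<close>; the added \<open>1\<close> covers \<open>c = 0\<close>.\<close>
    from this[of "- b / (c + 1)"]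
    have "0 \<le> (2 * (- b / (c + 1) * b) + (- b / (c + 1))\<^sup>2 * c) * (c + 1)\<^sup>2" by simp
    also have "\<dots> = 2 * ((- b / (c + 1) * (c + 1)) * b * (c + 1)) + (- b / (c + 1) * (c + 1))\<^sup>2 * c"
      by algebra
    also have "- b / (c + 1) * (c + 1) = - b" using c0 by simp
    also have "2 * (- b * b * (c + 1)) + (- b)\<^sup>2 * c = - (b\<^sup>2 * (c + 2))" by algebra
    finally have "b\<^sup>2 * (c + 2) \<le> 0" by simp
    then have "b = 0" using c0 by (simp add: mult_le_0_iff)
    then show ?thesis by (simp add: b_def)
  qed
  have "AE z in lborel. z \<in> \<Omega> \<longrightarrow> g z = 0"
    by (rule fundamental_lemma_calculus_of_variations[OF \<open>open \<Omega>\<close> square_integrable_locally[OF g] orth])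
  then have "AE z in lborel. g z = 0"
    using AElim
  proof eventually_elim
    case (elim z)
    have "h n z = 0" if "z \<notin> \<Omega>" for n
      using h[of n] that out test_function_outside unfolding K_def by fastforce
    then show ?case using elim by (cases "z \<in> \<Omega>") (auto simp: LIMSEQ_const_iff)
  qed
  then have "sq_norm lborel (\<lambda>z. h n z - g z) = sq_norm lborel (h n)" for n
    unfolding sq_norm_def using Ksq[OF h[of n]] g
    by (intro integral_cong_AE) (auto simp: square_integrable_def)
  then have "(\<lambda>n. sq_norm lborel (h n)) \<longlonglongrightarrow> 0" using lim by simp
  then have "eventually (\<lambda>n. sq_norm lborel (h n) < \<delta>) sequentially"
    using \<open>\<delta> > 0\<close> by (rule order_tendstoD(2))
  then obtain n where n: "sq_norm lborel (h n) < \<delta>" by (auto simp: eventually_sequentially)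
  obtain \<phi> where "h n = (\<lambda>z. f z - \<phi> z)" "test_function \<Omega> \<phi>"
    using h[of n] unfolding K_def mem_Collect_eq by metis
  then show ?thesis using n that[of \<phi>] by simp
qed

text \<open>
Duality: by density, the norm of a functional on test functions is the $L^2$ norm of the function that represents it.
\<close>

lemma sq_norm_le_by_testing:
  fixes g :: "'a::euclidean_space \<Rightarrow> real"
  assumes "open \<Omega>" and g: "square_integrable lborel g" and out: "\<And>z. z \<notin> \<Omega> \<Longrightarrow> g z = 0" and "0 \<le> A"
    and bd: "\<And>\<phi>. test_function \<Omega> \<phi> \<Longrightarrow> \<bar>LBINT z. g z * \<phi> z\<bar> \<le> A * sqrt (sq_norm lborel \<phi>)"
  shows "sqrt (sq_norm lborel g) \<le> A"
proof -
  define G where "G = sqrt (sq_norm lborel g)"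
  have G0: "0 \<le> G" by (simp add: G_def)
  have est: "G\<^sup>2 \<le> A * G + \<delta> * (G + A)" if pos: "\<delta> > 0" for \<delta>
  proof -
    obtain \<phi> where \<phi>: "test_function \<Omega> \<phi>" and "sq_norm lborel (\<lambda>z. g z - \<phi> z) < \<delta>\<^sup>2"
      using test_functions_dense[OF \<open>open \<Omega>\<close> g out zero_less_power[OF pos, of 2]] by metis
    then have close: "sqrt (sq_norm lborel (\<lambda>z. g z - \<phi> z)) \<le> \<delta>"
      using pos by (intro real_le_lsqrt) auto
    note p = square_integrable_test_function[OF \<phi>]
    have d: "square_integrable lborel (\<lambda>z. g z - \<phi> z)" by (intro square_integrable_diff g p)
    have "G\<^sup>2 = (LBINT z. g z * g z)"
      by (simp add: G_def sq_norm_def power2_eq_square)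
    also have "\<dots> = (LBINT z. g z * (g z - \<phi> z)) + (LBINT z. g z * \<phi> z)"
      using square_integrable_real_mult(1)[OF g d] square_integrable_real_mult(1)[OF g p]
      by (subst Bochner_Integration.integral_add[symmetric]) (auto simp: right_diff_distrib)
    also have "\<dots> \<le> G * sqrt (sq_norm lborel (\<lambda>z. g z - \<phi> z)) + A * sqrt (sq_norm lborel \<phi>)"
      using square_integrable_real_mult(2)[OF g d] bd[OF \<phi>] by (simp add: G_def)
    also have "sqrt (sq_norm lborel \<phi>) \<le> sqrt (sq_norm lborel (\<lambda>z. g z - \<phi> z)) + G"
    proof -
      have "sqrt (sq_norm lborel (\<lambda>z. (- 1) *\<^sub>R (g z - \<phi> z) + g z))
        \<le> sqrt (sq_norm lborel (\<lambda>z. (- 1) *\<^sub>R (g z - \<phi> z))) + sqrt (sq_norm lborel g)"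
        by (intro sqrt_sq_norm_triangle square_integrable_scaleR d g)
      then show ?thesis unfolding sq_norm_scaleR by (simp add: G_def)
    qed
    finally have "G\<^sup>2 \<le> G * sqrt (sq_norm lborel (\<lambda>z. g z - \<phi> z)) + A * (sqrt (sq_norm lborel (\<lambda>z. g z - \<phi> z)) + G)"
      using \<open>0 \<le> A\<close> by (simp add: mult_left_mono)
    also have "\<dots> \<le> G * \<delta> + A * (\<delta> + G)"
      using close G0 \<open>0 \<le> A\<close> by (intro add_mono mult_left_mono) auto
    finally show ?thesis by (simp add: algebra_simps)
  qed
  have "G\<^sup>2 \<le> A * G"
  proof (rule field_le_epsilon)
    fix e :: real assume "e > 0"
    have "e / (G + A + 1) * (G + A) \<le> e"
      using \<open>e > 0\<close> G0 \<open>0 \<le> A\<close> by (simp add: field_simps)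
    then show "G\<^sup>2 \<le> A * G + e"
      using est[of "e / (G + A + 1)"] \<open>e > 0\<close> G0 \<open>0 \<le> A\<close> by fastforce
  qed
  then have "G \<le> A" using G0 \<open>0 \<le> A\<close> by (cases "G = 0") (auto simp: power2_eq_square)
  then show ?thesis by (simp add: G_def)
qed

section \<open>Translations\<close>

lemma integral_lborel_translate:
  fixes f :: "'a::euclidean_space \<Rightarrow> real"
  assumes "f \<in> borel_measurable borel"
  shows "(LBINT z. f (z + v)) = (LBINT z. f z)"
proof -
  have "(LBINT z. f z) = (LINT z|distr lborel borel ((+) v). f z)"
    by (simp only: lborel_distr_plus)
  also have "\<dots> = (LBINT z. f (v + z))"
    by (rule integral_distr) (use assms in auto)
  finally show ?thesis by (simp add: add.commute)
qed

lemma integrable_lborel_translate: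
  fixes f :: "'a::euclidean_space \<Rightarrow> real"
  assumes "integrable lborel f"
  shows "integrable lborel (\<lambda>z. f (z + v))"
proof -
  have "f \<in> borel_measurable borel" using assms by auto
  moreover have "integrable (distr lborel borel ((+) v)) f"
    using assms by (simp only: lborel_distr_plus)
  ultimately have "integrable lborel (\<lambda>z. f (v + z))"
    by (subst (asm) integrable_distr_eq) auto
  then show ?thesis by (simp add: add.commute)
qed

lemma square_integrable_translate:
  fixes f :: "'a::euclidean_space \<Rightarrow> real"
  assumes f: "square_integrable lborel f"
  shows "square_integrable lborel (\<lambda>z. f (z + v))" "sq_norm lborel (\<lambda>z. f (z + v)) = sq_norm lborel f"
proof -
  note [measurable] = square_integrableD(1)[OF f, simplified]
  show "square_integrable lborel (\<lambda>z. f (z + v))"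
    using integrable_lborel_translate[OF square_integrableD(2)[OF f], of v]
    by (simp add: square_integrable_def)
  show "sq_norm lborel (\<lambda>z. f (z + v)) = sq_norm lborel f"
    unfolding sq_norm_def by (rule integral_lborel_translate) measurable
qed

lemma integral_shift_mult:
  fixes f g :: "'a::euclidean_space \<Rightarrow> real"
  assumes f: "square_integrable lborel f" and g: "square_integrable lborel g"
  shows "(LBINT z. f (z + v) * g z) = (LBINT z. f z * g (z - v))"
proof -
  note [measurable] = square_integrableD(1)[OF f, simplified] square_integrableD(1)[OF g, simplified]
  have "(LBINT z. f (z + v) * g ((z + v) - v)) = (LBINT z. f z * g (z - v))"
    by (rule integral_lborel_translate) measurable
  then show ?thesis by simp
qed

lemma dir_deriv_translate:
  assumes "f differentiable (at (z + v))"
  shows "dir_deriv d (\<lambda>z. f (z + v)) z = dir_deriv d f (z + v)"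
proof -
  have "((\<lambda>z. z + v) has_derivative (\<lambda>h. h)) (at z)" by (auto intro!: derivative_eq_intros)
  from has_derivative_compose[OF this has_derivative_dir_deriv[OF assms]]
  show ?thesis by (rule dir_deriv_eq)
qed

lemma has_derivative_along_line:
  fixes \<phi> :: "'a::real_normed_vector \<Rightarrow> real"
  assumes "\<And>z. \<phi> differentiable (at z)"
  shows "((\<lambda>s. \<phi> (z + s *\<^sub>R d)) has_real_derivative dir_deriv d \<phi> (z + s *\<^sub>R d)) (at s)"
proof -
  have "((\<lambda>s. z + s *\<^sub>R d) has_derivative (\<lambda>h. h *\<^sub>R d)) (at s)" by (auto intro!: derivative_eq_intros)
  from has_derivative_compose[OF this has_derivative_dir_deriv[OF assms]]
  have "((\<lambda>s. \<phi> (z + s *\<^sub>R d)) has_derivative (\<lambda>h. dir_deriv (h *\<^sub>R d) \<phi> (z + s *\<^sub>R d))) (at s)" .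
  moreover have "dir_deriv (h *\<^sub>R d) \<phi> (z + s *\<^sub>R d) = dir_deriv d \<phi> (z + s *\<^sub>R d) * h" for h
    using linear_simps(5)[OF has_derivative_bounded_linear[OF has_derivative_dir_deriv[OF assms]]]
    by (simp add: mult.commute)
  ultimately show ?thesis by (simp add: has_field_derivative_def)
qed

text \<open>
Differentiation under the integral sign. For parameters in a bounded range all translates of \<open>\<phi>\<close>
are supported in one compact set, and the difference quotients of \<open>\<phi>\<close> are bounded, so dominated
convergence applies.
\<close>

lemma integral_translated_test_has_derivative:
  fixes f :: "'a::euclidean_space \<Rightarrow> real"
  assumes loc: "\<And>K. compact K \<Longrightarrow> set_integrable lborel K f" and \<phi>: "test_function \<Omega> \<phi>"
  shows "((\<lambda>s. LBINT z. f z * \<phi> (z + s *\<^sub>R d))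
    has_real_derivative (LBINT z. f z * dir_deriv d \<phi> (z + s *\<^sub>R d))) (at s)"
proof -
  note diff = test_function_differentiable[OF \<phi>] and test' = test_function_dir_deriv[OF \<phi>, of d]
  obtain K where K: "compact K" "\<And>z. z \<notin> K \<Longrightarrow> \<phi> z = 0" using \<phi> test_function_support by metis
  obtain B where B: "\<And>z. \<bar>dir_deriv d \<phi> z\<bar> \<le> B" using test_function_bounded[OF test'] by (metis real_norm_def)
  have [measurable]: "\<phi> \<in> borel_measurable borel" "dir_deriv d \<phi> \<in> borel_measurable borel"
    using test_function_borel \<phi> test' by blast+
  have lip: "\<bar>\<phi> (z + p *\<^sub>R d) - \<phi> (z + q *\<^sub>R d)\<bar> \<le> B * \<bar>p - q\<bar>" for z p q
    using field_differentiable_bound[of UNIV "\<lambda>s. \<phi> (z + s *\<^sub>R d)" "\<lambda>s. dir_deriv d \<phi> (z + s *\<^sub>R d)" B p q]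
      has_derivative_along_line[OF diff] B by simp
  define N where "N R = (\<lambda>(z, t). z - t *\<^sub>R d) ` (K \<times> {-R..R})" for R
  have N: "compact (N R)" for R
    unfolding N_def by (intro compact_continuous_image) (auto intro!: continuous_intros compact_Times K simp: split_beta)
  have vanish: "\<phi> (z + p *\<^sub>R d) = 0" if "z \<notin> N R" "\<bar>p\<bar> \<le> R" for z p R
  proof (rule K(2), rule notI)
    assume "z + p *\<^sub>R d \<in> K"
    then have "(z + p *\<^sub>R d) - p *\<^sub>R d \<in> N R" unfolding N_def using that(2) by (intro image_eqI[of _ _ "(z + p *\<^sub>R d, p)"]) auto
    then show False using that(1) by simp
  qed
  have fN: "integrable lborel (\<lambda>z. indicator (N R) z * f z)" for R
    using loc[OF N, of R] by (simp add: set_integrable_def)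
  obtain B' where B': "\<And>z. \<bar>\<phi> z\<bar> \<le> B'" using test_function_bounded[OF \<phi>] by (metis real_norm_def)
  have eqN: "f z * \<phi> (z + p *\<^sub>R d) = (indicator (N R) z * f z) * \<phi> (z + p *\<^sub>R d)" if "\<bar>p\<bar> \<le> R" for z p R
    using vanish[OF _ that, of z] by (cases "z \<in> N R") auto
  have int: "integrable lborel (\<lambda>z. f z * \<phi> (z + p *\<^sub>R d))" for p
  proof -
    note [measurable] = borel_measurable_integrable[OF fN[of "\<bar>p\<bar>"]]
    have "integrable lborel (\<lambda>z. (indicator (N \<bar>p\<bar>) z * f z) * \<phi> (z + p *\<^sub>R d))"
    proof (rule Bochner_Integration.integrable_bound[where f="\<lambda>z. B' * (indicator (N \<bar>p\<bar>) z * f z)"])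
      show "AE z in lborel. norm (indicator (N \<bar>p\<bar>) z * f z * \<phi> (z + p *\<^sub>R d)) \<le> norm (B' * (indicator (N \<bar>p\<bar>) z * f z))"
        using B' by (intro AE_I2) (simp only: real_norm_def abs_mult_le_bound)
    qed (use fN in auto)
    then show ?thesis unfolding eqN[OF order_refl] .
  qed
  have "((\<lambda>p. ((LBINT z. f z * \<phi> (z + p *\<^sub>R d)) - (LBINT z. f z * \<phi> (z + s *\<^sub>R d))) / (p - s))
    \<longlongrightarrow> (LBINT z. f z * dir_deriv d \<phi> (z + s *\<^sub>R d))) (at s)"
    unfolding tendsto_at_iff_sequentially o_def
  proof (intro allI impI)
    fix X assume X: "\<forall>i. X i \<in> UNIV - {s}" "X \<longlonglongrightarrow> s"
    obtain R0 where R0: "\<And>n. \<bar>X n\<bar> \<le> R0"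
      using convergent_imp_Bseq[of X] X(2) by (auto simp: convergent_def Bseq_def)
    define R where "R = max R0 \<bar>s\<bar>"
    have XR: "\<bar>X n\<bar> \<le> R" and sR: "\<bar>s\<bar> \<le> R" for n using R0[of n] by (auto simp: R_def)
    note [measurable] = borel_measurable_integrable[OF fN[of R]]
    define q where "q n z = (\<phi> (z + X n *\<^sub>R d) - \<phi> (z + s *\<^sub>R d)) / (X n - s)" for n z
    have [measurable]: "q n \<in> borel_measurable borel" for n unfolding q_def by measurable
    have qlim: "(\<lambda>n. q n z) \<longlonglongrightarrow> dir_deriv d \<phi> (z + s *\<^sub>R d)" for z
      using has_derivative_along_line[OF diff, where z=z and s=s and d=d] X
      unfolding q_def has_field_derivative_iff tendsto_at_iff_sequentially o_def by blast
    have qbd: "\<bar>q n z\<bar> \<le> B" for n z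
    proof -
      have "\<bar>X n - s\<bar> > 0" using X(1) by auto
      then show ?thesis using lip[of z "X n" s] by (simp add: q_def field_simps)
    qed
    have qv: "q n z = 0" if "z \<notin> N R" for n z using vanish[OF that] XR sR by (simp add: q_def)
    have dv: "dir_deriv d \<phi> (z + s *\<^sub>R d) = 0" if "z \<notin> N R" for z
      using qlim[of z] qv[OF that] by (simp add: LIMSEQ_const_iff)
    have "(\<lambda>n. LBINT z. (indicator (N R) z * f z) * q n z)
      \<longlonglongrightarrow> (LBINT z. (indicator (N R) z * f z) * dir_deriv d \<phi> (z + s *\<^sub>R d))"
    proof (rule integral_dominated_convergence[where w="\<lambda>z. \<bar>B * (indicator (N R) z * f z)\<bar>"])
      show "AE z in lborel. (\<lambda>n. indicator (N R) z * f z * q n z) \<longlonglongrightarrow> indicator (N R) z * f z * dir_deriv d \<phi> (z + s *\<^sub>R d)"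
        by (intro AE_I2 tendsto_intros qlim)
      show "AE z in lborel. norm (indicator (N R) z * f z * q n z) \<le> \<bar>B * (indicator (N R) z * f z)\<bar>" for n
        using qbd by (intro AE_I2) (simp only: real_norm_def abs_mult_le_bound)
    qed (use fN in auto)
    moreover have "(\<lambda>z. (indicator (N R) z * f z) * q n z) = (\<lambda>z. f z * q n z)" for n
      using qv by (auto simp: fun_eq_iff indicator_def)
    moreover have "(\<lambda>z. (indicator (N R) z * f z) * dir_deriv d \<phi> (z + s *\<^sub>R d)) = (\<lambda>z. f z * dir_deriv d \<phi> (z + s *\<^sub>R d))"
      using dv by (auto simp: fun_eq_iff indicator_def)
    moreover have "(LBINT z. f z * q n z)
      = ((LBINT z. f z * \<phi> (z + X n *\<^sub>R d)) - (LBINT z. f z * \<phi> (z + s *\<^sub>R d))) / (X n - s)" for n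
      using int by (simp add: q_def right_diff_distrib flip: Bochner_Integration.integral_diff)
    ultimately show "(\<lambda>n. ((LBINT z. f z * \<phi> (z + X n *\<^sub>R d)) - (LBINT z. f z * \<phi> (z + s *\<^sub>R d))) / (X n - s))
      \<longlonglongrightarrow> (LBINT z. f z * dir_deriv d \<phi> (z + s *\<^sub>R d))" by simp
  qed
  then show ?thesis by (simp add: has_field_derivative_iff)
qed

text \<open>
The integral of a translate of \<open>\<phi>\<close> does not depend on the translation, so its derivative vanishes.
\<close>

lemma integral_dir_deriv_test_function:
  fixes \<phi> :: "'a::euclidean_space \<Rightarrow> real"
  assumes \<phi>: "test_function \<Omega> \<phi>"
  shows "(LBINT z. dir_deriv d \<phi> z) = 0"
proof -
  have "set_integrable lborel K (\<lambda>z::'a. 1::real)" if "compact K" for K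
    using that emeasure_bounded_finite[OF compact_imp_bounded[OF that]] borel_compact[OF that]
    by (simp add: set_integrable_def)
  from integral_translated_test_has_derivative[OF this \<phi>, where s=0 and d=d]
  have "((\<lambda>s. LBINT z. \<phi> (z + s *\<^sub>R d)) has_real_derivative (LBINT z. dir_deriv d \<phi> z)) (at 0)"
    by simp
  moreover have "(LBINT z. \<phi> (z + s *\<^sub>R d)) = (LBINT z. \<phi> z)" for s
    using test_function_borel[OF \<phi>] by (rule integral_lborel_translate)
  ultimately have "((\<lambda>s::real. LBINT z. \<phi> z) has_real_derivative (LBINT z. dir_deriv d \<phi> z)) (at 0)"
    by simp
  from DERIV_unique[OF this DERIV_const] show ?thesis .
qed

section \<open>Weak derivatives and difference quotients\<close>

text \<open>
Both functions live on the whole space and vanish outside \<open>\<Omega>\<close>. Then translations, which need not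
preserve a domain of integration, act on them without case distinctions.
\<close>

definition weak_deriv_L2 :: "'a::euclidean_space set \<Rightarrow> 'a \<Rightarrow> ('a \<Rightarrow> real) \<Rightarrow> ('a \<Rightarrow> real) \<Rightarrow> bool"
  where "weak_deriv_L2 \<Omega> d f g \<longleftrightarrow> square_integrable lborel f \<and> square_integrable lborel g \<and>
    (\<forall>z. z \<notin> \<Omega> \<longrightarrow> f z = 0 \<and> g z = 0) \<and>
    (\<forall>\<phi>. test_function \<Omega> \<phi> \<longrightarrow>
      (LBINT z. f z * dir_deriv d \<phi> z) = - (LBINT z. g z * \<phi> z))"

definition translation_invariant :: "'a::real_vector set \<Rightarrow> 'a \<Rightarrow> bool"
  where "translation_invariant \<Omega> d \<longleftrightarrow> (\<forall>z s. z + s *\<^sub>R d \<in> \<Omega> \<longleftrightarrow> z \<in> \<Omega>)"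

definition diff_quot :: "'a::real_vector \<Rightarrow> real \<Rightarrow> ('a \<Rightarrow> real) \<Rightarrow> 'a \<Rightarrow> real"
  where "diff_quot d s f z = (f (z + s *\<^sub>R d) - f z) / s"

lemma weak_deriv_L2D:
  assumes "weak_deriv_L2 \<Omega> d f g"
  shows "square_integrable lborel f" "square_integrable lborel g"
    "\<And>z. z \<notin> \<Omega> \<Longrightarrow> f z = 0" "\<And>z. z \<notin> \<Omega> \<Longrightarrow> g z = 0"
    "\<And>\<phi>. test_function \<Omega> \<phi> \<Longrightarrow> (LBINT z. f z * dir_deriv d \<phi> z) = - (LBINT z. g z * \<phi> z)"
  using assms by (auto simp: weak_deriv_L2_def)

lemma test_function_translate_invariant:
  assumes "translation_invariant \<Omega> d" "test_function \<Omega> \<phi>"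
  shows "test_function \<Omega> (\<lambda>z. \<phi> (z + s *\<^sub>R d))"
proof (rule test_function_translate[OF assms(2)])
  show "(\<lambda>z. z - s *\<^sub>R d) ` \<Omega> \<subseteq> \<Omega>"
    using assms(1) unfolding translation_invariant_def
    by (metis image_subsetI scaleR_minus_left uminus_add_conv_diff add.commute)
qed

lemma square_integrable_diff_quot:
  assumes "square_integrable lborel f"
  shows "square_integrable lborel (diff_quot d s f)"
proof -
  have "square_integrable lborel (\<lambda>z. (1/s) *\<^sub>R (f (z + s *\<^sub>R d) - f z))"
    by (intro square_integrable_scaleR square_integrable_diff square_integrable_translate assms)
  also have "(\<lambda>z. (1/s) *\<^sub>R (f (z + s *\<^sub>R d) - f z)) = diff_quot d s f" by (auto simp: diff_quot_def)
  finally show ?thesis .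
qed

lemma diff_quot_outside:
  "translation_invariant \<Omega> d \<Longrightarrow> (\<And>z. z \<notin> \<Omega> \<Longrightarrow> f z = 0) \<Longrightarrow> z \<notin> \<Omega> \<Longrightarrow> diff_quot d s f z = 0"
  by (simp add: diff_quot_def translation_invariant_def)

text \<open>
Summation by parts: the adjoint of a forward quotient is the negative of a backward quotient.
\<close>

lemma diff_quot_adjoint:
  assumes f: "square_integrable lborel f" and g: "square_integrable lborel g"
  shows "(LBINT z. diff_quot d s f z * g z) = - (LBINT z. f z * diff_quot d (- s) g z)"
proof -
  have "(LBINT z. diff_quot d s f z * g z)
    = (LBINT z. (f (z + s *\<^sub>R d) * g z) / s - (f z * g z) / s)"
    by (simp add: diff_quot_def left_diff_distrib diff_divide_distrib)
  also have "\<dots> = (LBINT z. f (z + s *\<^sub>R d) * g z) / s - (LBINT z. f z * g z) / s"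
    using square_integrable_real_mult(1)[OF square_integrable_translate(1)[OF f] g, of "s *\<^sub>R d"]
      square_integrable_real_mult(1)[OF f g] by simp
  also have "(LBINT z. f (z + s *\<^sub>R d) * g z) = (LBINT z. f z * g (z + (- s) *\<^sub>R d))"
    using integral_shift_mult[OF f g, of "s *\<^sub>R d"] by simp
  also have "\<dots> / s - (LBINT z. f z * g z) / s
    = (LBINT z. (f z * g (z + (- s) *\<^sub>R d)) / s - (f z * g z) / s)"
    using square_integrable_real_mult(1)[OF f square_integrable_translate(1)[OF g], of "(- s) *\<^sub>R d"]
      square_integrable_real_mult(1)[OF f g] by simp
  also have "\<dots> = (LBINT z. - (f z * diff_quot d (- s) g z))"
    by (simp add: diff_quot_def right_diff_distrib diff_divide_distrib)
  finally show ?thesis by simp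
qed

lemma integral_diff_quot_mult:
  fixes f g :: "'a::euclidean_space \<Rightarrow> real"
  assumes f: "square_integrable lborel f" and g: "square_integrable lborel g"
  shows "(LBINT z. diff_quot d s f z * g z)
    = - (((LBINT z. f z * g (z + (- s) *\<^sub>R d)) - (LBINT z. f z * g z)) / (- s))"
proof -
  have "(LBINT z. diff_quot d s f z * g z) = - (LBINT z. f z * diff_quot d (- s) g z)"
    by (rule diff_quot_adjoint[OF f g])
  also have "(LBINT z. f z * diff_quot d (- s) g z)
    = (LBINT z. (f z * g (z + (- s) *\<^sub>R d)) / (- s) - (f z * g z) / (- s))"
    unfolding diff_quot_def diff_divide_distrib right_diff_distrib times_divide_eq_right ..
  also have "\<dots> = ((LBINT z. f z * g (z + (- s) *\<^sub>R d)) - (LBINT z. f z * g z)) / (- s)"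
    using square_integrable_real_mult(1)[OF f square_integrable_translate(1)[OF g], of "(- s) *\<^sub>R d"]
      square_integrable_real_mult(1)[OF f g]
    unfolding diff_divide_distrib by (subst Bochner_Integration.integral_diff) auto
  finally show ?thesis .
qed

text \<open>
The derivative of $s \mapsto \int f\, \phi(\cdot + s d)$ is $-\int g\, \phi(\cdot + s d)$, which Cauchy--Schwarz bounds; then the mean value inequality.
\<close>

lemma test_function_pairing_shift_bound:
  assumes fg: "weak_deriv_L2 \<Omega> d f g" and inv: "translation_invariant \<Omega> d" and \<phi>: "test_function \<Omega> \<phi>"
  shows "\<bar>(LBINT z. f z * \<phi> (z + s *\<^sub>R d)) - (LBINT z. f z * \<phi> z)\<bar>
    \<le> \<bar>s\<bar> * (sqrt (sq_norm lborel g) * sqrt (sq_norm lborel \<phi>))"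
proof -
  let ?h = "\<lambda>s. LBINT z. f z * \<phi> (z + s *\<^sub>R d)"
  let ?h' = "\<lambda>s. LBINT z. f z * dir_deriv d \<phi> (z + s *\<^sub>R d)"
  note D = weak_deriv_L2D[OF fg]
  have der: "(?h has_real_derivative ?h' s) (at s)" for s
    by (rule integral_translated_test_has_derivative[OF square_integrable_locally[OF D(1)] \<phi>])
  have bd: "\<bar>?h' s\<bar> \<le> sqrt (sq_norm lborel g) * sqrt (sq_norm lborel \<phi>)" for s
  proof -
    have "?h' s = - (LBINT z. g z * \<phi> (z + s *\<^sub>R d))"
      using D(5)[OF test_function_translate_invariant[OF inv \<phi>]]
        dir_deriv_translate[OF test_function_differentiable[OF \<phi>]] by simp
    then show ?thesis
      using square_integrable_real_mult(2)[OF D(2) square_integrable_translate(1)[OF square_integrable_test_function[OF \<phi>]]]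
        square_integrable_translate(2)[OF square_integrable_test_function[OF \<phi>]] by simp
  qed
  have "norm (?h s - ?h 0) \<le> (sqrt (sq_norm lborel g) * sqrt (sq_norm lborel \<phi>)) * norm (s - 0)"
    by (rule field_differentiable_bound[of UNIV ?h ?h']) (use der bd in auto)
  then show ?thesis by (simp add: mult.commute)
qed

lemma diff_quot_sq_norm_le:
  assumes "open \<Omega>" and fg: "weak_deriv_L2 \<Omega> d f g" and inv: "translation_invariant \<Omega> d"
  shows "sqrt (sq_norm lborel (diff_quot d s f)) \<le> sqrt (sq_norm lborel g)"
proof (rule sq_norm_le_by_testing[OF \<open>open \<Omega>\<close>])
  note D = weak_deriv_L2D[OF fg]
  show "square_integrable lborel (diff_quot d s f)" by (rule square_integrable_diff_quot[OF D(1)])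
  show "diff_quot d s f z = 0" if "z \<notin> \<Omega>" for z using diff_quot_outside[OF inv D(3) that] .
  fix \<phi> :: "'a \<Rightarrow> real" assume \<phi>: "test_function \<Omega> \<phi>"
  note p = square_integrable_test_function[OF \<phi>]
  have "\<bar>LBINT z. diff_quot d s f z * \<phi> z\<bar>
    = \<bar>(LBINT z. f z * \<phi> (z + (- s) *\<^sub>R d)) - (LBINT z. f z * \<phi> z)\<bar> / \<bar>s\<bar>"
    unfolding integral_diff_quot_mult[OF D(1) p] by (simp del: scaleR_minus_left)
  also have "\<dots> \<le> sqrt (sq_norm lborel g) * sqrt (sq_norm lborel \<phi>)"
    using test_function_pairing_shift_bound[OF fg inv \<phi>, of "- s"]
    by (cases "s = 0") (auto simp: field_simps simp del: scaleR_minus_left)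
  finally show "\<bar>LBINT z. diff_quot d s f z * \<phi> z\<bar> \<le> sqrt (sq_norm lborel g) * sqrt (sq_norm lborel \<phi>)" .
qed simp

text \<open>
Against test functions this is the definition of the weak derivative. The uniform bound on difference quotients extends it to square integrable functions by density.
\<close>

lemma diff_quot_tendsto_weakly:
  assumes "open \<Omega>" and fg: "weak_deriv_L2 \<Omega> d f g" and inv: "translation_invariant \<Omega> d"
    and \<psi>: "square_integrable lborel \<psi>" and out: "\<And>z. z \<notin> \<Omega> \<Longrightarrow> \<psi> z = 0"
  shows "((\<lambda>s. LBINT z. diff_quot d s f z * \<psi> z) \<longlongrightarrow> (LBINT z. g z * \<psi> z)) (at 0)"
proof (rule tendstoI)
  note D = weak_deriv_L2D[OF fg]
  fix e :: real assume "e > 0"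
  define G where "G = sqrt (sq_norm lborel g)"
  have G0: "0 \<le> G" by (simp add: G_def)
  define \<delta> where "\<delta> = e / (4 * (G + 1))"
  have \<delta>: "\<delta> > 0" "2 * (G * \<delta>) \<le> e / 2"
    using \<open>e > 0\<close> G0 by (auto simp: \<delta>_def field_simps)
  obtain \<phi> where \<phi>: "test_function \<Omega> \<phi>" and "sq_norm lborel (\<lambda>z. \<psi> z - \<phi> z) < \<delta>\<^sup>2"
    using test_functions_dense[OF \<open>open \<Omega>\<close> \<psi> out zero_less_power[OF \<delta>(1), of 2]] by metis
  then have close: "sqrt (sq_norm lborel (\<lambda>z. \<psi> z - \<phi> z)) \<le> \<delta>"
    using \<delta> by (intro real_le_lsqrt) auto
  note p = square_integrable_test_function[OF \<phi>]
  have q: "square_integrable lborel (\<lambda>z. \<psi> z - \<phi> z)" by (intro square_integrable_diff \<psi> p)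
  have split: "(LBINT z. k z * \<psi> z) = (LBINT z. k z * \<phi> z) + (LBINT z. k z * (\<psi> z - \<phi> z))"
    if "square_integrable lborel k" for k
    using square_integrable_real_mult(1)[OF that p] square_integrable_real_mult(1)[OF that q]
    by (subst Bochner_Integration.integral_add[symmetric]) (auto simp: right_diff_distrib)
  have err: "\<bar>LBINT z. k z * (\<psi> z - \<phi> z)\<bar> \<le> G * \<delta>"
    if k: "square_integrable lborel k" and "sqrt (sq_norm lborel k) \<le> G" for k
  proof -
    have "\<bar>LBINT z. k z * (\<psi> z - \<phi> z)\<bar> \<le> sqrt (sq_norm lborel k) * sqrt (sq_norm lborel (\<lambda>z. \<psi> z - \<phi> z))"
      by (rule square_integrable_real_mult(2)[OF k q])
    also have "\<dots> \<le> G * \<delta>" using that(2) close G0 by (intro mult_mono) auto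
    finally show ?thesis .
  qed
  have "((\<lambda>s. ((LBINT z. f z * \<phi> (z + s *\<^sub>R d)) - (LBINT z. f z * \<phi> z)) / s)
    \<longlongrightarrow> (LBINT z. f z * dir_deriv d \<phi> z)) (at 0)"
    using integral_translated_test_has_derivative[OF square_integrable_locally[OF D(1)] \<phi>, where s=0 and d=d]
    by (simp add: has_field_derivative_iff)
  then have "((\<lambda>s. ((LBINT z. f z * \<phi> (z + (- s) *\<^sub>R d)) - (LBINT z. f z * \<phi> z)) / (- s))
    \<longlongrightarrow> (LBINT z. f z * dir_deriv d \<phi> z)) (at 0)"
    by (rule filterlim_compose[where g="\<lambda>s. ((LBINT z. f z * \<phi> (z + s *\<^sub>R d)) - (LBINT z. f z * \<phi> z)) / s"])
       (auto simp: filterlim_at eventually_at_filter intro!: tendsto_eq_intros)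
  then have "((\<lambda>s. - (((LBINT z. f z * \<phi> (z + (- s) *\<^sub>R d)) - (LBINT z. f z * \<phi> z)) / (- s)))
    \<longlongrightarrow> - (LBINT z. f z * dir_deriv d \<phi> z)) (at 0)" by (rule tendsto_minus)
  moreover have "(LBINT z. diff_quot d s f z * \<phi> z)
    = - (((LBINT z. f z * \<phi> (z + (- s) *\<^sub>R d)) - (LBINT z. f z * \<phi> z)) / (- s))" for s
    by (rule integral_diff_quot_mult[OF D(1) p])
  ultimately have "((\<lambda>s. LBINT z. diff_quot d s f z * \<phi> z) \<longlongrightarrow> (LBINT z. g z * \<phi> z)) (at 0)"
    using D(5)[OF \<phi>] by simp
  from tendstoD[OF this, of "e/2"]
  have "eventually (\<lambda>s. dist (LBINT z. diff_quot d s f z * \<phi> z) (LBINT z. g z * \<phi> z) < e/2) (at 0)"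
    using \<open>e > 0\<close> by simp
  then show "eventually (\<lambda>s. dist (LBINT z. diff_quot d s f z * \<psi> z) (LBINT z. g z * \<psi> z) < e) (at 0)"
  proof (rule eventually_mono)
    fix s assume "dist (LBINT z. diff_quot d s f z * \<phi> z) (LBINT z. g z * \<phi> z) < e/2"
    moreover have "\<bar>LBINT z. diff_quot d s f z * (\<psi> z - \<phi> z)\<bar> \<le> G * \<delta>"
      using diff_quot_sq_norm_le[OF \<open>open \<Omega>\<close> fg inv] by (intro err square_integrable_diff_quot D(1)) (simp add: G_def)
    moreover have "\<bar>LBINT z. g z * (\<psi> z - \<phi> z)\<bar> \<le> G * \<delta>"
      by (intro err D(2)) (simp add: G_def)
    ultimately show "dist (LBINT z. diff_quot d s f z * \<psi> z) (LBINT z. g z * \<psi> z) < e"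
      unfolding split[OF D(2)] split[OF square_integrable_diff_quot[OF D(1)]] dist_real_def using \<delta>(2) by linarith
  qed
qed

text \<open>
Pass to the limit in summation by parts. In each integral only one factor is a difference quotient, so weak convergence is enough.
\<close>

lemma weak_deriv_L2_integration_by_parts:
  assumes "open \<Omega>" and inv: "translation_invariant \<Omega> d"
    and 1: "weak_deriv_L2 \<Omega> d f1 g1" and 2: "weak_deriv_L2 \<Omega> d f2 g2"
  shows "(LBINT z. g1 z * f2 z) = - (LBINT z. f1 z * g2 z)"
proof -
  note D1 = weak_deriv_L2D[OF 1] and D2 = weak_deriv_L2D[OF 2]
  have "((\<lambda>s. LBINT z. diff_quot d s f2 z * f1 z) \<longlongrightarrow> (LBINT z. g2 z * f1 z)) (at 0)"
    by (rule diff_quot_tendsto_weakly[OF \<open>open \<Omega>\<close> 2 inv D1(1,3)])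
  then have "((\<lambda>s. LBINT z. diff_quot d (- s) f2 z * f1 z) \<longlongrightarrow> (LBINT z. g2 z * f1 z)) (at 0)"
    by (rule filterlim_compose) (auto simp: filterlim_at eventually_at_filter intro!: tendsto_eq_intros)
  then have "((\<lambda>s. - (LBINT z. f1 z * diff_quot d (- s) f2 z)) \<longlongrightarrow> - (LBINT z. f1 z * g2 z)) (at 0)"
    by (intro tendsto_minus) (simp add: mult.commute)
  moreover have "((\<lambda>s. LBINT z. diff_quot d s f1 z * f2 z) \<longlongrightarrow> (LBINT z. g1 z * f2 z)) (at 0)"
    by (rule diff_quot_tendsto_weakly[OF \<open>open \<Omega>\<close> 1 inv D2(1,3)])
  ultimately show ?thesis
    using tendsto_unique[OF trivial_limit_at] unfolding diff_quot_adjoint[OF D1(1) D2(1)] by blast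
qed

lemma weak_deriv_L2_diff_quot:
  assumes fg: "weak_deriv_L2 \<Omega> d f g" and inv: "translation_invariant \<Omega> d'"
  shows "weak_deriv_L2 \<Omega> d (diff_quot d' s f) (diff_quot d' s g)"
  unfolding weak_deriv_L2_def
proof (intro conjI allI impI)
  note D = weak_deriv_L2D[OF fg]
  show "square_integrable lborel (diff_quot d' s f)" "square_integrable lborel (diff_quot d' s g)"
    by (intro square_integrable_diff_quot D)+
  show "diff_quot d' s f z = 0" "diff_quot d' s g z = 0" if "z \<notin> \<Omega>" for z
    using diff_quot_outside[OF inv _ that] D(3,4) by blast+
  fix \<phi> :: "'a \<Rightarrow> real" assume \<phi>: "test_function \<Omega> \<phi>"
  note p = square_integrable_test_function[OF \<phi>]
    and p' = square_integrable_test_function[OF test_function_dir_deriv[OF \<phi>, of d]]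
    and ps = test_function_translate_invariant[OF inv \<phi>, of "- s"]
  have "(LBINT z. f z * dir_deriv d \<phi> (z + (- s) *\<^sub>R d')) = - (LBINT z. g z * \<phi> (z + (- s) *\<^sub>R d'))"
    using D(5)[OF ps] dir_deriv_translate[OF test_function_differentiable[OF \<phi>], of _ "(- s) *\<^sub>R d'"]
    by (simp del: scaleR_minus_left)
  then show "(LBINT z. diff_quot d' s f z * dir_deriv d \<phi> z) = - (LBINT z. diff_quot d' s g z * \<phi> z)"
  proof -
    assume eq: "(LBINT z. f z * dir_deriv d \<phi> (z + (- s) *\<^sub>R d')) = - (LBINT z. g z * \<phi> (z + (- s) *\<^sub>R d'))"
    have arith: "- ((- a - - b) / (- s)) = - (- ((a - b) / (- s)))" for a b
      by (cases "s = 0") (simp_all add: field_simps)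
    show ?thesis
      unfolding integral_diff_quot_mult[OF D(1) p'] integral_diff_quot_mult[OF D(2) p] D(5)[OF \<phi>] eq
      by (rule arith)
  qed
qed

text \<open>
An inequality of Landau--Kolmogorov type, proved by duality. With
$k(s) = \int f\, \phi(\cdot + s d)$ the number $-\int g\, \phi$ is $k'(0)$; it differs from a difference
quotient of \<open>k\<close> by at most \<open>s\<close> times the bound on $k''$.
\<close>

lemma weak_deriv_L2_interpolation:
  assumes "open \<Omega>" and inv: "translation_invariant \<Omega> d"
    and fg: "weak_deriv_L2 \<Omega> d f g" and gh: "weak_deriv_L2 \<Omega> d g h" and "s > 0"
  shows "sqrt (sq_norm lborel g) \<le> 2 / s * sqrt (sq_norm lborel f) + s * sqrt (sq_norm lborel h)"
proof (rule sq_norm_le_by_testing[OF \<open>open \<Omega>\<close>])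
  note D = weak_deriv_L2D[OF fg] and E = weak_deriv_L2D[OF gh]
  show "square_integrable lborel g" "\<And>z. z \<notin> \<Omega> \<Longrightarrow> g z = 0" using D by auto
  show "0 \<le> 2 / s * sqrt (sq_norm lborel f) + s * sqrt (sq_norm lborel h)" using \<open>s > 0\<close> by simp
  fix \<phi> :: "'a \<Rightarrow> real" assume \<phi>: "test_function \<Omega> \<phi>"
  note p = square_integrable_test_function[OF \<phi>]
  let ?k = "\<lambda>s. LBINT z. f z * \<phi> (z + s *\<^sub>R d)"
  define F H P where "F = sqrt (sq_norm lborel f)" and "H = sqrt (sq_norm lborel h)" and "P = sqrt (sq_norm lborel \<phi>)"
  have der: "(?k has_real_derivative - (LBINT z. g z * \<phi> (z + t *\<^sub>R d))) (at t)" for t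
    using integral_translated_test_has_derivative[OF square_integrable_locally[OF D(1)] \<phi>, where s=t and d=d]
      D(5)[OF test_function_translate_invariant[OF inv \<phi>, of t]]
      dir_deriv_translate[OF test_function_differentiable[OF \<phi>]] by simp
  have kb: "\<bar>?k t\<bar> \<le> F * P" for t
    using square_integrable_real_mult(2)[OF D(1) square_integrable_translate(1)[OF p]]
      square_integrable_translate(2)[OF p] by (simp add: F_def P_def)
  obtain t where t: "0 < t" "t < s" and "?k s - ?k 0 = (s - 0) * - (LBINT z. g z * \<phi> (z + t *\<^sub>R d))"
    using MVT2[OF \<open>s > 0\<close>, of ?k "\<lambda>t. - (LBINT z. g z * \<phi> (z + t *\<^sub>R d))"] der by auto
  then have "\<bar>s * (LBINT z. g z * \<phi> (z + t *\<^sub>R d))\<bar> = \<bar>?k s - ?k 0\<bar>" by simp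
  also have "\<dots> \<le> 2 * (F * P)" using kb[of s] kb[of 0] by linarith
  finally have 1: "\<bar>LBINT z. g z * \<phi> (z + t *\<^sub>R d)\<bar> \<le> 2 / s * F * P"
    using \<open>s > 0\<close> by (simp add: abs_mult field_simps)
  have 2: "\<bar>(LBINT z. g z * \<phi> (z + t *\<^sub>R d)) - (LBINT z. g z * \<phi> z)\<bar> \<le> s * (H * P)"
    using test_function_pairing_shift_bound[OF gh inv \<phi>, of t] t
      mult_right_mono[of t s "H * P"] by (simp add: H_def P_def)
  show "\<bar>LBINT z. g z * \<phi> z\<bar> \<le> (2 / s * sqrt (sq_norm lborel f) + s * sqrt (sq_norm lborel h)) * sqrt (sq_norm lborel \<phi>)"
    using 1 2 unfolding F_def[symmetric] H_def[symmetric] P_def[symmetric]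
    by (simp add: distrib_right mult.assoc)
qed

text \<open>
Strong convergence of the functions and boundedness of second derivatives give strong convergence of first derivatives. This is how $\nabla\sqrt\rho$ is shown to vanish in the limit.
\<close>

lemma weak_deriv_L2_tendsto_0:
  assumes "open \<Omega>" and inv: "translation_invariant \<Omega> d"
    and fg: "\<And>n. weak_deriv_L2 \<Omega> d (f n) (g n)" and gh: "\<And>n. weak_deriv_L2 \<Omega> d (g n) (h n)"
    and f0: "(\<lambda>n. sq_norm lborel (f n)) \<longlonglongrightarrow> 0" and hB: "\<And>n. sq_norm lborel (h n) \<le> B"
  shows "(\<lambda>n. sq_norm lborel (g n)) \<longlonglongrightarrow> 0"
proof -
  have B0: "0 \<le> B" using hB[of 0] sq_norm_nonneg[of lborel "h 0"] by linarith
  have sf: "(\<lambda>n. sqrt (sq_norm lborel (f n))) \<longlonglongrightarrow> 0" using tendsto_real_sqrt[OF f0] by simp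
  have "(\<lambda>n. sqrt (sq_norm lborel (g n))) \<longlonglongrightarrow> 0"
  proof (rule LIMSEQ_I)
    fix e :: real assume "e > 0"
    \<comment> \<open>This step size makes the second derivative contribute less than \<open>e / 2\<close>.\<close>
    define s where "s = e / 2 / (sqrt B + 1)"
    have B1: "sqrt B + 1 > 0" using real_sqrt_ge_zero[OF B0] by linarith
    then have "s > 0" using \<open>e > 0\<close> unfolding s_def by (intro divide_pos_pos) auto
    moreover have "s * (sqrt B + 1) = e / 2" using B1 unfolding s_def by (intro nonzero_eq_divide_eq[THEN iffD1, OF _ refl]) simp
    ultimately have s: "s > 0" "s * sqrt B < e / 2" by (simp_all add: distrib_left)
    have "(\<lambda>n. 2 / s * sqrt (sq_norm lborel (f n))) \<longlonglongrightarrow> 2 / s * 0" by (intro tendsto_intros sf)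
    then have "eventually (\<lambda>n. 2 / s * sqrt (sq_norm lborel (f n)) < e / 2) sequentially"
      using \<open>e > 0\<close> by (intro order_tendstoD(2)) auto
    then obtain N where N: "\<And>n. n \<ge> N \<Longrightarrow> 2 / s * sqrt (sq_norm lborel (f n)) < e / 2"
      by (auto simp: eventually_sequentially)
    have "norm (sqrt (sq_norm lborel (g n)) - 0) < e" if "n \<ge> N" for n
    proof -
      have "s * sqrt (sq_norm lborel (h n)) \<le> s * sqrt B" using s hB by (intro mult_left_mono) auto
      then show ?thesis
        using weak_deriv_L2_interpolation[OF \<open>open \<Omega>\<close> inv fg gh s(1), of n] N[OF that] s(2) by simp
    qed
    then show "\<exists>N. \<forall>n\<ge>N. norm (sqrt (sq_norm lborel (g n)) - 0) < e" by blast
  qed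
  from tendsto_power[OF this, of 2] show ?thesis by simp
qed

text \<open>
Formally $\int \partial_j u_i \, \partial_i u_j = \int \partial_i u_i \, \partial_j u_j$. As \<open>u\<close> has only one derivative, $\partial_i u_j$ is
first replaced by a difference quotient, which can be moved to the other factor and commutes with
$\partial_j$. After integration by parts in direction \<open>j\<close> the sum over \<open>j\<close> is an integral against the
divergence and vanishes even before the step size tends to zero.
\<close>

theorem integral_gradient_transpose_eq_0:
  fixes u :: "'i::finite \<Rightarrow> 'a::euclidean_space \<Rightarrow> real"
  assumes "open \<Omega>" and inv: "\<And>j. translation_invariant \<Omega> (e j)"
    and G: "\<And>i j. weak_deriv_L2 \<Omega> (e j) (u i) (G i j)"
    and div: "AE z in lborel. (\<Sum>j\<in>UNIV. G j j z) = 0"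
  shows "(\<Sum>i\<in>UNIV. \<Sum>j\<in>UNIV. LBINT z. G i j z * G j i z) = 0"
proof (rule sum.neutral, rule ballI)
  fix i
  note D = weak_deriv_L2D[OF G]
  have zero: "(\<Sum>j\<in>UNIV. LBINT z. diff_quot (e i) s (u j) z * G i j z) = 0" for s
  proof -
    define w where "w = diff_quot (e i) (- s) (u i)"
    have w: "square_integrable lborel w" unfolding w_def by (intro square_integrable_diff_quot D(1))
    have "(LBINT z. diff_quot (e i) s (u j) z * G i j z) = (LBINT z. w z * G j j z)" for j
    proof -
      have "(LBINT z. diff_quot (e i) s (u j) z * G i j z)
        = - (LBINT z. u j z * diff_quot (e i) (- s) (G i j) z)"
        by (rule diff_quot_adjoint[OF D(1) D(2)])
      also have "(LBINT z. u j z * diff_quot (e i) (- s) (G i j) z)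
        = - (LBINT z. G j j z * w z)"
        using weak_deriv_L2_integration_by_parts[OF \<open>open \<Omega>\<close> inv G[of j j] weak_deriv_L2_diff_quot[OF G[of j i] inv[of i], of "- s"]]
        unfolding w_def by simp
      finally show ?thesis by (simp add: mult.commute)
    qed
    then have "(\<Sum>j\<in>UNIV. LBINT z. diff_quot (e i) s (u j) z * G i j z)
      = (LBINT z. w z * (\<Sum>j\<in>UNIV. G j j z))"
      unfolding sum_distrib_left
      using square_integrable_real_mult(1)[OF w D(2)]
      by (subst Bochner_Integration.integral_sum) auto
    also have "\<dots> = (LINT z|(lborel :: 'a measure). 0)"
    proof (rule Bochner_Integration.integral_cong_AE)
      have [measurable]: "G j j \<in> borel_measurable lborel" for j by (rule square_integrableD(1)[OF D(2)])
      note [measurable] = square_integrableD(1)[OF w]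
      show "(\<lambda>z. w z * (\<Sum>j\<in>UNIV. G j j z)) \<in> borel_measurable lborel" by measurable
      show "AE z in lborel. w z * (\<Sum>j\<in>UNIV. G j j z) = 0" using div by eventually_elim simp
    qed simp
    finally show ?thesis by simp
  qed
  have "((\<lambda>s. \<Sum>j\<in>UNIV. LBINT z. diff_quot (e i) s (u j) z * G i j z)
    \<longlongrightarrow> (\<Sum>j\<in>UNIV. LBINT z. G j i z * G i j z)) (at 0)"
    using diff_quot_tendsto_weakly[OF \<open>open \<Omega>\<close> G inv D(2) D(4)] by (intro tendsto_sum)
  then have "(\<Sum>j\<in>UNIV. LBINT z. G j i z * G i j z) = 0"
    unfolding zero by (rule tendsto_unique[OF trivial_limit_at _ tendsto_const])
  then show "(\<Sum>j\<in>UNIV. LBINT z. G i j z * G j i z) = 0" by (simp add: mult.commute)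
qed

section \<open>Extension by zero\<close>

definition zero_ext :: "'a set \<Rightarrow> ('a \<Rightarrow> 'b::real_vector) \<Rightarrow> 'a \<Rightarrow> 'b"
  where "zero_ext \<Omega> f z = indicator \<Omega> z *\<^sub>R f z"

lemma L2_on_iff: "L2_on \<Omega> f \<longleftrightarrow> square_integrable lborel (zero_ext \<Omega> f)"
proof -
  have "(\<lambda>z. indicator \<Omega> z *\<^sub>R (norm (f z))\<^sup>2) = (\<lambda>z. (norm (zero_ext \<Omega> f z))\<^sup>2)"
    by (auto simp: zero_ext_def indicator_def fun_eq_iff)
  moreover have "(\<lambda>z. indicator \<Omega> z *\<^sub>R f z) = zero_ext \<Omega> f" by (auto simp: zero_ext_def)
  ultimately show ?thesis
    by (simp add: L2_on_def square_integrable_def set_borel_measurable_def set_integrable_def)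
qed

lemma L2_on_UNIV_iff: "L2_on UNIV f \<longleftrightarrow> square_integrable lborel f"
proof -
  have "zero_ext UNIV f = f" by (auto simp: zero_ext_def)
  then show ?thesis by (simp add: L2_on_iff)
qed

lemma L2_norm_eq: "L2_norm f = sqrt (sq_norm lborel f)"
  by (simp add: L2_norm_def sq_norm_def)

lemma square_integrable_zero_ext:
  assumes f: "square_integrable lborel f" and [measurable]: "\<Omega> \<in> sets borel"
  shows "square_integrable lborel (zero_ext \<Omega> f)"
proof (rule sq_norm_mono(1)[OF f])
  show "zero_ext \<Omega> f \<in> borel_measurable lborel"
    unfolding zero_ext_def[abs_def] using square_integrableD(1)[OF f] by measurable
qed (auto simp: zero_ext_def indicator_def)

lemma zero_ext_zero_ext: "\<Omega>' \<subseteq> \<Omega> \<Longrightarrow> zero_ext \<Omega>' (zero_ext \<Omega> f) = zero_ext \<Omega>' f"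
  by (auto simp: zero_ext_def indicator_def fun_eq_iff)

lemma zero_ext_linear: "linear L \<Longrightarrow> zero_ext \<Omega> (\<lambda>z. L (f z)) = (\<lambda>z. L (zero_ext \<Omega> f z))"
  by (auto simp: zero_ext_def linear_scale fun_eq_iff)

lemma zero_ext_vec_nth: "zero_ext \<Omega> (\<lambda>z. f z $ i) = (\<lambda>z. zero_ext \<Omega> f z $ i)"
  by (rule zero_ext_linear[OF linear_vec_nth])

lemma has_weak_deriv_imp_L2:
  fixes f g :: "'a::euclidean_space \<Rightarrow> real"
  assumes "has_weak_deriv \<Omega> d f g" and "square_integrable lborel (zero_ext \<Omega> f)" "square_integrable lborel (zero_ext \<Omega> g)"
  shows "weak_deriv_L2 \<Omega> d (zero_ext \<Omega> f) (zero_ext \<Omega> g)"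
  using assms unfolding weak_deriv_L2_def has_weak_deriv_def set_lebesgue_integral_def
  by (auto simp: zero_ext_def mult.assoc)

text \<open>
On a set of infinite measure \<open>f\<close> itself need not be square integrable when $f - 1$ is; the constant is invisible to the weak derivative because derivatives of test functions have integral zero.
\<close>

lemma has_weak_deriv_minus_1_imp_L2:
  fixes f g :: "'a::euclidean_space \<Rightarrow> real"
  assumes wd: "has_weak_deriv \<Omega> d f g" and f: "square_integrable lborel (zero_ext \<Omega> (\<lambda>z. f z - 1))"
    and g: "square_integrable lborel (zero_ext \<Omega> g)"
  shows "weak_deriv_L2 \<Omega> d (zero_ext \<Omega> (\<lambda>z. f z - 1)) (zero_ext \<Omega> g)"
  unfolding weak_deriv_L2_def
proof (intro conjI allI impI f g)
  show "zero_ext \<Omega> (\<lambda>z. f z - 1) z = 0" "zero_ext \<Omega> g z = 0" if "z \<notin> \<Omega>" for z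
    using that by (simp_all add: zero_ext_def)
  fix \<phi> :: "'a \<Rightarrow> real" assume \<phi>: "test_function \<Omega> \<phi>"
  note d\<phi> = test_function_dir_deriv[OF \<phi>, of d]
  have "(LBINT z. zero_ext \<Omega> (\<lambda>z. f z - 1) z * dir_deriv d \<phi> z)
    = (LBINT z. zero_ext \<Omega> (\<lambda>z. f z - 1) z * dir_deriv d \<phi> z) + (LBINT z. dir_deriv d \<phi> z)"
    by (simp add: integral_dir_deriv_test_function[OF \<phi>])
  also have "\<dots> = (LBINT z. zero_ext \<Omega> (\<lambda>z. f z - 1) z * dir_deriv d \<phi> z + dir_deriv d \<phi> z)"
    by (intro Bochner_Integration.integral_add[symmetric]
        square_integrable_real_mult(1)[OF f square_integrable_test_function[OF d\<phi>]] integrable_test_function[OF d\<phi>])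
  also have "\<dots> = (LINT z:\<Omega>|lborel. f z * dir_deriv d \<phi> z)"
    unfolding set_lebesgue_integral_def using test_function_outside[OF d\<phi>]
    by (intro Bochner_Integration.integral_cong refl) (auto simp: zero_ext_def indicator_def algebra_simps)
  also have "\<dots> = - (LBINT z. zero_ext \<Omega> g z * \<phi> z)"
    using wd \<phi> unfolding has_weak_deriv_def set_lebesgue_integral_def by (simp add: zero_ext_def mult.assoc)
  finally show "(LBINT z. zero_ext \<Omega> (\<lambda>z. f z - 1) z * dir_deriv d \<phi> z) = - (LBINT z. zero_ext \<Omega> g z * \<phi> z)" .
qed

lemma L1_loc_if_square_integrable:
  fixes f :: "'a::euclidean_space \<Rightarrow> real"
  assumes f: "square_integrable lborel (zero_ext \<Omega> f)"
  shows "L1_loc \<Omega> f"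
  unfolding L1_loc_def
proof (intro conjI allI impI)
  show "set_borel_measurable lborel \<Omega> f"
    using f by (auto simp: set_borel_measurable_def square_integrable_def zero_ext_def[abs_def])
  fix K assume "compact K" "K \<subseteq> \<Omega>"
  have "(\<lambda>z. indicator K z *\<^sub>R f z) = (\<lambda>z. indicator K z *\<^sub>R zero_ext \<Omega> f z)"
    using \<open>K \<subseteq> \<Omega>\<close> by (auto simp: zero_ext_def indicator_def fun_eq_iff)
  then show "set_integrable lborel K f"
    using square_integrable_locally[OF f \<open>compact K\<close>] by (simp add: set_integrable_def)
qed

lemma weak_deriv_L2_imp_has_weak_deriv:
  fixes f g :: "'a::euclidean_space \<Rightarrow> real"
  assumes "weak_deriv_L2 \<Omega> d (zero_ext \<Omega> f) (zero_ext \<Omega> g)"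
  shows "has_weak_deriv \<Omega> d f g"
  using assms L1_loc_if_square_integrable[of \<Omega> f] L1_loc_if_square_integrable[of \<Omega> g]
  unfolding weak_deriv_L2_def has_weak_deriv_def set_lebesgue_integral_def
  by (auto simp: zero_ext_def mult.assoc)

lemma weak_deriv_L2_restrict:
  assumes fg: "weak_deriv_L2 \<Omega> d f g" and "\<Omega>' \<subseteq> \<Omega>" "\<Omega>' \<in> sets borel"
  shows "weak_deriv_L2 \<Omega>' d (zero_ext \<Omega>' f) (zero_ext \<Omega>' g)"
  unfolding weak_deriv_L2_def
proof (intro conjI allI impI)
  note D = weak_deriv_L2D[OF fg]
  show "square_integrable lborel (zero_ext \<Omega>' f)" "square_integrable lborel (zero_ext \<Omega>' g)"
    by (intro square_integrable_zero_ext D assms(3))+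
  show "zero_ext \<Omega>' f z = 0" "zero_ext \<Omega>' g z = 0" if "z \<notin> \<Omega>'" for z
    using that by (simp_all add: zero_ext_def)
  fix \<phi> :: "'a \<Rightarrow> real" assume \<phi>: "test_function \<Omega>' \<phi>"
  have "(\<lambda>z. zero_ext \<Omega>' f z * dir_deriv d \<phi> z) = (\<lambda>z. f z * dir_deriv d \<phi> z)"
    using test_function_outside[OF test_function_dir_deriv[OF \<phi>]] by (fastforce simp: zero_ext_def indicator_def)
  moreover have "(\<lambda>z. zero_ext \<Omega>' g z * \<phi> z) = (\<lambda>z. g z * \<phi> z)"
    using test_function_outside[OF \<phi>] by (fastforce simp: zero_ext_def indicator_def)
  ultimately show "(LBINT z. zero_ext \<Omega>' f z * dir_deriv d \<phi> z) = - (LBINT z. zero_ext \<Omega>' g z * \<phi> z)"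
    using D(5)[OF test_function_mono[OF \<phi> \<open>\<Omega>' \<subseteq> \<Omega>\<close>]] by simp
qed

section \<open>The space-time cylinder\<close>

lemma open_cylinder: "open (cylinder T)"
  unfolding cylinder_def by (intro open_Times) auto

lemma cylinder_borel [measurable]: "cylinder T \<in> sets borel"
  using open_cylinder by auto

lemma cylinder_iff [simp]: "(t, x) \<in> cylinder T \<longleftrightarrow> 0 < t \<and> t < T"
  by (auto simp: cylinder_def)

lemma cylinder_mono: "s \<le> t \<Longrightarrow> cylinder s \<subseteq> cylinder t"
  by (auto simp: cylinder_def)

lemma translation_invariant_cylinder: "translation_invariant (cylinder T) (0, v)"
  by (auto simp: translation_invariant_def cylinder_def)

lemma section_borel:
  fixes f :: "spacetime \<Rightarrow> 'b::topological_space"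
  assumes "f \<in> borel_measurable borel" shows "(\<lambda>x. f (t, x)) \<in> borel_measurable borel"
  using assms by (rule measurable_compose[rotated]) (intro borel_measurable_continuous_onI continuous_intros)

lemma AE_sections:
  fixes P :: "spacetime \<Rightarrow> bool"
  assumes "AE z in lborel. P z" shows "AE t in lborel. AE x in lborel. P (t, x)"
proof (rule lborel_pair.AE_pair)
  show "AE z in lborel \<Otimes>\<^sub>M lborel. P z" using assms by (simp only: lborel_prod)
qed

text \<open>
Tonelli: a bound on almost every time slice integrates to a bound on the cylinder.
\<close>

lemma slicewise_bound:
  fixes f :: "spacetime \<Rightarrow> 'b::euclidean_space"
  assumes meas: "set_borel_measurable lborel (cylinder T) f" and "a > 0" "b \<ge> 0" "T > 0"
    and slice: "AE t in lborel. t \<in> {0<..<T} \<longrightarrow> (\<integral>\<^sup>+x. ennreal (a * (norm (f (t, x)))\<^sup>2) \<partial>lborel) \<le> ennreal b"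
  shows "square_integrable lborel (zero_ext (cylinder T) f)"
    "sq_norm lborel (zero_ext (cylinder T) f) \<le> T * b / a"
proof -
  define F where "F = zero_ext (cylinder T) f"
  have [measurable]: "F \<in> borel_measurable borel"
    using meas by (simp add: set_borel_measurable_def F_def zero_ext_def[abs_def])
  then have Fm: "(\<lambda>z. ennreal (a * (norm (F z))\<^sup>2)) \<in> borel_measurable (lborel \<Otimes>\<^sub>M lborel)"
    unfolding lborel_prod by measurable
  have "(\<integral>\<^sup>+z. ennreal (a * (norm (F z))\<^sup>2) \<partial>lborel)
      = (\<integral>\<^sup>+t. \<integral>\<^sup>+x. ennreal (a * (norm (F (t, x)))\<^sup>2) \<partial>lborel \<partial>lborel)"
    unfolding lborel.nn_integral_fst[OF Fm] lborel_prod ..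
  also have "\<dots> \<le> (\<integral>\<^sup>+t. ennreal b * indicator {0<..<T} t \<partial>lborel)"
  proof (rule nn_integral_mono_AE)
    show "AE t in lborel. (\<integral>\<^sup>+x. ennreal (a * (norm (F (t, x)))\<^sup>2) \<partial>lborel) \<le> ennreal b * indicator {0<..<T} t"
      using slice
    proof eventually_elim
      case (elim t)
      then show ?case by (cases "t \<in> {0<..<T}") (auto simp: F_def zero_ext_def cylinder_def)
    qed
  qed
  also have "\<dots> = ennreal (T * b)"
    using assms by (simp add: nn_integral_cmult_indicator ennreal_mult' mult.commute)
  finally have le: "(\<integral>\<^sup>+z. ennreal (a * (norm (F z))\<^sup>2) \<partial>lborel) \<le> ennreal (T * b)" .
  have int: "integrable lborel (\<lambda>z. a * (norm (F z))\<^sup>2)"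
  proof (rule integrableI_nonneg)
    show "(\<integral>\<^sup>+z. ennreal (a * (norm (F z))\<^sup>2) \<partial>lborel) < \<infinity>"
      using le by (simp add: le_less_trans[OF _ ennreal_less_top])
  qed (use \<open>a > 0\<close> in auto)
  then show "square_integrable lborel (zero_ext (cylinder T) f)"
    using \<open>a > 0\<close> by (simp add: square_integrable_def flip: F_def)
  have "(LBINT z. a * (norm (F z))\<^sup>2) \<le> T * b"
    using le assms nn_integral_eq_integral[OF int] by simp
  then show "sq_norm lborel (zero_ext (cylinder T) f) \<le> T * b / a"
    using \<open>a > 0\<close> by (simp add: sq_norm_def field_simps flip: F_def)
qed

lemma AE_interval_ex:
  assumes "AE t in lborel. t \<in> {0..T} \<longrightarrow> P t" "0 \<le> a" "a < b" "b \<le> (T::real)"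
  shows "\<exists>t. a < t \<and> t < b \<and> P t"
proof (rule ccontr)
  assume "\<not> (\<exists>t. a < t \<and> t < b \<and> P t)"
  then have no: "\<not> P t" if "a < t" "t < b" for t using that by blast
  have "AE t in lborel. t \<notin> {a<..<b}"
    using assms(1) by eventually_elim (use no assms in auto)
  then have "emeasure lborel {a<..<b} = 0"
    by (subst (asm) AE_iff_null) (auto simp: null_sets_def greaterThanLessThan_def greaterThan_def lessThan_def Int_def)
  then show False using assms by simp
qed

lemma sq_integral_upto_eq:
  assumes F: "set_borel_measurable lborel (cylinder T) F" and "t \<le> T"
    and fin: "sq_integral_upto t F < \<infinity>"
  shows "square_integrable lborel (zero_ext (cylinder t) F)"
    "sq_integral_upto t F = ennreal (sq_norm lborel (zero_ext (cylinder t) F))"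
proof -
  have [measurable]: "(\<lambda>z. indicator (cylinder T) z *\<^sub>R F z) \<in> borel_measurable borel"
    using F by (simp add: set_borel_measurable_def)
  have "(\<lambda>z. indicator (cylinder t) z *\<^sub>R (indicator (cylinder T) z *\<^sub>R F z)) \<in> borel_measurable lborel"
    by measurable
  also have "(\<lambda>z. indicator (cylinder t) z *\<^sub>R (indicator (cylinder T) z *\<^sub>R F z)) = zero_ext (cylinder t) F"
    using \<open>t \<le> T\<close> by (auto simp: zero_ext_def fun_eq_iff indicator_def)
  finally have [measurable]: "zero_ext (cylinder t) F \<in> borel_measurable borel" by simp
  have eq: "sq_integral_upto t F = (\<integral>\<^sup>+z. ennreal ((norm (zero_ext (cylinder t) F z))\<^sup>2) \<partial>lborel)"
    unfolding sq_integral_upto_def by (intro nn_integral_cong) (auto simp: zero_ext_def indicator_def)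
  then have int: "integrable lborel (\<lambda>z. (norm (zero_ext (cylinder t) F z))\<^sup>2)"
    using fin by (intro integrableI_nonneg) auto
  then show "square_integrable lborel (zero_ext (cylinder t) F)" by (simp add: square_integrable_def)
  show "sq_integral_upto t F = ennreal (sq_norm lborel (zero_ext (cylinder t) F))"
    unfolding eq sq_norm_def by (rule nn_integral_eq_integral[OF int]) auto
qed

text \<open>
The bound is known for almost every upper limit \<open>t\<close> only, so the full cylinder is exhausted by cylinders up to admissible times that increase to \<open>T\<close>.
\<close>

lemma sq_integral_upto_bound:
  fixes F :: "spacetime \<Rightarrow> 'b::euclidean_space"
  assumes F: "set_borel_measurable lborel (cylinder T) F" and "a > 0" "K \<ge> 0" "T > 0"
    and le: "AE t in lborel. t \<in> {0..T} \<longrightarrow> ennreal a * sq_integral_upto t F \<le> ennreal K"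
  shows "square_integrable lborel (zero_ext (cylinder T) F)"
    "sq_norm lborel (zero_ext (cylinder T) F) \<le> K / a"
proof -
  have good: "square_integrable lborel (zero_ext (cylinder t) F) \<and> sq_norm lborel (zero_ext (cylinder t) F) \<le> K / a"
    if "t \<le> T" "ennreal a * sq_integral_upto t F \<le> ennreal K" for t
  proof -
    have "ennreal a * sq_integral_upto t F < \<infinity>"
      using that(2) by (simp add: le_less_trans[OF _ ennreal_less_top])
    then have fin: "sq_integral_upto t F < \<infinity>" using \<open>a > 0\<close> by (auto simp: ennreal_mult_less_top)
    have "a * sq_norm lborel (zero_ext (cylinder t) F) \<le> K"
      using that(2) assms unfolding sq_integral_upto_eq(2)[OF F that(1) fin]
      by (simp flip: ennreal_mult)
    then show ?thesis
      using sq_integral_upto_eq(1)[OF F that(1) fin] \<open>a > 0\<close> by (simp add: field_simps)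
  qed
  \<comment> \<open>Deterministic times increasing to \<open>T\<close>; an admissible time is chosen after each of them.\<close>
  define s where "s n = T * (1 - 1 / real (n + 2))" for n
  have "\<exists>t. s n < t \<and> t < T \<and> ennreal a * sq_integral_upto t F \<le> ennreal K" for n
  proof -
    have "0 \<le> s n" "s n < T" using \<open>T > 0\<close> by (auto simp: s_def field_simps)
    then show ?thesis by (intro AE_interval_ex[OF le _ _ order_refl])
  qed
  then obtain t where t: "\<And>n. s n < t n" "\<And>n. t n < T" "\<And>n. ennreal a * sq_integral_upto (t n) F \<le> ennreal K"
    by metis
  have slim: "s \<longlonglongrightarrow> T"
  proof -
    have "(\<lambda>n. T * (1 - 1 / real (n + 2))) \<longlonglongrightarrow> T * (1 - 0)"
      by (intro tendsto_intros LIMSEQ_ignore_initial_segment[OF lim_const_over_n])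
    then show ?thesis by (simp add: s_def[abs_def])
  qed
  have sq: "square_integrable lborel (zero_ext (cylinder (t n)) F)"
    and bd: "sq_norm lborel (zero_ext (cylinder (t n)) F) \<le> K / a" for n
    using good[OF less_imp_le[OF t(2)] t(3)] by auto
  have conv: "AE z in lborel. (\<lambda>n. zero_ext (cylinder (t n)) F z) \<longlonglongrightarrow> zero_ext (cylinder T) F z"
  proof (intro AE_I2)
    fix z :: spacetime
    obtain \<tau> x where z: "z = (\<tau>, x)" by (cases z)
    have "eventually (\<lambda>n. zero_ext (cylinder T) F z = zero_ext (cylinder (t n)) F z) sequentially"
    proof (cases "\<tau> < T")
      case True
      then have "eventually (\<lambda>n. \<tau> < s n) sequentially" using order_tendstoD(1)[OF slim] by auto
      then show ?thesis
      proof eventually_elim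
        case (elim n)
        then show ?case using t(1)[of n] t(2)[of n] by (auto simp: zero_ext_def z indicator_def)
      qed
    next
      case False
      then have "\<not> \<tau> < t n" for n using t(2)[of n] by simp
      then show ?thesis using False by (simp add: zero_ext_def z indicator_def)
    qed
    then show "(\<lambda>n. zero_ext (cylinder (t n)) F z) \<longlonglongrightarrow> zero_ext (cylinder T) F z"
      by (rule Lim_transform_eventually[OF tendsto_const])
  qed
  have "zero_ext (cylinder T) F \<in> borel_measurable lborel"
    using F by (simp add: set_borel_measurable_def zero_ext_def[abs_def])
  then show "square_integrable lborel (zero_ext (cylinder T) F)"
    "sq_norm lborel (zero_ext (cylinder T) F) \<le> K / a"
    using sq_norm_liminf[OF sq _ conv always_eventually] bd by blast+
qed

text \<open>
As the time interval is bounded, $L^2(0,T;L^2)$ is contained in $L^1(0,T;L^2)$; so weak-$*$ convergence may be tested with square integrable functions.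
\<close>

lemma L2_on_imp_L1_L2:
  assumes \<psi>: "L2_on (cylinder T) \<psi>"
  shows "L1_L2 T \<psi>"
proof -
  define \<Psi> where "\<Psi> = zero_ext (cylinder T) \<psi>"
  have sq: "square_integrable lborel \<Psi>" using \<psi> by (simp add: L2_on_iff \<Psi>_def)
  have [measurable]: "\<Psi> \<in> borel_measurable borel" using square_integrableD(1)[OF sq] by simp
  have int: "integrable (lborel \<Otimes>\<^sub>M lborel) (\<lambda>z. (norm (\<Psi> z))\<^sup>2)"
    using square_integrableD(2)[OF sq] by (simp add: lborel_prod)
  have sec: "(\<lambda>x. \<psi> (t, x)) = (\<lambda>x. \<Psi> (t, x))" if "t \<in> {0<..<T}" for t
    using that by (auto simp: \<Psi>_def zero_ext_def)
  show ?thesis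
    unfolding L1_L2_def
  proof (intro conjI)
    show "set_borel_measurable lborel (cylinder T) \<psi>" using \<psi> by (simp add: L2_on_def)
    show "AE t in lborel. t \<in> {0<..<T} \<longrightarrow> L2_on UNIV (\<lambda>x. \<psi> (t, x))"
      using lborel_pair.AE_integrable_fst'[OF int]
    proof eventually_elim
      case (elim t)
      then show ?case using sec[of t] section_borel[of \<Psi> t]
        by (auto simp: L2_on_UNIV_iff square_integrable_def)
    qed
    have "integrable lborel (\<lambda>t. indicator {0<..<T} t *\<^sub>R L2_norm (\<lambda>x. \<Psi> (t, x)))"
    proof (rule Bochner_Integration.integrable_bound)
      show "integrable lborel (\<lambda>t. indicator {0<..<T} t + (LBINT x. (norm (\<Psi> (t, x)))\<^sup>2))"
        by (intro Bochner_Integration.integrable_add lborel_pair.integrable_fst'[OF int] integrable_real_indicator emeasure_bounded_finite) auto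
      have m: "(\<lambda>t. LBINT x. (norm (\<Psi> (t, x)))\<^sup>2) \<in> borel_measurable lborel"
        using lborel_pair.integrable_fst'[OF int] by auto
      then show "(\<lambda>t. indicator {0<..<T} t *\<^sub>R L2_norm (\<lambda>x. \<Psi> (t, x))) \<in> borel_measurable lborel"
        unfolding L2_norm_def by measurable
      have "s \<ge> 0 \<Longrightarrow> sqrt s \<le> 1 + s" for s
        by (rule real_le_lsqrt) (auto simp: power2_eq_square algebra_simps)
      then show "AE t in lborel. norm (indicator {0<..<T} t *\<^sub>R L2_norm (\<lambda>x. \<Psi> (t, x)))
        \<le> norm (indicator {0<..<T} t + (LBINT x. (norm (\<Psi> (t, x)))\<^sup>2))"
        by (intro AE_I2) (auto simp: indicator_def L2_norm_def)
    qed
    moreover have "(\<lambda>t. indicator {0<..<T} t *\<^sub>R L2_norm (\<lambda>x. \<Psi> (t, x))) = (\<lambda>t. indicator {0<..<T} t *\<^sub>R L2_norm (\<lambda>x. \<psi> (t, x)))"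
      using sec by (auto simp: fun_eq_iff indicator_def)
    ultimately show "set_integrable lborel {0<..<T} (\<lambda>t. L2_norm (\<lambda>x. \<psi> (t, x)))"
      by (simp add: set_integrable_def)
  qed
qed

lemma Linf_L2_imp_square_integrable:
  assumes u: "Linf_L2 T u" and "T > 0"
  shows "square_integrable lborel (zero_ext (cylinder T) u)"
proof -
  obtain M where M: "AE t in lborel. t \<in> {0<..<T} \<longrightarrow> L2_on UNIV (\<lambda>x. u (t, x)) \<and> L2_norm (\<lambda>x. u (t, x)) \<le> M"
    using u by (auto simp: Linf_L2_def)
  show ?thesis
  proof (rule slicewise_bound(1)[where a=1 and b="M\<^sup>2"])
    show "set_borel_measurable lborel (cylinder T) u" using u by (simp add: Linf_L2_def)
    show "AE t in lborel. t \<in> {0<..<T} \<longrightarrow> (\<integral>\<^sup>+x. ennreal (1 * (norm (u (t, x)))\<^sup>2) \<partial>lborel) \<le> ennreal (M\<^sup>2)"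
      using M
    proof (rule eventually_mono, intro impI)
      fix t assume "t \<in> {0<..<T} \<longrightarrow> L2_on UNIV (\<lambda>x. u (t, x)) \<and> L2_norm (\<lambda>x. u (t, x)) \<le> M" "t \<in> {0<..<T}"
      then have sq: "square_integrable lborel (\<lambda>x. u (t, x))" and le: "sqrt (sq_norm lborel (\<lambda>x. u (t, x))) \<le> M"
        by (auto simp: L2_on_UNIV_iff L2_norm_eq)
      have "(\<integral>\<^sup>+x. ennreal (1 * (norm (u (t, x)))\<^sup>2) \<partial>lborel) = ennreal (sq_norm lborel (\<lambda>x. u (t, x)))"
        unfolding sq_norm_def using nn_integral_eq_integral[OF square_integrableD(2)[OF sq]] by simp
      also have "\<dots> \<le> ennreal (M\<^sup>2)"
        using power_mono[OF le, of 2] by (intro ennreal_leI) simp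
      finally show "(\<integral>\<^sup>+x. ennreal (1 * (norm (u (t, x)))\<^sup>2) \<partial>lborel) \<le> ennreal (M\<^sup>2)" .
    qed
  qed (use assms in auto)
qed

lemma weak_star_component:
  assumes lim: "weak_star_tends_Linf_L2 T f l F" and \<eta>: "square_integrable lborel \<eta>"
  shows "((\<lambda>n. LBINT z. zero_ext (cylinder T) (f n) z $ i * \<eta> z)
    \<longlongrightarrow> (LBINT z. zero_ext (cylinder T) l z $ i * \<eta> z)) F"
proof -
  define \<psi> :: "spacetime \<Rightarrow> R3" where "\<psi> z = axis i (\<eta> z)" for z
  have lin: "linear (axis i :: real \<Rightarrow> R3)" by (rule linearI) (auto simp: axis_def vec_eq_iff)
  have n: "norm (axis i x :: R3) = \<bar>x\<bar>" for x :: real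
    by (simp add: norm_eq_sqrt_inner inner_axis_axis)
  have "zero_ext (cylinder T) \<psi> \<in> borel_measurable lborel"
    unfolding \<psi>_def zero_ext_linear[OF lin] using square_integrableD(1)[OF \<eta>]
    by (intro borel_measurable_linear_compose[OF lin]) (simp add: zero_ext_def[abs_def])
  then have "square_integrable lborel (zero_ext (cylinder T) \<psi>)"
    by (rule sq_norm_mono(1)[OF \<eta>]) (simp add: \<psi>_def zero_ext_def n indicator_def)
  then have "L1_L2 T \<psi>" by (intro L2_on_imp_L1_L2) (simp add: L2_on_iff)
  then have *: "((\<lambda>n. LINT z:cylinder T|lborel. f n z \<bullet> \<psi> z) \<longlongrightarrow> (LINT z:cylinder T|lborel. l z \<bullet> \<psi> z)) F"
    using lim by (simp add: weak_star_tends_Linf_L2_def)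
  have eq: "(LINT z:cylinder T|lborel. g z \<bullet> \<psi> z) = (LBINT z. zero_ext (cylinder T) g z $ i * \<eta> z)" for g
    unfolding set_lebesgue_integral_def
    by (intro Bochner_Integration.integral_cong refl) (simp add: zero_ext_def \<psi>_def inner_axis)
  show ?thesis using * unfolding eq .
qed

section \<open>Symmetric parts and divergence-free fields\<close>

lemma linear_sym_part: "linear sym_part"
  by (rule linearI) (simp_all add: sym_part_def transpose_def vec_eq_iff algebra_simps)

lemma linear_antisym_part: "linear antisym_part"
  by (rule linearI) (simp_all add: antisym_part_def transpose_def vec_eq_iff algebra_simps)

lemma norm_matrix_sq: "(norm A)\<^sup>2 = (\<Sum>i\<in>UNIV. \<Sum>j\<in>UNIV. (A $ i $ j)\<^sup>2)" for A :: "real ^ 3 ^ 3"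
  unfolding power2_norm_eq_inner by (simp add: inner_vec_def power2_eq_square)

text \<open>
The identity $2|S|^2 = |A|^2 + A : A^T$ for the symmetric part $S$ of $A$.
\<close>

lemma norm_sym_part_sq:
  fixes A :: "real ^ 3 ^ 3"
  shows "2 * (norm (sym_part A))\<^sup>2 = (norm A)\<^sup>2 + (\<Sum>i\<in>UNIV. \<Sum>j\<in>UNIV. A $ i $ j * A $ j $ i)"
  unfolding norm_matrix_sq sum_3
  by (simp add: sym_part_def transpose_def power2_eq_square field_simps)

lemma norm_sym_part_le: "norm (sym_part A) \<le> norm A"
proof -
  have "(\<Sum>i\<in>UNIV. \<Sum>j\<in>UNIV. A $ i $ j * A $ j $ i) \<le> (norm A)\<^sup>2"
  proof -
    have "2 * (A $ i $ j * A $ j $ i) \<le> (A $ i $ j)\<^sup>2 + (A $ j $ i)\<^sup>2" for i j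
      using sum_squares_bound[of "A $ i $ j" "A $ j $ i"] by (simp add: mult.assoc)
    then have "(\<Sum>i\<in>UNIV. \<Sum>j\<in>UNIV. 2 * (A $ i $ j * A $ j $ i))
      \<le> (\<Sum>i\<in>UNIV. \<Sum>j\<in>UNIV. (A $ i $ j)\<^sup>2 + (A $ j $ i)\<^sup>2)"
      by (intro sum_mono)
    also have "\<dots> = 2 * (norm A)\<^sup>2"
      unfolding norm_matrix_sq sum.distrib
      using sum.swap[of "\<lambda>i j. (A $ j $ i)\<^sup>2" UNIV UNIV] by simp
    finally show ?thesis by (simp flip: sum_distrib_left)
  qed
  then have "(norm (sym_part A))\<^sup>2 \<le> (norm A)\<^sup>2" using norm_sym_part_sq[of A] by linarith
  then show ?thesis by (rule power2_le_imp_le) simp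
qed

lemma sym_antisym_decomp: "sym_part A + antisym_part A = A"
  by (simp add: sym_part_def antisym_part_def vec_eq_iff algebra_simps flip: scaleR_add_right)

text \<open>
Korn's identity: for a divergence-free field the mixed term $\int \nabla u : (\nabla u)^T$ vanishes. It is applied on shorter cylinders, since the energy inequality concerns times before \<open>T\<close>.
\<close>

theorem divergence_free_sq_norm_gradient:
  fixes u :: "spacetime \<Rightarrow> R3" and Du :: "spacetime \<Rightarrow> real ^ 3 ^ 3"
  assumes wd: "\<And>i j. weak_deriv_L2 (cylinder T) (0, axis j 1)
      (zero_ext (cylinder T) (\<lambda>z. u z $ i)) (zero_ext (cylinder T) (\<lambda>z. Du z $ i $ j))"
    and Du: "square_integrable lborel Du"
    and div: "\<And>\<phi>. test_function (cylinder T) \<phi> \<Longrightarrow>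
      (\<Sum>j\<in>UNIV. LBINT z. zero_ext (cylinder T) (\<lambda>z. u z $ j) z * dx j \<phi> z) = 0"
    and "t \<le> T"
  shows "2 * sq_norm lborel (zero_ext (cylinder t) (\<lambda>z. sym_part (Du z))) = sq_norm lborel (zero_ext (cylinder t) Du)"
proof -
  define G where "G i j = zero_ext (cylinder T) (\<lambda>z. Du z $ i $ j)" for i j
  have Gs: "square_integrable lborel (G i j)" for i j using weak_deriv_L2D(2)[OF wd] by (simp add: G_def)
  have tr_sq: "square_integrable lborel (\<lambda>z. \<Sum>j\<in>UNIV. G j j z)"
    unfolding sum_3 by (intro square_integrable_add Gs)
  have "AE z in lborel. z \<in> cylinder T \<longrightarrow> (\<Sum>j\<in>UNIV. G j j z) = 0"
  proof (rule fundamental_lemma_calculus_of_variations[OF open_cylinder square_integrable_locally[OF tr_sq]])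
    fix \<phi> :: "spacetime \<Rightarrow> real" assume \<phi>: "test_function (cylinder T) \<phi>"
    have "(LBINT z. (\<Sum>j\<in>UNIV. G j j z) * \<phi> z) = (\<Sum>j\<in>UNIV. LBINT z. G j j z * \<phi> z)"
      unfolding sum_distrib_right
      using square_integrable_real_mult(1)[OF Gs square_integrable_test_function[OF \<phi>]]
      by (subst Bochner_Integration.integral_sum) auto
    also have "\<dots> = - (\<Sum>j\<in>UNIV. LBINT z. zero_ext (cylinder T) (\<lambda>z. u z $ j) z * dx j \<phi> z)"
      using weak_deriv_L2D(5)[OF wd \<phi>] by (simp add: dx_def G_def sum_negf)
    finally show "(LBINT z. (\<Sum>j\<in>UNIV. G j j z) * \<phi> z) = 0" using div[OF \<phi>] by simp
  qed
  then have tr: "AE z in lborel. (\<Sum>j\<in>UNIV. zero_ext (cylinder t) (G j j) z) = 0"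
  proof eventually_elim
    case (elim z)
    then show ?case by (cases "z \<in> cylinder T") (auto simp: zero_ext_def G_def simp flip: sum_distrib_left)
  qed
  note sub = cylinder_mono[OF \<open>t \<le> T\<close>]
  have "(\<Sum>i\<in>UNIV. \<Sum>j\<in>UNIV. LBINT z. zero_ext (cylinder t) (G i j) z * zero_ext (cylinder t) (G j i) z) = 0"
    using weak_deriv_L2_restrict[OF wd sub cylinder_borel] tr
    by (intro integral_gradient_transpose_eq_0[OF open_cylinder translation_invariant_cylinder]) (auto simp: G_def)
  moreover have "zero_ext (cylinder t) (G i j) z = zero_ext (cylinder t) Du z $ i $ j" for i j z
    unfolding G_def zero_ext_zero_ext[OF sub] zero_ext_vec_nth ..
  ultimately have zero: "(\<Sum>i\<in>UNIV. \<Sum>j\<in>UNIV. LBINT z. zero_ext (cylinder t) Du z $ i $ j * zero_ext (cylinder t) Du z $ j $ i) = 0"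
    by simp
  have F: "square_integrable lborel (zero_ext (cylinder t) Du)"
    by (rule square_integrable_zero_ext[OF Du cylinder_borel])
  note Fc = square_integrable_component(1)[OF square_integrable_component(1)[OF F]]
  have "2 * sq_norm lborel (zero_ext (cylinder t) (\<lambda>z. sym_part (Du z)))
    = (LBINT z. 2 * (norm (sym_part (zero_ext (cylinder t) Du z)))\<^sup>2)"
    unfolding zero_ext_linear[OF linear_sym_part] sq_norm_def by simp
  also have "\<dots> = (LBINT z. (norm (zero_ext (cylinder t) Du z))\<^sup>2
      + (\<Sum>i\<in>UNIV. \<Sum>j\<in>UNIV. zero_ext (cylinder t) Du z $ i $ j * zero_ext (cylinder t) Du z $ j $ i))"
    unfolding norm_sym_part_sq ..
  also have "\<dots> = sq_norm lborel (zero_ext (cylinder t) Du)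
    + (\<Sum>i\<in>UNIV. \<Sum>j\<in>UNIV. LBINT z. zero_ext (cylinder t) Du z $ i $ j * zero_ext (cylinder t) Du z $ j $ i)"
    unfolding sq_norm_def using square_integrableD(2)[OF F] square_integrable_real_mult(1)[OF Fc Fc] by simp
  finally show ?thesis using zero by simp
qed

section \<open>Uniform estimates from energy and BD entropy\<close>

text \<open>
Bernoulli's inequality for real exponents, as Young's inequality for the product of \<open>x\<close> and \<open>1\<close>.
\<close>

lemma powr_ge_tangent_at_1:
  fixes x p :: real
  assumes "x \<ge> 0" "p > 1"
  shows "1 + p * (x - 1) \<le> x powr p"
proof -
  \<comment> \<open>The exponent conjugate to \<open>p\<close>.\<close>
  define q where "q = p / (p - 1)"
  have "q > 1" using assms by (simp add: q_def field_simps)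
  moreover have "1/p + 1/q = 1" using assms by (simp add: q_def field_simps)
  ultimately have "x * 1 \<le> x powr p / p + 1 powr q / q"
    using assms by (intro Youngs_inequality) auto
  also have "1 powr q / q = 1 - 1 / p" using assms by (simp add: q_def field_simps)
  finally have "p * x \<le> p * (x powr p / p + (1 - 1 / p))"
    using assms by (intro mult_left_mono) auto
  also have "\<dots> = x powr p + p - 1" using assms by (simp add: distrib_left right_diff_distrib)
  finally show ?thesis by (simp add: right_diff_distrib)
qed

text \<open>
The inequality $s^{2\gamma} - 1 - \gamma(s^2 - 1) \ge (\gamma - 1)(s - 1)^2$ holds because the difference of both sides is
\<open>s\<close> times the gap in Bernoulli's inequality with exponent $2\gamma - 1$.
\<close>

lemma pi_pot_ge:
  assumes "\<gamma> > 1" "\<epsilon> > 0" "s \<ge> 0"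
  shows "(s - 1)\<^sup>2 / (\<epsilon>\<^sup>2 * \<gamma>) \<le> pi_pot \<gamma> \<epsilon> (s\<^sup>2)"
proof -
  have pw: "(s\<^sup>2) powr \<gamma> = s * s powr (2 * \<gamma> - 1)"
  proof (cases "s = 0")
    case False
    then have "s > 0" using assms by simp
    have "(s\<^sup>2) powr \<gamma> = s powr (2 * \<gamma>)"
      using \<open>s > 0\<close> by (simp add: powr_powr flip: powr_numeral)
    also have "\<dots> = s powr (1 + (2 * \<gamma> - 1))" by simp
    also have "\<dots> = s * s powr (2 * \<gamma> - 1)" unfolding powr_add using \<open>s > 0\<close> by simp
    finally show ?thesis .
  qed auto
  have "0 \<le> s * (s powr (2 * \<gamma> - 1) - (1 + (2 * \<gamma> - 1) * (s - 1)))"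
    using assms powr_ge_tangent_at_1[of s "2 * \<gamma> - 1"] by (intro mult_nonneg_nonneg) auto
  also have "\<dots> = ((s\<^sup>2) powr \<gamma> - 1 - \<gamma> * (s\<^sup>2 - 1)) - (\<gamma> - 1) * (s - 1)\<^sup>2"
    unfolding pw by algebra
  finally have "(\<gamma> - 1) * (s - 1)\<^sup>2 \<le> (s\<^sup>2) powr \<gamma> - 1 - \<gamma> * (s\<^sup>2 - 1)" by simp
  then have "(\<gamma> - 1) * (s - 1)\<^sup>2 / (\<epsilon>\<^sup>2 * \<gamma> * (\<gamma> - 1)) \<le> pi_pot \<gamma> \<epsilon> (s\<^sup>2)"
    unfolding pi_pot_def using assms by (intro divide_right_mono) auto
  then show ?thesis using assms by simp
qed

lemma pi_pot_nonneg:
  assumes "\<gamma> > 1" "\<epsilon> > 0"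
  shows "0 \<le> pi_pot \<gamma> \<epsilon> (s\<^sup>2)"
proof -
  have "0 \<le> (\<bar>s\<bar> - 1)\<^sup>2 / (\<epsilon>\<^sup>2 * \<gamma>)" using assms by simp
  then show ?thesis using pi_pot_ge[OF assms, of "\<bar>s\<bar>"] by simp
qed

lemma energy_parts_le:
  assumes "\<gamma> > 1" "\<epsilon> > 0"
  shows "(\<integral>\<^sup>+x. ennreal (1/2 * (norm (w x))\<^sup>2) \<partial>lborel) \<le> energy \<gamma> \<kappa> \<epsilon> r w dr"
    "(\<integral>\<^sup>+x. ennreal (2 * \<kappa>\<^sup>2 * (norm (dr x))\<^sup>2) \<partial>lborel) \<le> energy \<gamma> \<kappa> \<epsilon> r w dr"
    "(AE x in lborel. r x \<ge> 0) \<Longrightarrow>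
      (\<integral>\<^sup>+x. ennreal (1 / (\<epsilon>\<^sup>2 * \<gamma>) * (norm (r x - 1))\<^sup>2) \<partial>lborel) \<le> energy \<gamma> \<kappa> \<epsilon> r w dr"
proof -
  note pi = pi_pot_nonneg[OF assms]
  show "(\<integral>\<^sup>+x. ennreal (1/2 * (norm (w x))\<^sup>2) \<partial>lborel) \<le> energy \<gamma> \<kappa> \<epsilon> r w dr"
    unfolding energy_def using pi by (intro nn_integral_mono ennreal_leI) simp
  show "(\<integral>\<^sup>+x. ennreal (2 * \<kappa>\<^sup>2 * (norm (dr x))\<^sup>2) \<partial>lborel) \<le> energy \<gamma> \<kappa> \<epsilon> r w dr"
    unfolding energy_def using pi by (intro nn_integral_mono ennreal_leI) simp
  assume "AE x in lborel. r x \<ge> 0"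
  then show "(\<integral>\<^sup>+x. ennreal (1 / (\<epsilon>\<^sup>2 * \<gamma>) * (norm (r x - 1))\<^sup>2) \<partial>lborel) \<le> energy \<gamma> \<kappa> \<epsilon> r w dr"
    unfolding energy_def
  proof (intro nn_integral_mono_AE, eventually_elim)
    case (elim x)
    have "1 / (\<epsilon>\<^sup>2 * \<gamma>) * (norm (r x - 1))\<^sup>2 \<le> pi_pot \<gamma> \<epsilon> ((r x)\<^sup>2)"
      using pi_pot_ge[OF assms elim(2)] by simp
    also have "\<dots> \<le> 1/2 * (norm (w x))\<^sup>2 + 2 * \<kappa>\<^sup>2 * (norm (dr x))\<^sup>2 + pi_pot \<gamma> \<epsilon> ((r x)\<^sup>2)" by simp
    finally show ?case by (rule ennreal_leI)
  qed
qed

lemma energy_eq: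
  assumes "\<gamma> > 1" "\<epsilon> > 0" and w: "square_integrable lborel w" and dr: "square_integrable lborel dr"
    and pi: "integrable lborel (\<lambda>x. pi_pot \<gamma> \<epsilon> ((r x)\<^sup>2))"
  shows "energy \<gamma> \<kappa> \<epsilon> r w dr = ennreal (1/2 * sq_norm lborel w + 2 * \<kappa>\<^sup>2 * sq_norm lborel dr
    + L1_norm (\<lambda>x. pi_pot \<gamma> \<epsilon> ((r x)\<^sup>2)))"
proof -
  note p = pi_pot_nonneg[OF assms(1,2)]
  have "energy \<gamma> \<kappa> \<epsilon> r w dr = ennreal (LBINT x. 1/2 * (norm (w x))\<^sup>2
    + 2 * \<kappa>\<^sup>2 * (norm (dr x))\<^sup>2 + pi_pot \<gamma> \<epsilon> ((r x)\<^sup>2))"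
    unfolding energy_def using square_integrableD(2)[OF w] square_integrableD(2)[OF dr] pi p
    by (intro nn_integral_eq_integral) auto
  also have "(LBINT x. 1/2 * (norm (w x))\<^sup>2 + 2 * \<kappa>\<^sup>2 * (norm (dr x))\<^sup>2 + pi_pot \<gamma> \<epsilon> ((r x)\<^sup>2))
    = 1/2 * sq_norm lborel w + 2 * \<kappa>\<^sup>2 * sq_norm lborel dr + L1_norm (\<lambda>x. pi_pot \<gamma> \<epsilon> ((r x)\<^sup>2))"
    using square_integrableD(2)[OF w] square_integrableD(2)[OF dr] pi p
    by (simp add: sq_norm_def L1_norm_def)
  finally show ?thesis .
qed

lemma BD_entropy_le:
  assumes "\<gamma> > 1" "\<epsilon> > 0" and w: "square_integrable lborel w" and dr: "square_integrable lborel dr"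
    and pi: "integrable lborel (\<lambda>x. pi_pot \<gamma> \<epsilon> ((r x)\<^sup>2))"
  shows "BD_entropy \<gamma> c \<epsilon> r w dr \<le> ennreal (sq_norm lborel w + (4 * c\<^sup>2 + 1) * sq_norm lborel dr
    + L1_norm (\<lambda>x. pi_pot \<gamma> \<epsilon> ((r x)\<^sup>2)))"
proof -
  note p = pi_pot_nonneg[OF assms(1,2)]
  have "BD_entropy \<gamma> c \<epsilon> r w dr \<le> (\<integral>\<^sup>+x. ennreal ((norm (w x))\<^sup>2
    + (4 * c\<^sup>2 + 1) * (norm (dr x))\<^sup>2 + pi_pot \<gamma> \<epsilon> ((r x)\<^sup>2)) \<partial>lborel)"
    unfolding BD_entropy_def
  proof (intro nn_integral_mono ennreal_leI)
    fix x
    show "1/2 * (norm (w x + (2 * c) *\<^sub>R dr x))\<^sup>2 + (norm (dr x))\<^sup>2 + pi_pot \<gamma> \<epsilon> ((r x)\<^sup>2)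
      \<le> (norm (w x))\<^sup>2 + (4 * c\<^sup>2 + 1) * (norm (dr x))\<^sup>2 + pi_pot \<gamma> \<epsilon> ((r x)\<^sup>2)"
      using norm_add_sq_le[of "w x" "(2 * c) *\<^sub>R dr x"] by (simp add: power_mult_distrib algebra_simps)
  qed
  also have "\<dots> = ennreal (LBINT x. (norm (w x))\<^sup>2
    + (4 * c\<^sup>2 + 1) * (norm (dr x))\<^sup>2 + pi_pot \<gamma> \<epsilon> ((r x)\<^sup>2))"
    using square_integrableD(2)[OF w] square_integrableD(2)[OF dr] pi p
    by (intro nn_integral_eq_integral) auto
  also have "(LBINT x. (norm (w x))\<^sup>2 + (4 * c\<^sup>2 + 1) * (norm (dr x))\<^sup>2 + pi_pot \<gamma> \<epsilon> ((r x)\<^sup>2))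
    = sq_norm lborel w + (4 * c\<^sup>2 + 1) * sq_norm lborel dr + L1_norm (\<lambda>x. pi_pot \<gamma> \<epsilon> ((r x)\<^sup>2))"
    using square_integrableD(2)[OF w] square_integrableD(2)[OF dr] pi p
    by (simp add: sq_norm_def L1_norm_def)
  finally show ?thesis .
qed

lemma set_borel_measurable_linear:
  fixes L :: "'b::euclidean_space \<Rightarrow> 'c::euclidean_space"
  assumes "linear L" "set_borel_measurable M \<Omega> f"
  shows "set_borel_measurable M \<Omega> (\<lambda>z. L (f z))"
  using borel_measurable_linear_compose[OF assms(1) assms(2)[unfolded set_borel_measurable_def]]
  by (simp add: set_borel_measurable_def linear_scale[OF assms(1)])

text \<open>
What the energy inequality yields on the cylinder: $\sqrt\rho - 1$ is of order $\varepsilon$, the momentum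
and the symmetric stress are bounded. The last statement keeps the inequality itself at almost
every time, without the capillary and pressure energies.
\<close>

lemma finite_energy_estimates:
  assumes "\<gamma> > 1" "\<nu> > 0" "\<kappa> > 0" "\<epsilon> > 0" "T > 0"
    and sol: "finite_energy_weak_solution_with \<gamma> \<nu> \<kappa> \<epsilon> T r0 w0 dr0 r w dr TT"
    and E: "energy \<gamma> \<kappa> \<epsilon> r0 w0 dr0 \<le> ennreal E" "E \<ge> 0"
  shows "square_integrable lborel (zero_ext (cylinder T) (\<lambda>z. r z - 1))"
    and "sq_norm lborel (zero_ext (cylinder T) (\<lambda>z. r z - 1)) \<le> T * E * \<gamma> * \<epsilon>\<^sup>2"
    and "square_integrable lborel (zero_ext (cylinder T) w)"
    and "sq_norm lborel (zero_ext (cylinder T) w) \<le> 2 * T * E"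
    and "square_integrable lborel (zero_ext (cylinder T) dr)"
    and "sq_norm lborel (zero_ext (cylinder T) (\<lambda>z. sym_part (TT z))) \<le> E / (2 * \<nu>)"
    and "AE t in lborel. t \<in> {0<..<T} \<longrightarrow> square_integrable lborel (\<lambda>x. w (t, x)) \<and>
      1/2 * sq_norm lborel (\<lambda>x. w (t, x)) + 2 * \<nu> * sq_norm lborel (zero_ext (cylinder t) (\<lambda>z. sym_part (TT z))) \<le> E"
proof -
  note eu = energy_parts_le[OF \<open>\<gamma> > 1\<close> \<open>\<epsilon> > 0\<close>]
  have rpos: "AE z in lborel. z \<in> cylinder T \<longrightarrow> r z \<ge> 0"
    and meas_r: "set_borel_measurable lborel (cylinder T) r"
    and meas_w: "set_borel_measurable lborel (cylinder T) w"
    and meas_dr: "set_borel_measurable lborel (cylinder T) dr"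
    and TT: "L2_on (cylinder T) TT"
    and ineq: "AE t in lborel. t \<in> {0..T} \<longrightarrow>
      energy \<gamma> \<kappa> \<epsilon> (\<lambda>x. r (t, x)) (\<lambda>x. w (t, x)) (\<lambda>x. dr (t, x))
        + ennreal (2 * \<nu>) * sq_integral_upto t (\<lambda>z. sym_part (TT z)) \<le> energy \<gamma> \<kappa> \<epsilon> r0 w0 dr0"
    using sol by (auto simp: finite_energy_weak_solution_with_def L2_loc_def)
  have ineqE: "AE t in lborel. t \<in> {0..T} \<longrightarrow>
      energy \<gamma> \<kappa> \<epsilon> (\<lambda>x. r (t, x)) (\<lambda>x. w (t, x)) (\<lambda>x. dr (t, x))
        + ennreal (2 * \<nu>) * sq_integral_upto t (\<lambda>z. sym_part (TT z)) \<le> ennreal E"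
    using ineq by eventually_elim (use E(1) in \<open>auto intro: order_trans\<close>)
  then have en: "AE t in lborel. t \<in> {0<..<T} \<longrightarrow>
      energy \<gamma> \<kappa> \<epsilon> (\<lambda>x. r (t, x)) (\<lambda>x. w (t, x)) (\<lambda>x. dr (t, x)) \<le> ennreal E"
  proof eventually_elim
    case (elim t)
    show ?case
    proof
      assume "t \<in> {0<..<T}"
      then show "energy \<gamma> \<kappa> \<epsilon> (\<lambda>x. r (t, x)) (\<lambda>x. w (t, x)) (\<lambda>x. dr (t, x)) \<le> ennreal E"
        using elim order_trans[OF add_increasing2[OF zero_le order_refl]] by auto
    qed
  qed
  have sl_w: "AE t in lborel. t \<in> {0<..<T} \<longrightarrow> (\<integral>\<^sup>+x. ennreal (1/2 * (norm (w (t, x)))\<^sup>2) \<partial>lborel) \<le> ennreal E"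
    using en by eventually_elim (rule impI, drule (1) mp, rule order_trans[OF eu(1)])
  have sl_dr: "AE t in lborel. t \<in> {0<..<T} \<longrightarrow> (\<integral>\<^sup>+x. ennreal (2 * \<kappa>\<^sup>2 * (norm (dr (t, x)))\<^sup>2) \<partial>lborel) \<le> ennreal E"
    using en by eventually_elim (rule impI, drule (1) mp, rule order_trans[OF eu(2)])
  have sl_r: "AE t in lborel. t \<in> {0<..<T} \<longrightarrow>
      (\<integral>\<^sup>+x. ennreal (1 / (\<epsilon>\<^sup>2 * \<gamma>) * (norm (r (t, x) - 1))\<^sup>2) \<partial>lborel) \<le> ennreal E"
    using en AE_sections[OF rpos]
  proof eventually_elim
    case (elim t)
    show ?case
    proof
      assume t: "t \<in> {0<..<T}"
      have "AE x in lborel. r (t, x) \<ge> 0" using elim(2) t by simp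
      from eu(3)[OF this] elim(1) t
      show "(\<integral>\<^sup>+x. ennreal (1 / (\<epsilon>\<^sup>2 * \<gamma>) * (norm (r (t, x) - 1))\<^sup>2) \<partial>lborel) \<le> ennreal E"
        by (meson order_trans)
    qed
  qed
  have meas_r1: "set_borel_measurable lborel (cylinder T) (\<lambda>z. r z - 1)"
    using meas_r unfolding set_borel_measurable_def scaleR_diff_right
    by (intro borel_measurable_diff) auto
  have pos: "1 / (\<epsilon>\<^sup>2 * \<gamma>) > 0" using assms by simp
  have "T * E / (1 / (\<epsilon>\<^sup>2 * \<gamma>)) = T * E * \<gamma> * \<epsilon>\<^sup>2" by simp
  then show "square_integrable lborel (zero_ext (cylinder T) (\<lambda>z. r z - 1))"
    "sq_norm lborel (zero_ext (cylinder T) (\<lambda>z. r z - 1)) \<le> T * E * \<gamma> * \<epsilon>\<^sup>2"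
    using slicewise_bound[OF meas_r1 pos E(2) \<open>T > 0\<close> sl_r] by (simp_all add: mult.assoc mult.commute[of \<gamma>])
  show "square_integrable lborel (zero_ext (cylinder T) w)" "sq_norm lborel (zero_ext (cylinder T) w) \<le> 2 * T * E"
    using slicewise_bound[OF meas_w _ E(2) \<open>T > 0\<close> sl_w] by (simp_all add: mult_ac)
  show "square_integrable lborel (zero_ext (cylinder T) dr)"
    using slicewise_bound(1)[OF meas_dr _ E(2) \<open>T > 0\<close> sl_dr] \<open>\<kappa> > 0\<close> by simp
  have meas_S: "set_borel_measurable lborel (cylinder T) (\<lambda>z. sym_part (TT z))"
    using TT by (intro set_borel_measurable_linear[OF linear_sym_part]) (simp add: L2_on_def)
  have S_le: "AE t in lborel. t \<in> {0..T} \<longrightarrow> ennreal (2 * \<nu>) * sq_integral_upto t (\<lambda>z. sym_part (TT z)) \<le> ennreal E"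
    using ineqE
  proof eventually_elim
    case (elim t)
    then show ?case using order_trans[OF add_increasing[OF zero_le order_refl]] by auto
  qed
  show "sq_norm lborel (zero_ext (cylinder T) (\<lambda>z. sym_part (TT z))) \<le> E / (2 * \<nu>)"
    using sq_integral_upto_bound(2)[OF meas_S _ E(2) \<open>T > 0\<close> S_le] \<open>\<nu> > 0\<close> by simp
  show "AE t in lborel. t \<in> {0<..<T} \<longrightarrow> square_integrable lborel (\<lambda>x. w (t, x)) \<and>
      1/2 * sq_norm lborel (\<lambda>x. w (t, x)) + 2 * \<nu> * sq_norm lborel (zero_ext (cylinder t) (\<lambda>z. sym_part (TT z))) \<le> E"
    using ineqE
  proof eventually_elim
    case (elim t)
    show ?case
    proof
      assume t: "t \<in> {0<..<T}"
      have le: "(\<integral>\<^sup>+x. ennreal (1/2 * (norm (w (t, x)))\<^sup>2) \<partial>lborel)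
          + ennreal (2 * \<nu>) * sq_integral_upto t (\<lambda>z. sym_part (TT z)) \<le> ennreal E"
      proof (rule order_trans[OF add_right_mono[OF eu(1)]])
        show "energy \<gamma> \<kappa> \<epsilon> (\<lambda>x. r (t, x)) (\<lambda>x. w (t, x)) (\<lambda>x. dr (t, x))
          + ennreal (2 * \<nu>) * sq_integral_upto t (\<lambda>z. sym_part (TT z)) \<le> ennreal E"
          using elim t by simp
      qed
      have "(\<lambda>x. zero_ext (cylinder T) w (t, x)) \<in> borel_measurable borel"
        using meas_w by (intro section_borel) (simp add: set_borel_measurable_def zero_ext_def[abs_def])
      also have "(\<lambda>x. zero_ext (cylinder T) w (t, x)) = (\<lambda>x. w (t, x))" using t by (auto simp: zero_ext_def)
      finally have [measurable]: "(\<lambda>x. w (t, x)) \<in> borel_measurable borel" .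
      have lt: "(\<integral>\<^sup>+x. ennreal (1/2 * (norm (w (t, x)))\<^sup>2) \<partial>lborel) < \<infinity>"
        "ennreal (2 * \<nu>) * sq_integral_upto t (\<lambda>z. sym_part (TT z)) < \<infinity>"
        using le_less_trans[OF le ennreal_less_top] by (simp_all add: infinity_ennreal_def)
      have int: "integrable lborel (\<lambda>x. 1/2 * (norm (w (t, x)))\<^sup>2)"
        using lt(1) by (intro integrableI_nonneg) auto
      then have "integrable lborel (\<lambda>x. 2 * (1/2 * (norm (w (t, x)))\<^sup>2))" by (rule integrable_mult_right)
      then have sq: "square_integrable lborel (\<lambda>x. w (t, x))" by (simp add: square_integrable_def)
      have fin: "sq_integral_upto t (\<lambda>z. sym_part (TT z)) < \<infinity>"
        using lt(2) \<open>\<nu> > 0\<close> by (auto simp: ennreal_mult_less_top)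
      have "(\<integral>\<^sup>+x. ennreal (1/2 * (norm (w (t, x)))\<^sup>2) \<partial>lborel) = ennreal (1/2 * sq_norm lborel (\<lambda>x. w (t, x)))"
        using nn_integral_eq_integral[OF int] by (simp add: sq_norm_def)
      moreover have "sq_integral_upto t (\<lambda>z. sym_part (TT z)) = ennreal (sq_norm lborel (zero_ext (cylinder t) (\<lambda>z. sym_part (TT z))))"
        using sq_integral_upto_eq(2)[OF meas_S _ fin] t by simp
      ultimately have "ennreal (1/2 * sq_norm lborel (\<lambda>x. w (t, x)) + 2 * \<nu> * sq_norm lborel (zero_ext (cylinder t) (\<lambda>z. sym_part (TT z)))) \<le> ennreal E"
        using le \<open>\<nu> > 0\<close> by (simp add: ennreal_plus ennreal_mult flip: ennreal_plus ennreal_mult)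
      then show "square_integrable lborel (\<lambda>x. w (t, x)) \<and>
        1/2 * sq_norm lborel (\<lambda>x. w (t, x)) + 2 * \<nu> * sq_norm lborel (zero_ext (cylinder t) (\<lambda>z. sym_part (TT z))) \<le> E"
        using sq E(2) by (simp add: ennreal_le_iff)
    qed
  qed
qed

text \<open>
The BD entropy controls the antisymmetric stress and the Hessian of $\sqrt\rho$, about which the energy says nothing.
\<close>

lemma BD_entropy_estimates:
  assumes "\<nu> > 0" "T > 0" "C > 0" "K \<ge> 0"
    and TT: "L2_on (cylinder T) TT" and H: "has_weak_jacobian_x T dr H"
    and K: "BD_entropy \<gamma> c \<epsilon> r0 w0 dr0 \<le> ennreal K"
    and ineq: "AE t in lborel. t \<in> {0..T} \<longrightarrow>
        BD_entropy \<gamma> c \<epsilon> (\<lambda>x. r (t, x)) (\<lambda>x. w (t, x)) (\<lambda>x. dr (t, x))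
          + ennreal \<nu> * sq_integral_upto t (\<lambda>z. antisym_part (TT z))
          + ennreal \<nu> * sq_integral_upto t H
          + ennreal (\<nu> / (4 * \<gamma> * \<epsilon>\<^sup>2)) * sq_integral_upto t N
        \<le> ennreal C * BD_entropy \<gamma> c \<epsilon> r0 w0 dr0"
  shows "sq_norm lborel (zero_ext (cylinder T) (\<lambda>z. antisym_part (TT z))) \<le> C * K / \<nu>"
    and "square_integrable lborel (zero_ext (cylinder T) (\<lambda>z. H z $ i $ j))"
    and "sq_norm lborel (zero_ext (cylinder T) (\<lambda>z. H z $ i $ j)) \<le> C * K / \<nu>"
proof -
  have CK: "0 \<le> C * K" using assms by simp
  have le: "AE t in lborel. t \<in> {0..T} \<longrightarrow>
    ennreal \<nu> * sq_integral_upto t (\<lambda>z. antisym_part (TT z)) \<le> ennreal (C * K) \<and>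
    ennreal \<nu> * sq_integral_upto t H \<le> ennreal (C * K)"
    using ineq
  proof (eventually_elim, intro impI)
    fix t assume A: "t \<in> {0..T} \<longrightarrow>
        BD_entropy \<gamma> c \<epsilon> (\<lambda>x. r (t, x)) (\<lambda>x. w (t, x)) (\<lambda>x. dr (t, x))
          + ennreal \<nu> * sq_integral_upto t (\<lambda>z. antisym_part (TT z))
          + ennreal \<nu> * sq_integral_upto t H
          + ennreal (\<nu> / (4 * \<gamma> * \<epsilon>\<^sup>2)) * sq_integral_upto t N
        \<le> ennreal C * BD_entropy \<gamma> c \<epsilon> r0 w0 dr0" and t: "t \<in> {0..T}"
    have "ennreal C * BD_entropy \<gamma> c \<epsilon> r0 w0 dr0 \<le> ennreal (C * K)"
      using mult_left_mono[OF K, of "ennreal C"] assms by (simp add: ennreal_mult)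
    with A t have s: "BD_entropy \<gamma> c \<epsilon> (\<lambda>x. r (t, x)) (\<lambda>x. w (t, x)) (\<lambda>x. dr (t, x))
          + ennreal \<nu> * sq_integral_upto t (\<lambda>z. antisym_part (TT z))
          + ennreal \<nu> * sq_integral_upto t H
          + ennreal (\<nu> / (4 * \<gamma> * \<epsilon>\<^sup>2)) * sq_integral_upto t N \<le> ennreal (C * K)"
      by (meson order_trans)
    show "ennreal \<nu> * sq_integral_upto t (\<lambda>z. antisym_part (TT z)) \<le> ennreal (C * K) \<and>
      ennreal \<nu> * sq_integral_upto t H \<le> ennreal (C * K)"
      by (intro conjI; rule order_trans[OF _ s]) (simp_all add: add_increasing add_increasing2)
  qed
  have meas_A: "set_borel_measurable lborel (cylinder T) (\<lambda>z. antisym_part (TT z))"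
    using TT by (intro set_borel_measurable_linear[OF linear_antisym_part]) (simp add: L2_on_def)
  have "AE t in lborel. t \<in> {0..T} \<longrightarrow> ennreal \<nu> * sq_integral_upto t (\<lambda>z. antisym_part (TT z)) \<le> ennreal (C * K)"
    using le by eventually_elim auto
  from sq_integral_upto_bound(2)[OF meas_A \<open>\<nu> > 0\<close> CK \<open>T > 0\<close> this]
  show "sq_norm lborel (zero_ext (cylinder T) (\<lambda>z. antisym_part (TT z))) \<le> C * K / \<nu>" .
  have meas_H: "set_borel_measurable lborel (cylinder T) (\<lambda>z. H z $ i $ j)"
    using H by (simp add: has_weak_jacobian_x_def has_weak_grad_x_def has_weak_deriv_def L1_loc_def)
  have comp: "sq_integral_upto t (\<lambda>z. H z $ i $ j) \<le> sq_integral_upto t H" for t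
    unfolding sq_integral_upto_def
  proof (intro nn_integral_mono mult_right_mono ennreal_leI power_mono)
    show "norm (H z $ i $ j) \<le> norm (H z)" for z
      using Finite_Cartesian_Product.norm_nth_le order_trans by metis
  qed auto
  have "AE t in lborel. t \<in> {0..T} \<longrightarrow> ennreal \<nu> * sq_integral_upto t (\<lambda>z. H z $ i $ j) \<le> ennreal (C * K)"
    using le
  proof eventually_elim
    case (elim t)
    then show ?case using mult_left_mono[OF comp[of t], of "ennreal \<nu>"] by (auto intro: order_trans)
  qed
  from sq_integral_upto_bound[OF meas_H \<open>\<nu> > 0\<close> CK \<open>T > 0\<close> this]
  show "square_integrable lborel (zero_ext (cylinder T) (\<lambda>z. H z $ i $ j))"
    "sq_norm lborel (zero_ext (cylinder T) (\<lambda>z. H z $ i $ j)) \<le> C * K / \<nu>" by auto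
qed

section \<open>The limit of the equations\<close>

text \<open>
Splitting $r = 1 + (r - 1)$ in the stress identity leaves the linear terms of the limit equation and
three products with a factor that vanishes strongly in $L^2$, namely $r - 1$ twice and \<open>dr\<close>.
\<close>

lemma stress_identity_limit:
  fixes \<phi> :: "spacetime \<Rightarrow> real"
  assumes r: "\<And>n. square_integrable lborel (zero_ext (cylinder T) (\<lambda>z. r n z - 1))"
    and r0: "(\<lambda>n. sq_norm lborel (zero_ext (cylinder T) (\<lambda>z. r n z - 1))) \<longlonglongrightarrow> 0"
    and w: "\<And>n. square_integrable lborel (zero_ext (cylinder T) (w n))"
    and wB: "\<And>n. sq_norm lborel (zero_ext (cylinder T) (w n)) \<le> Bw"
    and dr: "\<And>n. square_integrable lborel (zero_ext (cylinder T) (dr n))"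
    and dr0: "(\<lambda>n. sq_norm lborel (zero_ext (cylinder T) (\<lambda>z. dr n z $ j))) \<longlonglongrightarrow> 0"
    and TT: "\<And>n. square_integrable lborel (zero_ext (cylinder T) (TT n))"
    and TB: "\<And>n. sq_norm lborel (zero_ext (cylinder T) (TT n)) \<le> BT"
    and st: "\<And>n. stress_identity T (r n) (w n) (dr n) (TT n)"
    and lim: "weak_star_tends_Linf_L2 T w u sequentially"
    and \<phi>: "test_function (cylinder T) \<phi>"
  shows "(\<lambda>n. LBINT z. zero_ext (cylinder T) (TT n) z $ i $ j * \<phi> z)
    \<longlonglongrightarrow> - (LBINT z. zero_ext (cylinder T) u z $ i * dx j \<phi> z)"
proof -
  let ?\<Omega> = "cylinder T"
  define R where "R n = zero_ext ?\<Omega> (\<lambda>z. r n z - 1)" for n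
  define W where "W n z = zero_ext ?\<Omega> (w n) z $ i" for n z
  define D where "D n z = zero_ext ?\<Omega> (dr n) z $ j" for n z
  define X where "X n z = zero_ext ?\<Omega> (TT n) z $ i $ j" for n z
  note \<phi>' = dx_test_function[OF \<phi>, of j]
  note p = square_integrable_test_function[OF \<phi>] and p' = square_integrable_test_function[OF \<phi>']
  obtain B where B: "\<phi> \<in> borel_measurable lborel" "\<And>z. \<bar>\<phi> z\<bar> \<le> B" using test_function_bound_measurable[OF \<phi>] by blast
  obtain B' where B': "dx j \<phi> \<in> borel_measurable lborel" "\<And>z. \<bar>dx j \<phi> z\<bar> \<le> B'"
    using test_function_bound_measurable[OF \<phi>'] by blast
  have Rs: "square_integrable lborel (R n)" for n using r by (simp add: R_def)
  have Ws: "square_integrable lborel (W n)" "sq_norm lborel (W n) \<le> Bw" for n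
    using square_integrable_component[OF w[of n], of i] wB[of n] unfolding W_def by (auto intro: order_trans)
  have Ds: "square_integrable lborel (D n)" for n
    using square_integrable_component[OF dr[of n], of j] unfolding D_def by auto
  have Xs: "square_integrable lborel (X n)" "sq_norm lborel (X n) \<le> BT" for n
    using square_integrable_component[OF TT[of n], of i]
      square_integrable_component[OF square_integrable_component(1)[OF TT[of n], of i], of j] TB[of n]
    unfolding X_def by (auto intro: order_trans)
  have Rlim: "(\<lambda>n. sq_norm lborel (R n)) \<longlonglongrightarrow> 0" using r0 by (simp add: R_def)
  have Dlim: "(\<lambda>n. sq_norm lborel (D n)) \<longlonglongrightarrow> 0" using dr0 unfolding zero_ext_vec_nth by (simp add: D_def[abs_def])
  have id: "(LBINT z. X n z * \<phi> z) = - (LBINT z. R n z * W n z * dx j \<phi> z)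
      - (LBINT z. W n z * dx j \<phi> z) - 2 * (LBINT z. D n z * W n z * \<phi> z)
      - (LBINT z. R n z * X n z * \<phi> z)" for n
  proof -
    have "(LINT z:?\<Omega>|lborel. r n z * TT n z $ i $ j * \<phi> z)
      = (LBINT z. R n z * X n z * \<phi> z + X n z * \<phi> z)"
      unfolding set_lebesgue_integral_def R_def X_def
      by (intro Bochner_Integration.integral_cong refl) (simp add: zero_ext_def indicator_def algebra_simps)
    also have "\<dots> = (LBINT z. R n z * X n z * \<phi> z) + (LBINT z. X n z * \<phi> z)"
      by (intro Bochner_Integration.integral_add integral_triple_product(1)[OF Rs Xs(1) B] square_integrable_real_mult(1)[OF Xs(1) p])
    finally have 1: "(LINT z:?\<Omega>|lborel. r n z * TT n z $ i $ j * \<phi> z)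
      = (LBINT z. R n z * X n z * \<phi> z) + (LBINT z. X n z * \<phi> z)" .
    have "(LINT z:?\<Omega>|lborel. (r n z *\<^sub>R w n z) $ i * dx j \<phi> z)
      = (LBINT z. R n z * W n z * dx j \<phi> z + W n z * dx j \<phi> z)"
      unfolding set_lebesgue_integral_def R_def W_def
      by (intro Bochner_Integration.integral_cong refl) (simp add: zero_ext_def indicator_def algebra_simps)
    also have "\<dots> = (LBINT z. R n z * W n z * dx j \<phi> z) + (LBINT z. W n z * dx j \<phi> z)"
      by (intro Bochner_Integration.integral_add integral_triple_product(1)[OF Rs Ws(1) B'] square_integrable_real_mult(1)[OF Ws(1) p'])
    finally have 2: "(LINT z:?\<Omega>|lborel. (r n z *\<^sub>R w n z) $ i * dx j \<phi> z)
      = (LBINT z. R n z * W n z * dx j \<phi> z) + (LBINT z. W n z * dx j \<phi> z)" .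
    have "(LINT z:?\<Omega>|lborel. 2 * tensor (w n z) (dr n z) $ i $ j * \<phi> z) = (LBINT z. 2 * (D n z * W n z * \<phi> z))"
      unfolding set_lebesgue_integral_def D_def W_def
      by (intro Bochner_Integration.integral_cong refl) (simp add: zero_ext_def indicator_def tensor_def)
    then have 3: "(LINT z:?\<Omega>|lborel. 2 * tensor (w n z) (dr n z) $ i $ j * \<phi> z) = 2 * (LBINT z. D n z * W n z * \<phi> z)"
      by simp
    have "(LINT z:?\<Omega>|lborel. r n z * TT n z $ i $ j * \<phi> z)
      = - (LINT z:?\<Omega>|lborel. (r n z *\<^sub>R w n z) $ i * dx j \<phi> z)
        - (LINT z:?\<Omega>|lborel. 2 * tensor (w n z) (dr n z) $ i $ j * \<phi> z)"
      using st[of n] \<phi> by (simp add: stress_identity_def)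
    then show ?thesis unfolding 1 2 3 by linarith
  qed
  have "(\<lambda>n. - (LBINT z. R n z * W n z * dx j \<phi> z)
      - (LBINT z. W n z * dx j \<phi> z) - 2 * (LBINT z. D n z * W n z * \<phi> z)
      - (LBINT z. R n z * X n z * \<phi> z))
    \<longlonglongrightarrow> - 0 - (LBINT z. zero_ext ?\<Omega> u z $ i * dx j \<phi> z) - 2 * 0 - 0"
  proof (intro tendsto_intros)
    show "(\<lambda>n. LBINT z. R n z * W n z * dx j \<phi> z) \<longlonglongrightarrow> 0"
      by (rule integral_triple_product_tendsto_0[OF Rs Ws(1) B' Rlim Ws(2)])
    show "(\<lambda>n. LBINT z. D n z * W n z * \<phi> z) \<longlonglongrightarrow> 0"
      by (rule integral_triple_product_tendsto_0[OF Ds Ws(1) B Dlim Ws(2)])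
    show "(\<lambda>n. LBINT z. R n z * X n z * \<phi> z) \<longlonglongrightarrow> 0"
      by (rule integral_triple_product_tendsto_0[OF Rs Xs(1) B Rlim Xs(2)])
    show "(\<lambda>n. LBINT z. W n z * dx j \<phi> z) \<longlonglongrightarrow> (LBINT z. zero_ext ?\<Omega> u z $ i * dx j \<phi> z)"
      unfolding W_def by (rule weak_star_component[OF lim p'])
  qed
  then have "(\<lambda>n. LBINT z. X n z * \<phi> z) \<longlonglongrightarrow> - (LBINT z. zero_ext ?\<Omega> u z $ i * dx j \<phi> z)"
    unfolding id by simp
  then show ?thesis unfolding X_def .
qed

text \<open>
For test functions that vanish near $t = 0$ the initial term drops out. With $r = 1 + (r - 1)$ the
density contributes the integral of $\partial_t\phi$, which is zero, and vanishing remainders, so only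
$\mathrm{div}\, u = 0$ survives.
\<close>

lemma continuity_equation_limit:
  fixes \<phi> :: "spacetime \<Rightarrow> real"
  assumes r: "\<And>n. square_integrable lborel (zero_ext (cylinder T) (\<lambda>z. r n z - 1))"
    and r0: "(\<lambda>n. sq_norm lborel (zero_ext (cylinder T) (\<lambda>z. r n z - 1))) \<longlonglongrightarrow> 0"
    and w: "\<And>n. square_integrable lborel (zero_ext (cylinder T) (w n))"
    and wB: "\<And>n. sq_norm lborel (zero_ext (cylinder T) (w n)) \<le> Bw"
    and ce: "\<And>n. weak_continuity_eq T (r_init n) (r n) (w n)"
    and lim: "weak_star_tends_Linf_L2 T w u sequentially"
    and \<phi>: "test_function (cylinder T) \<phi>"
  shows "(\<Sum>j\<in>UNIV. LBINT z. zero_ext (cylinder T) u z $ j * dx j \<phi> z) = 0"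
proof -
  let ?\<Omega> = "cylinder T"
  define R where "R n = zero_ext ?\<Omega> (\<lambda>z. r n z - 1)" for n
  define W where "W n j z = zero_ext ?\<Omega> (w n) z $ j" for n j z
  note px = square_integrable_test_function[OF dx_test_function[OF \<phi>]]
    and pt = square_integrable_test_function[OF dt_test_function[OF \<phi>]]
    and it = integrable_test_function[OF dt_test_function[OF \<phi>]]
  obtain B where B: "dt \<phi> \<in> borel_measurable lborel" "\<And>z. \<bar>dt \<phi> z\<bar> \<le> B"
    using test_function_bound_measurable[OF dt_test_function[OF \<phi>]] by blast
  have Rs: "square_integrable lborel (R n)" for n using r by (simp add: R_def)
  have Ws: "square_integrable lborel (W n j)" "sq_norm lborel (W n j) \<le> Bw" for n j
    using square_integrable_component[OF w[of n], of j] wB[of n] unfolding W_def by (auto intro: order_trans)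
  have Rlim: "(\<lambda>n. sq_norm lborel (R n)) \<longlonglongrightarrow> 0" using r0 by (simp add: R_def)
  obtain K where K: "\<And>n. sq_norm lborel (R n) \<le> K"
    using convergent_imp_Bseq[of "\<lambda>n. sq_norm lborel (R n)"] Rlim
    by (auto simp: convergent_def Bseq_def)
  have Wint: "integrable lborel (\<lambda>z. R n z * W n j z * dx j \<phi> z)" for n j
  proof -
    obtain B' where B': "dx j \<phi> \<in> borel_measurable lborel" "\<And>z. \<bar>dx j \<phi> z\<bar> \<le> B'"
      using test_function_bound_measurable[OF dx_test_function[OF \<phi>]] by blast
    show ?thesis by (rule integral_triple_product(1)[OF Rs Ws(1) B'])
  qed
  have Wlim: "(\<lambda>n. LBINT z. R n z * W n j z * dx j \<phi> z) \<longlonglongrightarrow> 0" for j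
  proof -
    obtain B' where B': "dx j \<phi> \<in> borel_measurable lborel" "\<And>z. \<bar>dx j \<phi> z\<bar> \<le> B'"
      using test_function_bound_measurable[OF dx_test_function[OF \<phi>]] by blast
    show ?thesis by (rule integral_triple_product_tendsto_0[OF Rs Ws(1) B' Rlim Ws(2)])
  qed
  have id: "0 = (LBINT z. R n z * R n z * dt \<phi> z) + 2 * (LBINT z. R n z * dt \<phi> z)
    + (\<Sum>j\<in>UNIV. (LBINT z. R n z * W n j z * dx j \<phi> z) + (LBINT z. W n j z * dx j \<phi> z))" for n
  proof -
    have "test_function (half_open_cylinder T) \<phi>"
      by (rule test_function_mono[OF \<phi>]) (auto simp: cylinder_def half_open_cylinder_def)
    then have "(LBINT x. (r_init n x)\<^sup>2 * \<phi> (0, x))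
      + (LINT z:?\<Omega>|lborel. (r n z)\<^sup>2 * dt \<phi> z + (r n z *\<^sub>R w n z) \<bullet> grad_x \<phi> z) = 0"
      using ce[of n] unfolding weak_continuity_eq_def Let_def by blast
    moreover have "\<phi> (0, x) = 0" for x by (rule test_function_outside[OF \<phi>]) simp
    ultimately have "0 = (LINT z:?\<Omega>|lborel. (r n z)\<^sup>2 * dt \<phi> z + (r n z *\<^sub>R w n z) \<bullet> grad_x \<phi> z)"
      by simp
    also have "\<dots> = (LBINT z. R n z * R n z * dt \<phi> z + 2 * (R n z * dt \<phi> z) + dt \<phi> z
      + (\<Sum>j\<in>UNIV. R n z * W n j z * dx j \<phi> z + W n j z * dx j \<phi> z))"
      unfolding set_lebesgue_integral_def R_def W_def
    proof (intro Bochner_Integration.integral_cong refl)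
      fix z
      have "dt \<phi> z = 0" if "z \<notin> ?\<Omega>" using test_function_outside[OF dt_test_function[OF \<phi>] that] .
      then show "indicator ?\<Omega> z *\<^sub>R ((r n z)\<^sup>2 * dt \<phi> z + (r n z *\<^sub>R w n z) \<bullet> grad_x \<phi> z) =
        zero_ext ?\<Omega> (\<lambda>z. r n z - 1) z * zero_ext ?\<Omega> (\<lambda>z. r n z - 1) z * dt \<phi> z
        + 2 * (zero_ext ?\<Omega> (\<lambda>z. r n z - 1) z * dt \<phi> z) + dt \<phi> z
        + (\<Sum>j\<in>UNIV. zero_ext ?\<Omega> (\<lambda>z. r n z - 1) z * zero_ext ?\<Omega> (w n) z $ j * dx j \<phi> z
            + zero_ext ?\<Omega> (w n) z $ j * dx j \<phi> z)"
        by (simp add: zero_ext_def indicator_def inner_vec_def grad_x_def sum_3 power2_eq_square algebra_simps)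
    qed
    also have "\<dots> = (LBINT z. R n z * R n z * dt \<phi> z) + 2 * (LBINT z. R n z * dt \<phi> z) + (LBINT z. dt \<phi> z)
      + (\<Sum>j\<in>UNIV. (LBINT z. R n z * W n j z * dx j \<phi> z) + (LBINT z. W n j z * dx j \<phi> z))"
      using integral_triple_product(1)[OF Rs Rs B] square_integrable_real_mult(1)[OF Rs pt] it
        Wint square_integrable_real_mult(1)[OF Ws(1) px] by simp
    also have "(LBINT z. dt \<phi> z) = 0" unfolding dt_def by (rule integral_dir_deriv_test_function[OF \<phi>])
    finally show ?thesis by simp
  qed
  have "(\<lambda>n. LBINT z. R n z * dt \<phi> z) \<longlonglongrightarrow> 0"
  proof (rule Lim_null_comparison)
    show "\<forall>\<^sub>F n in sequentially. norm (LBINT z. R n z * dt \<phi> z) \<le> sqrt (sq_norm lborel (R n)) * sqrt (sq_norm lborel (dt \<phi>))"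
      using square_integrable_real_mult(2)[OF Rs pt] by simp
    have "(\<lambda>n. sqrt (sq_norm lborel (R n)) * sqrt (sq_norm lborel (dt \<phi>))) \<longlonglongrightarrow> sqrt 0 * sqrt (sq_norm lborel (dt \<phi>))"
      by (intro tendsto_intros Rlim)
    then show "(\<lambda>n. sqrt (sq_norm lborel (R n)) * sqrt (sq_norm lborel (dt \<phi>))) \<longlonglongrightarrow> 0" by simp
  qed
  then have "(\<lambda>n. (LBINT z. R n z * R n z * dt \<phi> z) + 2 * (LBINT z. R n z * dt \<phi> z)
    + (\<Sum>j\<in>UNIV. (LBINT z. R n z * W n j z * dx j \<phi> z) + (LBINT z. W n j z * dx j \<phi> z)))
    \<longlonglongrightarrow> 0 + 2 * 0 + (\<Sum>j\<in>UNIV. 0 + (LBINT z. zero_ext ?\<Omega> u z $ j * dx j \<phi> z))"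
    unfolding W_def
    by (intro tendsto_intros integral_triple_product_tendsto_0[OF Rs Rs B Rlim K] Wlim[unfolded W_def]
        weak_star_component[OF lim px])
  then show ?thesis unfolding id[symmetric] by (simp add: LIMSEQ_const_iff)
qed

section \<open>The energy inequality in the limit\<close>

text \<open>
The energy inequality at time \<open>t\<close>, as a convex condition on the pair \<open>(w, TT)\<close>.
\<close>

definition slice_energy_le :: "real \<Rightarrow> real \<Rightarrow> real \<Rightarrow> (spacetime \<Rightarrow> R3 \<times> (real ^ 3 ^ 3)) \<Rightarrow> bool"
  where "slice_energy_le \<nu> t E f \<longleftrightarrow> square_integrable lborel (\<lambda>x. fst (f (t, x))) \<and>
    1/2 * sq_norm lborel (\<lambda>x. fst (f (t, x)))
      + 2 * \<nu> * sq_norm lborel (zero_ext (cylinder t) (\<lambda>z. sym_part (snd (f z)))) \<le> E"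

lemma slice_energy_le_mono: "slice_energy_le \<nu> t E f \<Longrightarrow> E \<le> E' \<Longrightarrow> slice_energy_le \<nu> t E' f"
  by (auto simp: slice_energy_le_def)

lemma linear_sym_part_snd: "linear (\<lambda>p :: R3 \<times> (real ^ 3 ^ 3). sym_part (snd p))"
  using linear_compose[OF linear_snd linear_sym_part] by (simp add: o_def)

lemma square_integrable_sym_part_snd:
  fixes f :: "spacetime \<Rightarrow> R3 \<times> (real ^ 3 ^ 3)"
  assumes f: "square_integrable lborel f"
  shows "square_integrable lborel (zero_ext (cylinder t) (\<lambda>z. sym_part (snd (f z))))"
    "sq_norm lborel (zero_ext (cylinder t) (\<lambda>z. sym_part (snd (f z)))) \<le> sq_norm lborel f"
proof -
  have [measurable]: "(\<lambda>z. sym_part (snd (f z))) \<in> borel_measurable borel"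
    using borel_measurable_linear_compose[OF linear_sym_part_snd square_integrableD(1)[OF f]] by simp
  have "zero_ext (cylinder t) (\<lambda>z. sym_part (snd (f z))) \<in> borel_measurable lborel"
    unfolding zero_ext_def[abs_def] by measurable
  moreover have "norm (zero_ext (cylinder t) (\<lambda>z. sym_part (snd (f z))) z) \<le> norm (f z)" for z
  proof -
    have "norm (sym_part (snd (f z))) \<le> norm (f z)"
      using norm_sym_part_le[of "snd (f z)"] norm_snd_le[of "snd (f z)" "fst (f z)"] by simp
    then show ?thesis by (simp add: zero_ext_def indicator_def)
  qed
  ultimately show "square_integrable lborel (zero_ext (cylinder t) (\<lambda>z. sym_part (snd (f z))))"
    "sq_norm lborel (zero_ext (cylinder t) (\<lambda>z. sym_part (snd (f z)))) \<le> sq_norm lborel f"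
    using sq_norm_mono[OF f] by blast+
qed

lemma slice_energy_le_tail_hull:
  assumes g: "g \<in> tail_hull Z N" and Z: "\<And>n. square_integrable lborel (Z n)" and "\<nu> > 0"
    and le: "\<And>n. n \<ge> N \<Longrightarrow> slice_energy_le \<nu> t E (Z n)"
  shows "slice_energy_le \<nu> t E g"
  using g
proof induction
  case (base k)
  then show ?case by (rule le)
next
  case (midpoint p q)
  note p = tail_hull_square_integrable[OF midpoint(1) Z] and q = tail_hull_square_integrable[OF midpoint(2) Z]
  define P where "P x = fst (p (t, x))" for x
  define Q where "Q x = fst (q (t, x))" for x
  define SP where "SP = zero_ext (cylinder t) (\<lambda>z. sym_part (snd (p z)))"
  define SQ where "SQ = zero_ext (cylinder t) (\<lambda>z. sym_part (snd (q z)))"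
  have P: "square_integrable lborel P" "1/2 * sq_norm lborel P + 2 * \<nu> * sq_norm lborel SP \<le> E"
    and Q: "square_integrable lborel Q" "1/2 * sq_norm lborel Q + 2 * \<nu> * sq_norm lborel SQ \<le> E"
    using midpoint.IH by (auto simp: slice_energy_le_def P_def[abs_def] Q_def[abs_def] SP_def SQ_def)
  have SP: "square_integrable lborel SP" and SQ: "square_integrable lborel SQ"
    unfolding SP_def SQ_def by (intro square_integrable_sym_part_snd p q)+
  have f1: "(\<lambda>x. fst ((1/2) *\<^sub>R (p (t, x) + q (t, x)))) = (\<lambda>x. (1/2) *\<^sub>R (P x + Q x))"
    by (simp add: P_def Q_def)
  have s1: "zero_ext (cylinder t) (\<lambda>z. sym_part (snd ((1/2) *\<^sub>R (p z + q z)))) = (\<lambda>z. (1/2) *\<^sub>R (SP z + SQ z))"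
    unfolding SP_def SQ_def zero_ext_linear[OF linear_sym_part_snd]
    by (simp add: zero_ext_def fun_eq_iff linear_add[OF linear_sym_part] linear_scale[OF linear_sym_part] scaleR_add_right)
  have "2 * \<nu> * sq_norm lborel (\<lambda>z. (1/2) *\<^sub>R (SP z + SQ z)) \<le> 2 * \<nu> * (1/2 * sq_norm lborel SP + 1/2 * sq_norm lborel SQ)"
    using \<open>\<nu> > 0\<close> by (intro mult_left_mono sq_norm_midpoint_le SP SQ) auto
  also have "\<dots> = \<nu> * sq_norm lborel SP + \<nu> * sq_norm lborel SQ" by (simp add: distrib_left)
  finally have "1/2 * sq_norm lborel (\<lambda>x. (1/2) *\<^sub>R (P x + Q x)) + 2 * \<nu> * sq_norm lborel (\<lambda>z. (1/2) *\<^sub>R (SP z + SQ z)) \<le> E"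
    using sq_norm_midpoint_le[OF P(1) Q(1)] P(2) Q(2) by linarith
  moreover have "square_integrable lborel (\<lambda>x. (1/2) *\<^sub>R (P x + Q x))"
    by (intro square_integrable_scaleR square_integrable_add P Q)
  ultimately show ?case unfolding slice_energy_le_def f1 s1 by blast
qed

text \<open>
The dissipation converges because of strong convergence; the kinetic energy of a single time slice is controlled by convergence almost everywhere and Fatou's lemma.
\<close>

lemma slice_energy_le_limit:
  assumes g: "\<And>n. square_integrable lborel (g n)" and h: "square_integrable lborel h"
    and gh: "(\<lambda>n. sq_norm lborel (\<lambda>z. g n z - h z)) \<longlonglongrightarrow> 0"
    and AEx: "AE x in lborel. (\<lambda>n. g n (t, x)) \<longlonglongrightarrow> h (t, x)" and "\<nu> > 0"
    and le: "eventually (\<lambda>n. slice_energy_le \<nu> t E (g n)) sequentially"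
  shows "slice_energy_le \<nu> t E h"
proof -
  define S where "S f = zero_ext (cylinder t) (\<lambda>z. sym_part (snd (f z)))" for f :: "spacetime \<Rightarrow> R3 \<times> (real ^ 3 ^ 3)"
  have Ss: "square_integrable lborel (S f)" "sq_norm lborel (S f) \<le> sq_norm lborel f" if "square_integrable lborel f" for f
    unfolding S_def by (intro square_integrable_sym_part_snd that)+
  have Sdiff: "S (\<lambda>z. g n z - h z) = (\<lambda>z. S (g n) z - S h z)" for n
    unfolding S_def by (auto simp: zero_ext_def linear_diff[OF linear_sym_part] scaleR_diff_right)
  have "(\<lambda>n. sq_norm lborel (\<lambda>z. S (g n) z - S h z)) \<longlonglongrightarrow> 0"
    by (rule tendsto_sandwich[OF _ _ tendsto_const gh])
       (use Ss(2)[OF square_integrable_diff[OF g h]] in \<open>auto simp: Sdiff\<close>)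
  then have Slim: "(\<lambda>n. sq_norm lborel (S (g n))) \<longlonglongrightarrow> sq_norm lborel (S h)"
    by (intro sq_norm_tendsto Ss g h)
  obtain N where N: "\<And>n. n \<ge> N \<Longrightarrow> slice_energy_le \<nu> t E (g n)"
    using le by (auto simp: eventually_sequentially)
  define G where "G n x = fst (g (n + N) (t, x))" for n x
  have G: "square_integrable lborel (G n)"
    and GE: "1/2 * sq_norm lborel (G n) + 2 * \<nu> * sq_norm lborel (S (g (n + N))) \<le> E" for n
    using N[of "n + N"] by (auto simp: slice_energy_le_def G_def[abs_def] S_def)
  have "h \<in> borel_measurable borel" using square_integrableD(1)[OF h] by simp
  from section_borel[OF this] have hm: "(\<lambda>x. fst (h (t, x))) \<in> borel_measurable lborel"
    by (intro borel_measurable_linear_compose[OF linear_fst]) simp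
  have Glim: "AE x in lborel. (\<lambda>n. G n x) \<longlonglongrightarrow> fst (h (t, x))"
    using AEx unfolding G_def
    by eventually_elim (intro tendsto_fst LIMSEQ_ignore_initial_segment)
  have bound: "square_integrable lborel (\<lambda>x. fst (h (t, x)))
    \<and> sq_norm lborel (\<lambda>x. fst (h (t, x))) \<le> 2 * (E - 2 * \<nu> * sq_norm lborel (S h)) + \<delta>" if "\<delta> > 0" for \<delta>
  proof -
    have "(\<lambda>n. 2 * (E - 2 * \<nu> * sq_norm lborel (S (g (n + N))))) \<longlonglongrightarrow> 2 * (E - 2 * \<nu> * sq_norm lborel (S h))"
      by (intro tendsto_intros LIMSEQ_ignore_initial_segment Slim)
    then have "eventually (\<lambda>n. 2 * (E - 2 * \<nu> * sq_norm lborel (S (g (n + N)))) < 2 * (E - 2 * \<nu> * sq_norm lborel (S h)) + \<delta>) sequentially"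
      using that by (intro order_tendstoD(2)) auto
    then have "eventually (\<lambda>n. sq_norm lborel (G n) \<le> 2 * (E - 2 * \<nu> * sq_norm lborel (S h)) + \<delta>) sequentially"
    proof eventually_elim
      case (elim n)
      have "2 * (E - b) < X \<Longrightarrow> 1/2 * a + b \<le> E \<Longrightarrow> a \<le> X" for a b X :: real by simp
      from this[OF elim GE] show ?case .
    qed
    from sq_norm_liminf[OF G hm Glim this] show ?thesis by blast
  qed
  have "sq_norm lborel (\<lambda>x. fst (h (t, x))) \<le> 2 * (E - 2 * \<nu> * sq_norm lborel (S h))"
    by (rule field_le_epsilon) (use bound in blast)
  then show ?thesis using bound[of 1] unfolding slice_energy_le_def S_def by auto
qed

theorem proposition2p6:
  fixes \<gamma> \<nu> \<kappa> T c C M :: real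
    and sqrtrho0 :: "real \<Rightarrow> R3 \<Rightarrow> real"
    and sqrtrho0_u0 grad_sqrtrho0 :: "real \<Rightarrow> R3 \<Rightarrow> R3"
    and sqrtrho :: "real \<Rightarrow> spacetime \<Rightarrow> real"
    and sqrtrho_u :: "real \<Rightarrow> spacetime \<Rightarrow> R3"
    and u0 :: "R3 \<Rightarrow> R3"
    and e :: "nat \<Rightarrow> real"
    and u :: "spacetime \<Rightarrow> R3"
  assumes "\<gamma> > 1" and "\<nu> > 0" and "\<kappa> > 0" and "T > 0" and "c > 0" and "C > 0"
    and solutions: "\<And>\<epsilon>. 0 < \<epsilon> \<Longrightarrow> \<epsilon> < 1 \<Longrightarrow>
      BD_entropic_weak_solution \<gamma> \<nu> \<kappa> \<epsilon> T c C
        (sqrtrho0 \<epsilon>) (sqrtrho0_u0 \<epsilon>) (grad_sqrtrho0 \<epsilon>) (sqrtrho \<epsilon>) (sqrtrho_u \<epsilon>)"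
    and bounded_grad: "\<And>\<epsilon>. 0 < \<epsilon> \<Longrightarrow> \<epsilon> < 1 \<Longrightarrow>
      L2_on UNIV (grad_sqrtrho0 \<epsilon>) \<and> L2_norm (grad_sqrtrho0 \<epsilon>) \<le> M"
    and bounded_momentum: "\<And>\<epsilon>. 0 < \<epsilon> \<Longrightarrow> \<epsilon> < 1 \<Longrightarrow>
      L2_on UNIV (sqrtrho0_u0 \<epsilon>) \<and> L2_norm (sqrtrho0_u0 \<epsilon>) \<le> M"
    and bounded_pi: "\<And>\<epsilon>. 0 < \<epsilon> \<Longrightarrow> \<epsilon> < 1 \<Longrightarrow>
      integrable lborel (\<lambda>x. pi_pot \<gamma> \<epsilon> ((sqrtrho0 \<epsilon> x)\<^sup>2)) \<and>
      L1_norm (\<lambda>x. pi_pot \<gamma> \<epsilon> ((sqrtrho0 \<epsilon> x)\<^sup>2)) \<le> M"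
    and weak_data: "weakly_tends_L2 sqrtrho0_u0 u0 (at_right 0)"
    and strong_data: "((\<lambda>\<epsilon>. L2_norm (\<lambda>x. sqrtrho0_u0 \<epsilon> x - u0 x)) \<longlongrightarrow> 0) (at_right 0)"
    and leray: "is_P_proj u0 u0"
    and pi_data: "((\<lambda>\<epsilon>. L1_norm (\<lambda>x. pi_pot \<gamma> \<epsilon> ((sqrtrho0 \<epsilon> x)\<^sup>2))) \<longlongrightarrow> 0) (at_right 0)"
    and grad_data: "((\<lambda>\<epsilon>. L2_norm (grad_sqrtrho0 \<epsilon>)) \<longlongrightarrow> 0) (at_right 0)"
    and subsequence: "\<And>n. 0 < e n \<and> e n < 1" "e \<longlonglongrightarrow> 0"
    and limit: "weak_star_tends_Linf_L2 T (\<lambda>n. sqrtrho_u (e n)) u sequentially"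
  shows "\<exists>Du. has_weak_jacobian_x T u Du \<and> L2_on (cylinder T) Du \<and>
    (AE t in lborel. t \<in> {0..T} \<longrightarrow>
      (\<integral>\<^sup>+x. ennreal (1/2 * (norm (u (t, x)))\<^sup>2) \<partial>lborel) + ennreal \<nu> * sq_integral_upto t Du
      \<le> (\<integral>\<^sup>+x. ennreal (1/2 * (norm (u0 x))\<^sup>2) \<partial>lborel))"
proof -
  let ?\<Omega> = "cylinder T"
  have e01: "0 < e n" "e n < 1" for n using subsequence(1) by auto
  define r0 where "r0 n = sqrtrho0 (e n)" for n
  define w0 where "w0 n = sqrtrho0_u0 (e n)" for n
  define dr0 where "dr0 n = grad_sqrtrho0 (e n)" for n
  define r where "r n = sqrtrho (e n)" for n
  define w where "w n = sqrtrho_u (e n)" for n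
  have w0: "square_integrable lborel (w0 n)" "sqrt (sq_norm lborel (w0 n)) \<le> M" for n
    using bounded_momentum[OF e01] by (auto simp: L2_on_UNIV_iff L2_norm_eq w0_def)
  have dr0: "square_integrable lborel (dr0 n)" "sqrt (sq_norm lborel (dr0 n)) \<le> M" for n
    using bounded_grad[OF e01] by (auto simp: L2_on_UNIV_iff L2_norm_eq dr0_def)
  define p0 where "p0 n = L1_norm (\<lambda>x. pi_pot \<gamma> (e n) ((r0 n x)\<^sup>2))" for n
  have p0: "integrable lborel (\<lambda>x. pi_pot \<gamma> (e n) ((r0 n x)\<^sup>2))" "p0 n \<le> M" for n
    using bounded_pi[OF e01] by (auto simp: r0_def p0_def)
  have M0: "0 \<le> M" using w0(2)[of 0] real_sqrt_ge_zero[OF sq_norm_nonneg] order_trans by blast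
  have w0M: "sq_norm lborel (w0 n) \<le> M\<^sup>2" and dr0M: "sq_norm lborel (dr0 n) \<le> M\<^sup>2" for n
    using sqrt_le_D[OF w0(2)] sqrt_le_D[OF dr0(2)] by simp_all
  \<comment> \<open>The bound \<open>EM\<close> serves compactness, the limit of \<open>E0\<close> the energy inequality itself.\<close>
  define E0 where "E0 n = 1/2 * sq_norm lborel (w0 n) + 2 * \<kappa>\<^sup>2 * sq_norm lborel (dr0 n) + p0 n" for n
  have E0: "energy \<gamma> \<kappa> (e n) (r0 n) (w0 n) (dr0 n) = ennreal (E0 n)" for n
    unfolding E0_def p0_def by (rule energy_eq[OF \<open>\<gamma> > 1\<close> e01(1) w0(1) dr0(1) p0(1)])
  have p0_nonneg: "0 \<le> p0 n" for n by (simp add: p0_def L1_norm_def)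
  have E0_nonneg: "0 \<le> E0 n" for n using p0_nonneg by (simp add: E0_def)
  define EM where "EM = 1/2 * M\<^sup>2 + 2 * \<kappa>\<^sup>2 * M\<^sup>2 + M"
  have E0_le: "E0 n \<le> EM" for n
    unfolding E0_def EM_def using w0M dr0M p0(2) by (intro add_mono mult_left_mono) auto
  have EM0: "0 \<le> EM" using E0_nonneg[of 0] E0_le[of 0] by simp
  define KM where "KM = M\<^sup>2 + (4 * c\<^sup>2 + 1) * M\<^sup>2 + M"
  have KM0: "0 \<le> KM" using M0 by (simp add: KM_def)
  have KM: "BD_entropy \<gamma> c (e n) (r0 n) (w0 n) (dr0 n) \<le> ennreal KM" for n
  proof -
    have "sq_norm lborel (w0 n) + (4 * c\<^sup>2 + 1) * sq_norm lborel (dr0 n) + p0 n \<le> KM"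
      unfolding KM_def using w0M dr0M p0(2) by (intro add_mono mult_left_mono) auto
    then show ?thesis
      using BD_entropy_le[OF \<open>\<gamma> > 1\<close> e01(1) w0(1) dr0(1) p0(1), where c=c] unfolding p0_def
      by (meson ennreal_leI order_trans)
  qed
  have u0: "square_integrable lborel u0"
    using weak_data by (simp add: weakly_tends_L2_def L2_on_UNIV_iff)
  have e_lim: "filterlim e (at_right 0) sequentially"
    unfolding filterlim_at using subsequence(2) e01 by (simp add: less_imp_neq[symmetric])
  have "(\<lambda>n. sq_norm lborel (\<lambda>x. w0 n x - u0 x)) \<longlonglongrightarrow> 0"
    using tendsto_power[OF filterlim_compose[OF strong_data e_lim], of 2] by (simp add: L2_norm_eq w0_def)
  then have w0_lim: "(\<lambda>n. sq_norm lborel (w0 n)) \<longlonglongrightarrow> sq_norm lborel u0"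
    by (rule sq_norm_tendsto[OF w0(1) u0])
  have dr0_lim: "(\<lambda>n. sq_norm lborel (dr0 n)) \<longlonglongrightarrow> 0"
    using tendsto_power[OF filterlim_compose[OF grad_data e_lim], of 2] by (simp add: L2_norm_eq dr0_def)
  have p0_lim: "p0 \<longlonglongrightarrow> 0"
    using filterlim_compose[OF pi_data e_lim] by (simp add: p0_def[abs_def] r0_def)
  have "E0 \<longlonglongrightarrow> 1/2 * sq_norm lborel u0 + 2 * \<kappa>\<^sup>2 * 0 + 0"
    unfolding E0_def by (intro tendsto_intros w0_lim dr0_lim p0_lim)
  then have E0_lim: "E0 \<longlonglongrightarrow> 1/2 * sq_norm lborel u0" by simp
  define bounded_BD where "bounded_BD n dr TT H N \<longleftrightarrow> (AE t in lborel. t \<in> {0..T} \<longrightarrow>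
        BD_entropy \<gamma> c (e n) (\<lambda>x. r n (t, x)) (\<lambda>x. w n (t, x)) (\<lambda>x. dr (t, x))
          + ennreal \<nu> * sq_integral_upto t (\<lambda>z. antisym_part (TT z))
          + ennreal \<nu> * sq_integral_upto t H
          + ennreal (\<nu> / (4 * \<gamma> * (e n)\<^sup>2)) * sq_integral_upto t N
        \<le> ennreal C * BD_entropy \<gamma> c (e n) (r0 n) (w0 n) (dr0 n))"
    for n and dr :: "spacetime \<Rightarrow> R3" and TT H :: "spacetime \<Rightarrow> real ^ 3 ^ 3" and N :: "spacetime \<Rightarrow> R3"
  have "\<exists>dr TT H N. finite_energy_weak_solution_with \<gamma> \<nu> \<kappa> (e n) T (r0 n) (w0 n) (dr0 n) (r n) (w n) dr TT \<and>
      has_weak_jacobian_x T dr H \<and> bounded_BD n dr TT H N" for n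
    using solutions[OF e01, of n]
    unfolding BD_entropic_weak_solution_def bounded_BD_def r0_def w0_def dr0_def r_def w_def
    by (elim ex_forward) (elim conjE, intro conjI)
  then obtain dr TT H N where
    fe: "\<And>n. finite_energy_weak_solution_with \<gamma> \<nu> \<kappa> (e n) T (r0 n) (w0 n) (dr0 n) (r n) (w n) (dr n) (TT n)"
    and H: "\<And>n. has_weak_jacobian_x T (dr n) (H n)"
    and "\<And>n. bounded_BD n (dr n) (TT n) (H n) (N n)"
    by metis
  note BD = this(3)[unfolded bounded_BD_def]
  have TT_L2: "L2_on ?\<Omega> (TT n)" and ce: "weak_continuity_eq T (r0 n) (r n) (w n)"
    and st: "stress_identity T (r n) (w n) (dr n) (TT n)" and gr: "has_weak_grad_x T (r n) (dr n)" for n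
    using fe[of n] by (auto simp: finite_energy_weak_solution_with_def)
  note est = finite_energy_estimates[OF \<open>\<gamma> > 1\<close> \<open>\<nu> > 0\<close> \<open>\<kappa> > 0\<close> e01(1) \<open>T > 0\<close> fe eq_refl[OF E0] E0_nonneg]
  note bd = BD_entropy_estimates[OF \<open>\<nu> > 0\<close> \<open>T > 0\<close> \<open>C > 0\<close> KM0 TT_L2 H KM BD]
  have TT: "square_integrable lborel (zero_ext ?\<Omega> (TT n))" for n using TT_L2 by (simp add: L2_on_iff)
  define Bw where "Bw = 2 * T * EM"
  have w_le: "sq_norm lborel (zero_ext ?\<Omega> (w n)) \<le> Bw" for n
    using mult_left_mono[OF E0_le[of n], of "2 * T"] \<open>T > 0\<close> unfolding Bw_def
    by (intro order_trans[OF est(4)]) simp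
  define BT where "BT = 2 * (EM / (2 * \<nu>)) + 2 * (C * KM / \<nu>)"
  have TT_le: "sq_norm lborel (zero_ext ?\<Omega> (TT n)) \<le> BT" for n
  proof -
    define S where "S = zero_ext ?\<Omega> (\<lambda>z. sym_part (TT n z))"
    define A where "A = zero_ext ?\<Omega> (\<lambda>z. antisym_part (TT n z))"
    have eqS: "S = (\<lambda>z. sym_part (zero_ext ?\<Omega> (TT n) z))" and eqA: "A = (\<lambda>z. antisym_part (zero_ext ?\<Omega> (TT n) z))"
      unfolding S_def A_def by (intro zero_ext_linear linear_sym_part linear_antisym_part)+
    have S: "square_integrable lborel S"
      unfolding eqS by (rule sq_norm_mono(1)[OF TT borel_measurable_linear_compose[OF linear_sym_part square_integrableD(1)[OF TT]] norm_sym_part_le])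
    have "A = (\<lambda>z. zero_ext ?\<Omega> (TT n) z - S z)" unfolding eqA eqS using sym_antisym_decomp by (metis add_diff_cancel_left')
    then have A: "square_integrable lborel A" using TT S by (simp add: square_integrable_diff)
    have "sq_norm lborel (zero_ext ?\<Omega> (TT n)) = sq_norm lborel (\<lambda>z. S z + A z)"
      unfolding eqS eqA sym_antisym_decomp ..
    also have "\<dots> \<le> 2 * sq_norm lborel S + 2 * sq_norm lborel A"
      using sq_norm_parallelogram[OF S A] sq_norm_nonneg[of lborel "\<lambda>z. S z - A z"] sq_norm_scaleR[of lborel "1/2" "\<lambda>z. S z + A z"]
      by (simp add: power2_eq_square)
    also have "\<dots> \<le> BT"
      unfolding BT_def S_def A_def
    proof (intro add_mono mult_left_mono)
      have "E0 n / (2 * \<nu>) \<le> EM / (2 * \<nu>)" using E0_le \<open>\<nu> > 0\<close> by (intro divide_right_mono) auto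
      then show "sq_norm lborel (zero_ext ?\<Omega> (\<lambda>z. sym_part (TT n z))) \<le> EM / (2 * \<nu>)"
        using est(6)[of n] by simp
      show "sq_norm lborel (zero_ext ?\<Omega> (\<lambda>z. antisym_part (TT n z))) \<le> C * KM / \<nu>" by (rule bd(1))
    qed auto
    finally show ?thesis .
  qed
  have r_lim: "(\<lambda>n. sq_norm lborel (zero_ext ?\<Omega> (\<lambda>z. r n z - 1))) \<longlonglongrightarrow> 0"
  proof (rule tendsto_sandwich[OF _ _ tendsto_const])
    show "\<forall>\<^sub>F n in sequentially. sq_norm lborel (zero_ext ?\<Omega> (\<lambda>z. r n z - 1)) \<le> T * EM * \<gamma> * (e n)\<^sup>2"
    proof (intro always_eventually allI)
      fix n
      have "T * E0 n * \<gamma> * (e n)\<^sup>2 \<le> T * EM * \<gamma> * (e n)\<^sup>2"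
        using E0_le assms(1,4) by (intro mult_right_mono mult_left_mono) auto
      then show "sq_norm lborel (zero_ext ?\<Omega> (\<lambda>z. r n z - 1)) \<le> T * EM * \<gamma> * (e n)\<^sup>2"
        using est(2)[of n] by simp
    qed
    have "(\<lambda>n. T * EM * \<gamma> * (e n)\<^sup>2) \<longlonglongrightarrow> T * EM * \<gamma> * 0\<^sup>2" by (intro tendsto_intros subsequence)
    then show "(\<lambda>n. T * EM * \<gamma> * (e n)\<^sup>2) \<longlonglongrightarrow> 0" by simp
  qed auto
  have dr_lim: "(\<lambda>n. sq_norm lborel (zero_ext ?\<Omega> (\<lambda>z. dr n z $ j))) \<longlonglongrightarrow> 0" for j
  proof (rule weak_deriv_L2_tendsto_0[OF open_cylinder translation_invariant_cylinder _ _ r_lim bd(3)])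
    have drj: "square_integrable lborel (zero_ext ?\<Omega> (\<lambda>z. dr n z $ j))" for n
      unfolding zero_ext_vec_nth by (rule square_integrable_component(1)[OF est(5)])
    show "weak_deriv_L2 ?\<Omega> (0, axis j 1) (zero_ext ?\<Omega> (\<lambda>z. r n z - 1)) (zero_ext ?\<Omega> (\<lambda>z. dr n z $ j))" for n
      using gr[of n] by (intro has_weak_deriv_minus_1_imp_L2 est(1) drj) (simp add: has_weak_grad_x_def)
    show "weak_deriv_L2 ?\<Omega> (0, axis j 1) (zero_ext ?\<Omega> (\<lambda>z. dr n z $ j)) (zero_ext ?\<Omega> (\<lambda>z. H n z $ j $ j))" for n
      using H[of n] by (intro has_weak_deriv_imp_L2 bd(2) drj) (simp add: has_weak_jacobian_x_def has_weak_grad_x_def)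
  qed
  have lim: "weak_star_tends_Linf_L2 T w u sequentially" using limit by (simp add: w_def[abs_def])
  have u: "square_integrable lborel (zero_ext ?\<Omega> u)"
    using lim \<open>T > 0\<close> by (intro Linf_L2_imp_square_integrable) (simp_all add: weak_star_tends_Linf_L2_def)
  \<comment> \<open>Both fields form one function, so that the same midpoints are taken of \<open>w\<close> and \<open>TT\<close>
    and the energy inequality, which couples them, is inherited.\<close>
  define Z where "Z n z = (zero_ext ?\<Omega> (w n) z, zero_ext ?\<Omega> (TT n) z)" for n z
  have Z_meas: "Z n \<in> borel_measurable lborel" for n
    unfolding Z_def using square_integrableD(1)[OF est(3)[of n]] square_integrableD(1)[OF TT[of n]]
    by (intro borel_measurable_Pair)
  have Z_norm: "(norm (Z n z))\<^sup>2 = (norm (zero_ext ?\<Omega> (w n) z))\<^sup>2 + (norm (zero_ext ?\<Omega> (TT n) z))\<^sup>2" for n z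
    by (simp add: Z_def norm_Pair)
  have Z: "square_integrable lborel (Z n)" for n
    using Z_meas square_integrableD(2)[OF est(3)[of n]] square_integrableD(2)[OF TT[of n]]
    by (simp add: square_integrable_def Z_norm)
  have Z_le: "sq_norm lborel (Z n) \<le> Bw + BT" for n
  proof -
    have "sq_norm lborel (Z n) = sq_norm lborel (zero_ext ?\<Omega> (w n)) + sq_norm lborel (zero_ext ?\<Omega> (TT n))"
      using square_integrableD(2)[OF est(3)[of n]] square_integrableD(2)[OF TT[of n]]
      by (simp add: sq_norm_def Z_norm)
    then show ?thesis using w_le[of n] TT_le[of n] by simp
  qed
  obtain g h where g: "\<And>n. g n \<in> tail_hull Z n" and h: "square_integrable lborel h"
    and gh: "(\<lambda>n. sq_norm lborel (\<lambda>z. g n z - h z)) \<longlonglongrightarrow> 0"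
    and g_AE: "AE z in lborel. (\<lambda>n. g n z) \<longlonglongrightarrow> h z"
    using bounded_tail_hull_converges[of lborel Z "Bw + BT", OF Z Z_le] by blast
  note gs = tail_hull_square_integrable[OF g Z]
  note weak_lim = tail_hull_weak_limit[OF Z _ _ g h gh]
  have h1: "square_integrable lborel (\<lambda>z. fst (h z))"
    by (rule sq_norm_mono(1)[OF h borel_measurable_linear_compose[OF linear_fst square_integrableD(1)[OF h]]])
       (metis norm_fst_le prod.collapse)
  have h2: "square_integrable lborel (\<lambda>z. snd (h z))"
    by (rule sq_norm_mono(1)[OF h borel_measurable_linear_compose[OF linear_snd square_integrableD(1)[OF h]]])
       (metis norm_snd_le prod.collapse)
  \<comment> \<open>The difference of the strong and the weak-\<open>*\<close> limit is an admissible test function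
    for the weak convergence, hence orthogonal to itself.\<close>
  have fst_h: "AE z in lborel. z \<in> ?\<Omega> \<longrightarrow> fst (h z) = u z"
  proof -
    define k where "k = zero_ext ?\<Omega> (\<lambda>z. fst (h z) - zero_ext ?\<Omega> u z)"
    have k: "square_integrable lborel k"
      unfolding k_def by (intro square_integrable_zero_ext square_integrable_diff h1 u cylinder_borel)
    have k_out: "zero_ext ?\<Omega> k = k" by (simp add: k_def zero_ext_zero_ext)
    define \<psi> :: "spacetime \<Rightarrow> R3 \<times> (real ^ 3 ^ 3)" where "\<psi> z = (k z, 0)" for z
    have \<psi>: "square_integrable lborel \<psi>"
      using square_integrableD[OF k] unfolding \<psi>_def square_integrable_def by (simp add: norm_Pair)
    have eq: "(LINT z:?\<Omega>|lborel. v z \<bullet> k z) = (LINT z|lborel. zero_ext ?\<Omega> v z \<bullet> k z)" for v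
      unfolding set_lebesgue_integral_def by (intro Bochner_Integration.integral_cong refl) (simp add: zero_ext_def)
    have "L1_L2 T k" using k by (intro L2_on_imp_L1_L2) (simp add: L2_on_iff k_out)
    then have "(\<lambda>n. LINT z|lborel. zero_ext ?\<Omega> (w n) z \<bullet> k z) \<longlonglongrightarrow> (LINT z|lborel. zero_ext ?\<Omega> u z \<bullet> k z)"
      using lim unfolding weak_star_tends_Linf_L2_def eq[symmetric] by blast
    then have "(\<lambda>n. LINT z|lborel. Z n z \<bullet> \<psi> z) \<longlonglongrightarrow> (LINT z|lborel. zero_ext ?\<Omega> u z \<bullet> k z)"
      by (simp add: Z_def \<psi>_def)
    from weak_lim[OF \<psi> this]
    have "(LINT z|lborel. fst (h z) \<bullet> k z) = (LINT z|lborel. zero_ext ?\<Omega> u z \<bullet> k z)"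
      by (simp add: \<psi>_def inner_prod_def)
    then have "(LINT z|lborel. (fst (h z) - zero_ext ?\<Omega> u z) \<bullet> k z) = 0"
      using integrable_inner_square_integrable[OF h1 k] integrable_inner_square_integrable[OF u k]
      by (simp add: inner_diff_left)
    also have "(\<lambda>z. (fst (h z) - zero_ext ?\<Omega> u z) \<bullet> k z) = (\<lambda>z. (norm (k z))\<^sup>2)"
      unfolding k_def by (auto simp: zero_ext_def indicator_def power2_norm_eq_inner fun_eq_iff)
    finally have "AE z in lborel. (norm (k z))\<^sup>2 = 0"
      using integral_nonneg_eq_0_iff_AE[OF square_integrableD(2)[OF k]] by simp
    then show ?thesis by eventually_elim (auto simp: k_def zero_ext_def)
  qed
  define Du where "Du z = snd (h z)" for z
  have Du: "square_integrable lborel Du" using h2 by (simp add: Du_def[abs_def])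
  have wd: "weak_deriv_L2 ?\<Omega> (0, axis j 1) (zero_ext ?\<Omega> (\<lambda>z. u z $ i)) (zero_ext ?\<Omega> (\<lambda>z. Du z $ i $ j))" for i j
    unfolding weak_deriv_L2_def
  proof (intro conjI allI impI)
    show "square_integrable lborel (zero_ext ?\<Omega> (\<lambda>z. u z $ i))"
      unfolding zero_ext_vec_nth by (rule square_integrable_component(1)[OF u])
    show "square_integrable lborel (zero_ext ?\<Omega> (\<lambda>z. Du z $ i $ j))"
      by (intro square_integrable_zero_ext square_integrable_component Du cylinder_borel)
    show "zero_ext ?\<Omega> (\<lambda>z. u z $ i) z = 0" "zero_ext ?\<Omega> (\<lambda>z. Du z $ i $ j) z = 0" if "z \<notin> ?\<Omega>" for z
      using that by (simp_all add: zero_ext_def)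
    fix \<phi> :: "spacetime \<Rightarrow> real" assume \<phi>: "test_function ?\<Omega> \<phi>"
    note p = square_integrable_test_function[OF \<phi>]
    define L :: "real \<Rightarrow> R3 \<times> (real ^ 3 ^ 3)" where "L s = (0, axis i (axis j s))" for s
    have "linear L" by (rule linearI) (auto simp: L_def axis_def vec_eq_iff)
    have Ln: "norm (L s) = \<bar>s\<bar>" for s by (simp add: L_def norm_Pair norm_eq_sqrt_inner inner_axis_axis)
    have inner_L: "q \<bullet> L s = snd q $ i $ j * s" for q s
      by (simp add: L_def inner_prod_def inner_axis)
    have L\<phi>: "square_integrable lborel (\<lambda>z. L (\<phi> z))"
      by (rule sq_norm_mono(1)[OF p borel_measurable_linear_compose[OF \<open>linear L\<close> square_integrableD(1)[OF p]]]) (simp add: Ln)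
    have "(\<lambda>n. LINT z|lborel. Z n z \<bullet> L (\<phi> z)) \<longlonglongrightarrow> - (LINT z|lborel. zero_ext ?\<Omega> u z $ i * dx j \<phi> z)"
      unfolding inner_L Z_def snd_conv
      by (rule stress_identity_limit[OF est(1) r_lim est(3) w_le est(5) dr_lim TT TT_le st lim \<phi>])
    from weak_lim[OF L\<phi> this]
    have "(LINT z|lborel. Du z $ i $ j * \<phi> z) = - (LINT z|lborel. zero_ext ?\<Omega> (\<lambda>z. u z $ i) z * dir_deriv (0, axis j 1) \<phi> z)"
      unfolding inner_L zero_ext_vec_nth by (simp add: Du_def dx_def)
    moreover have "(\<lambda>z. zero_ext ?\<Omega> (\<lambda>z. Du z $ i $ j) z * \<phi> z) = (\<lambda>z. Du z $ i $ j * \<phi> z)"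
      using test_function_outside[OF \<phi>] by (fastforce simp: zero_ext_def indicator_def)
    ultimately show "(LINT z|lborel. zero_ext ?\<Omega> (\<lambda>z. u z $ i) z * dir_deriv (0, axis j 1) \<phi> z)
      = - (LINT z|lborel. zero_ext ?\<Omega> (\<lambda>z. Du z $ i $ j) z * \<phi> z)" by simp
  qed
  have div: "(\<Sum>j\<in>UNIV. LINT z|lborel. zero_ext ?\<Omega> (\<lambda>z. u z $ j) z * dx j \<phi> z) = 0"
    if "test_function ?\<Omega> \<phi>" for \<phi>
    unfolding zero_ext_vec_nth by (rule continuity_equation_limit[OF est(1) r_lim est(3) w_le ce lim that])
  have slices: "AE t in lborel. \<forall>n. t \<in> {0<..<T} \<longrightarrow> slice_energy_le \<nu> t (E0 n) (Z n)"
    unfolding AE_all_countable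
  proof
    fix n
    show "AE t in lborel. t \<in> {0<..<T} \<longrightarrow> slice_energy_le \<nu> t (E0 n) (Z n)"
      using est(7)[of n]
    proof eventually_elim
      case (elim t)
      show ?case
      proof
        assume t: "t \<in> {0<..<T}"
        have "(\<lambda>x. fst (Z n (t, x))) = (\<lambda>x. w n (t, x))" using t by (auto simp: Z_def zero_ext_def)
        moreover have "zero_ext (cylinder t) (\<lambda>z. sym_part (snd (Z n z))) = zero_ext (cylinder t) (\<lambda>z. sym_part (TT n z))"
          using t by (auto simp: Z_def zero_ext_def indicator_def fun_eq_iff)
        ultimately show "slice_energy_le \<nu> t (E0 n) (Z n)"
          using elim t by (simp add: slice_energy_le_def)
      qed
    qed
  qed
  show ?thesis
  proof (intro exI[of _ Du] conjI)
    show "has_weak_jacobian_x T u Du"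
      unfolding has_weak_jacobian_x_def has_weak_grad_x_def
      by (intro allI weak_deriv_L2_imp_has_weak_deriv wd)
    show "L2_on ?\<Omega> Du"
      unfolding L2_on_iff by (intro square_integrable_zero_ext Du cylinder_borel)
    have "AE t in lborel. t \<noteq> (0::real)" "AE t in lborel. t \<noteq> T" by (rule AE_lborel_singleton)+
    with slices AE_sections[OF g_AE] AE_sections[OF fst_h]
    show "AE t in lborel. t \<in> {0..T} \<longrightarrow>
      (\<integral>\<^sup>+x. ennreal (1/2 * (norm (u (t, x)))\<^sup>2) \<partial>lborel) + ennreal \<nu> * sq_integral_upto t Du
      \<le> (\<integral>\<^sup>+x. ennreal (1/2 * (norm (u0 x))\<^sup>2) \<partial>lborel)"
    proof eventually_elim
      case (elim t)
      show ?case
      proof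
        assume "t \<in> {0..T}"
        then have t: "t \<in> {0<..<T}" using elim(4,5) by auto
        have h_slice: "slice_energy_le \<nu> t (1/2 * sq_norm lborel u0 + \<delta>) h" if "\<delta> > 0" for \<delta>
        proof (rule slice_energy_le_limit[OF gs h gh elim(2) \<open>\<nu> > 0\<close>])
          have "eventually (\<lambda>n. E0 n < 1/2 * sq_norm lborel u0 + \<delta>) sequentially"
            using E0_lim that by (intro order_tendstoD(2)) auto
          then obtain N where N: "\<And>n. n \<ge> N \<Longrightarrow> E0 n < 1/2 * sq_norm lborel u0 + \<delta>"
            by (auto simp: eventually_sequentially)
          have Z_slice: "slice_energy_le \<nu> t (1/2 * sq_norm lborel u0 + \<delta>) (Z n)" if "n \<ge> N" for n
            using elim(1) t N[OF that] by (blast intro: slice_energy_le_mono less_imp_le)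
          have "slice_energy_le \<nu> t (1/2 * sq_norm lborel u0 + \<delta>) (g n)" if "n \<ge> N" for n
          proof (rule slice_energy_le_tail_hull[where Z=Z and N=N])
            show "g n \<in> tail_hull Z N" using g[of n] tail_hull_antimono[OF that, of Z] by blast
          qed (use Z \<open>\<nu> > 0\<close> Z_slice in auto)
          then show "eventually (\<lambda>n. slice_energy_le \<nu> t (1/2 * sq_norm lborel u0 + \<delta>) (g n)) sequentially"
            by (auto simp: eventually_sequentially)
        qed
        define hu where "hu x = fst (h (t, x))" for x
        define S where "S = zero_ext (cylinder t) (\<lambda>z. sym_part (Du z))"
        have hu: "square_integrable lborel hu"
          using h_slice[of 1] by (simp add: slice_energy_le_def hu_def[abs_def])
        have "1/2 * sq_norm lborel hu + 2 * \<nu> * sq_norm lborel S \<le> 1/2 * sq_norm lborel u0 + \<delta>" if "\<delta> > 0" for \<delta>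
          using h_slice[OF that] by (simp add: slice_energy_le_def hu_def[abs_def] S_def Du_def)
        then have le: "1/2 * sq_norm lborel hu + 2 * \<nu> * sq_norm lborel S \<le> 1/2 * sq_norm lborel u0"
          by (rule field_le_epsilon)
        have grad: "2 * sq_norm lborel S = sq_norm lborel (zero_ext (cylinder t) Du)"
          unfolding S_def using t by (intro divergence_free_sq_norm_gradient[OF wd Du div]) auto
        have "(\<integral>\<^sup>+x. ennreal (1/2 * (norm (u (t, x)))\<^sup>2) \<partial>lborel) = (\<integral>\<^sup>+x. ennreal (1/2 * (norm (hu x))\<^sup>2) \<partial>lborel)"
          using elim(3) t by (intro nn_integral_cong_AE) (auto simp: hu_def)
        also have "\<dots> = ennreal (1/2 * sq_norm lborel hu)"
          unfolding sq_norm_def using square_integrableD(2)[OF hu]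
          by (subst nn_integral_eq_integral) auto
        finally have u_eq: "(\<integral>\<^sup>+x. ennreal (1/2 * (norm (u (t, x)))\<^sup>2) \<partial>lborel) = ennreal (1/2 * sq_norm lborel hu)" .
        have "sq_integral_upto t Du = (\<integral>\<^sup>+z. ennreal ((norm (zero_ext (cylinder t) Du z))\<^sup>2) \<partial>lborel)"
          unfolding sq_integral_upto_def by (intro nn_integral_cong) (auto simp: zero_ext_def indicator_def)
        also have "\<dots> = ennreal (sq_norm lborel (zero_ext (cylinder t) Du))"
          unfolding sq_norm_def
          using square_integrableD(2)[OF square_integrable_zero_ext[OF Du cylinder_borel]]
          by (intro nn_integral_eq_integral) auto
        finally have Du_eq: "sq_integral_upto t Du = ennreal (2 * sq_norm lborel S)" unfolding grad .
        have u0_eq: "(\<integral>\<^sup>+x. ennreal (1/2 * (norm (u0 x))\<^sup>2) \<partial>lborel) = ennreal (1/2 * sq_norm lborel u0)"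
          unfolding sq_norm_def using square_integrableD(2)[OF u0]
          by (subst nn_integral_eq_integral) auto
        have "ennreal (1/2 * sq_norm lborel hu) + ennreal \<nu> * ennreal (2 * sq_norm lborel S)
          = ennreal (1/2 * sq_norm lborel hu + 2 * \<nu> * sq_norm lborel S)"
          using \<open>\<nu> > 0\<close> by (simp add: mult_ac flip: ennreal_mult ennreal_plus)
        also have "\<dots> \<le> ennreal (1/2 * sq_norm lborel u0)" by (rule ennreal_leI[OF le])
        finally show "(\<integral>\<^sup>+x. ennreal (1/2 * (norm (u (t, x)))\<^sup>2) \<partial>lborel) + ennreal \<nu> * sq_integral_upto t Du
          \<le> (\<integral>\<^sup>+x. ennreal (1/2 * (norm (u0 x))\<^sup>2) \<partial>lborel)" unfolding u_eq Du_eq u0_eq .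
      qed
    qed
  qed
qed

end
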